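(* Let $E$ be an arbitrary directed graph, $K$ a field, and $L=L_K(E)$ the Leavitt path algebra. Suppose $$I=P_1^{r_1}\cap\cdots\cap P_m^{r_m}=\bigcap_{j\in J}Q_j^{s_j}$$ are two representations of an ideal $I$ of $L$ as irredundant intersections, where $J$ is an arbitrary index set, and the ideals $P_i^{r_i}$ (respectively $Q_j^{s_j}$) are powers of distinct prime ideals (that is, the $P_i$ are distinct prime ideals, the $Q_j$ are distinct prime ideals, and $r_i,s_j$ are positive integers). Then $|J|=m$ and $\{P_1^{r_1},\dots,P_m^{r_m}\}=\{Q_j^{s_j}:j\in J\}$.
   Context: A directed graph $E=(E^0,E^1,r,s)$ consists of sets $E^0$ (vertices), $E^1$ (edges) and maps $r,s:E^1\to E^0$; no finiteness or countability is assumed. A vertex is regular if it emits a nonempty finite set of edges. $L_K(E)$ is the (not necessarily unital) $K$-algebra generated by pairwise orthogonal idempotents $v\in E^0$ and elements $e,e^*$ ($e\in E^1$) subject to: $s(e)e=e=er(e)$; $r(e)e^*=e^*=e^*s(e)$; $e^*e=r(e)$ and $e^*f=0$ for edges $e\neq f$; $v=\sum_{s(e)=v}ee^*$ for every regular vertex $v$. "Ideal" means two-sided ideal; prime ideals are proper. An intersection $\bigcap_{i}A_i$ of ideals is irredundant if $\bigcap_{i\neq j}A_i\nsubseteq A_j$ for every index $j$ (equivalently, no member can be omitted without changing the intersection). *)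

theory Defs
  imports
    "HOL-Library.Poly_Mapping"
    "HOL-Algebra.QuotRing"
    "HOL-Algebra.Ideal_Product"
    "HOL-Algebra.Module"
    "Graph_Theory.Digraph"
begin

section \<open>Free algebras without unit\<close>

text \<open>
  The free monoid on \<open>'x\<close>, written additively so that the convolution product of
  \<^theory>\<open>HOL-Library.Poly_Mapping\<close> makes \<open>'x word \<Rightarrow>\<^sub>0 'k\<close> the free unital
  \<open>'k\<close>-algebra on \<open>'x\<close>.
\<close>

datatype 'x word = Word (letters: "'x list")

instantiation word :: (type) monoid_add
begin

definition zero_word :: "'x word" where
  "zero_word = Word []"

definition plus_word :: "'x word \<Rightarrow> 'x word \<Rightarrow> 'x word" where
  "plus_word u w = Word (letters u @ letters w)"

instance
  by standard (simp_all add: zero_word_def plus_word_def)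

end

type_synonym ('x, 'k) free_alg = "'x word \<Rightarrow>\<^sub>0 'k"

definition gen :: "'x \<Rightarrow> ('x, 'k::field) free_alg" where
  "gen x = Poly_Mapping.single (Word [x]) 1"

definition scale :: "'k::field \<Rightarrow> ('x, 'k) free_alg \<Rightarrow> ('x, 'k) free_alg" where
  "scale c a = Poly_Mapping.single 0 c * a"

text \<open>
  The free non-unital \<open>'k\<close>-algebra on the set \<open>X\<close>: combinations of nonempty words over \<open>X\<close>.
  The record field \<open>one\<close> is present only because the library's record demands it; its
  value is not in the carrier.
\<close>

definition free_algebra :: "'x set \<Rightarrow> ('k::field, ('x, 'k) free_alg) module" where
  "free_algebra X =
    \<lparr>carrier = {a. \<forall>w \<in> Poly_Mapping.keys a. letters w \<noteq> [] \<and> set (letters w) \<subseteq> X},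
     mult = (*), one = 1, zero = 0, add = (+), smult = scale\<rparr>"

text \<open>The two-sided algebra ideal generated by a set \<open>S\<close> of elements of an algebra \<open>A\<close>.\<close>

inductive_set gen_ideal :: "('k, 'a) module \<Rightarrow> 'a set \<Rightarrow> 'a set"
  for A :: "('k, 'a) module" and S :: "'a set" where
  gen: "a \<in> S \<Longrightarrow> a \<in> gen_ideal A S"
| zero: "\<zero>\<^bsub>A\<^esub> \<in> gen_ideal A S"
| add: "a \<in> gen_ideal A S \<Longrightarrow> b \<in> gen_ideal A S \<Longrightarrow> a \<oplus>\<^bsub>A\<^esub> b \<in> gen_ideal A S"
| smult: "a \<in> gen_ideal A S \<Longrightarrow> c \<odot>\<^bsub>A\<^esub> a \<in> gen_ideal A S"
| l_mult: "a \<in> gen_ideal A S \<Longrightarrow> x \<in> carrier A \<Longrightarrow> x \<otimes>\<^bsub>A\<^esub> a \<in> gen_ideal A S"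
| r_mult: "a \<in> gen_ideal A S \<Longrightarrow> x \<in> carrier A \<Longrightarrow> a \<otimes>\<^bsub>A\<^esub> x \<in> gen_ideal A S"

text \<open>\<open>A Quot N\<close>, together with the induced scalar multiplication.\<close>

definition quot_algebra :: "('k, 'a) module \<Rightarrow> 'a set \<Rightarrow> ('k, 'a set) module" where
  "quot_algebra A N =
    \<lparr>carrier = carrier (A Quot N), mult = mult (A Quot N), one = one (A Quot N),
     zero = zero (A Quot N), add = add (A Quot N),
     smult = (\<lambda>c Y. \<Union>y \<in> Y. N +>\<^bsub>A\<^esub> (c \<odot>\<^bsub>A\<^esub> y))\<rparr>"


section \<open>Leavitt path algebras\<close>

text \<open>
  A directed graph \<open>(E\<^sup>0, E\<^sup>1, r, s)\<close> is a \<^const>\<open>wf_digraph\<close> with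
  \<open>E\<^sup>0 = verts E\<close>, \<open>E\<^sup>1 = arcs E\<close>, \<open>r = head E\<close>, \<open>s = tail E\<close>; this allows loops,
  parallel edges and arbitrary cardinalities.
\<close>

definition regular_vertex :: "('v, 'e) pre_digraph \<Rightarrow> 'v \<Rightarrow> bool" where
  "regular_vertex E v \<longleftrightarrow> v \<in> verts E \<and> finite (out_arcs E v) \<and> out_arcs E v \<noteq> {}"

datatype ('v, 'e) lpa_gen = Vertex 'v | Edge 'e | Ghost 'e

abbreviation vx :: "'v \<Rightarrow> (('v, 'e) lpa_gen, 'k::field) free_alg" where
  "vx v \<equiv> gen (Vertex v)"

abbreviation ed :: "'e \<Rightarrow> (('v, 'e) lpa_gen, 'k::field) free_alg" where
  "ed e \<equiv> gen (Edge e)"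

abbreviation gh :: "'e \<Rightarrow> (('v, 'e) lpa_gen, 'k::field) free_alg" where
  "gh e \<equiv> gen (Ghost e)"

definition lpa_gens :: "('v, 'e) pre_digraph \<Rightarrow> ('v, 'e) lpa_gen set" where
  "lpa_gens E = Vertex ` verts E \<union> Edge ` arcs E \<union> Ghost ` arcs E"

text \<open>A member \<open>a\<close> of this set stands for the relation \<open>a = 0\<close>.\<close>

definition lpa_rels :: "('v, 'e) pre_digraph \<Rightarrow> (('v, 'e) lpa_gen, 'k::field) free_alg set" where
  "lpa_rels E =
    {vx v * vx v - vx v | v. v \<in> verts E}
    \<union> {vx v * vx w | v w. v \<in> verts E \<and> w \<in> verts E \<and> v \<noteq> w}
    \<union> {vx (tail E e) * ed e - ed e | e. e \<in> arcs E}
    \<union> {ed e * vx (head E e) - ed e | e. e \<in> arcs E}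
    \<union> {vx (head E e) * gh e - gh e | e. e \<in> arcs E}
    \<union> {gh e * vx (tail E e) - gh e | e. e \<in> arcs E}
    \<union> {gh e * ed e - vx (head E e) | e. e \<in> arcs E}
    \<union> {gh e * ed f | e f. e \<in> arcs E \<and> f \<in> arcs E \<and> e \<noteq> f}
    \<union> {vx v - (\<Sum>e \<in> out_arcs E v. ed e * gh e) | v. regular_vertex E v}"

text \<open>The first argument only fixes the coefficient field \<open>'k\<close>.\<close>

definition leavitt_path_algebra ::
    "'k::field itself \<Rightarrow> ('v, 'e) pre_digraph \<Rightarrow> ('k, (('v, 'e) lpa_gen, 'k) free_alg set) module" where
  "leavitt_path_algebra K E =
    quot_algebra (free_algebra (lpa_gens E)) (gen_ideal (free_algebra (lpa_gens E)) (lpa_rels E))"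


section \<open>Ideals of rings that need not have a unit\<close>

text \<open>
  The library's \<^const>\<open>ideal\<close> requires a unital ring, and its \<^const>\<open>primeideal\<close>
  a commutative one.
\<close>

definition two_sided_ideal :: "('a, 'm) ring_scheme \<Rightarrow> 'a set \<Rightarrow> bool" where
  "two_sided_ideal R I \<longleftrightarrow> additive_subgroup I R \<and>
    (\<forall>a \<in> I. \<forall>x \<in> carrier R. x \<otimes>\<^bsub>R\<^esub> a \<in> I \<and> a \<otimes>\<^bsub>R\<^esub> x \<in> I)"

definition prime_ideal :: "('a, 'm) ring_scheme \<Rightarrow> 'a set \<Rightarrow> bool" where
  "prime_ideal R P \<longleftrightarrow> two_sided_ideal R P \<and> P \<noteq> carrier R \<and>
    (\<forall>A B. two_sided_ideal R A \<and> two_sided_ideal R B \<and> A \<cdot>\<^bsub>R\<^esub> B \<subseteq> P \<longrightarrow> A \<subseteq> P \<or> B \<subseteq> P)"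

text \<open>
  The recursion starts at exponent 1, since \<open>carrier R \<cdot>\<^bsub>R\<^esub> I\<close> may differ from \<open>I\<close> when
  there is no unit.
\<close>

fun ideal_power :: "('a, 'm) ring_scheme \<Rightarrow> 'a set \<Rightarrow> nat \<Rightarrow> 'a set" where
  "ideal_power R I 0 = carrier R"
| "ideal_power R I (Suc 0) = I"
| "ideal_power R I (Suc (Suc n)) = ideal_power R I (Suc n) \<cdot>\<^bsub>R\<^esub> I"

text \<open>The empty intersection is the whole ring.\<close>

definition ideal_Inter :: "('a, 'm) ring_scheme \<Rightarrow> 'j set \<Rightarrow> ('j \<Rightarrow> 'a set) \<Rightarrow> 'a set" where
  "ideal_Inter R J A = carrier R \<inter> (\<Inter>j \<in> J. A j)"

definition irredundant :: "('a, 'm) ring_scheme \<Rightarrow> 'j set \<Rightarrow> ('j \<Rightarrow> 'a set) \<Rightarrow> bool" where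
  "irredundant R J A \<longleftrightarrow> (\<forall>j \<in> J. \<not> ideal_Inter R (J - {j}) A \<subseteq> A j)"

end

theory Submission
  imports Defs "Graph_Theory.Arc_Walk" "HOL-Library.Sublist" "HOL-Computational_Algebra.Polynomial"
begin

text \<open>
  Call \<open>v - (\<Sum>e\<in>F. e e\<^sup>*)\<close>, for a finite set \<open>F\<close> of edges leaving \<open>v\<close>, a diagonal idempotent. For a prime
  ideal \<open>P\<close> let \<open>G\<close> be the ideal generated by the diagonal idempotents in \<open>P\<close> and the vertices
  \<open>v \<notin> P\<close> for which \<open>P\<close> contains some \<open>v + (\<Sum>i\<in>I. k\<^sub>i d\<^sub>i)\<close> with nontrivial closed walks \<open>d\<^sub>i\<close> at \<open>v\<close>.
  Then:
  \<^item> every \<open>x \<in> G\<close> has a left unit in \<open>G\<close>, since diagonal idempotents commute;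
  \<^item> \<open>P \<subseteq> G\<close>, by the reduction of an element of \<open>P - G\<close> to a combination of real paths;
  \<^item> every ideal \<open>X\<close> not below \<open>P\<close> satisfies \<open>G \<subseteq> X + P\<close>. Indeed, if that sum in \<open>P\<close> has the least
    number of terms, then all closed walks at \<open>v\<close> are powers of one cycle \<open>c\<close> without exits modulo \<open>P\<close>,
    so the corner of \<open>L/P\<close> at \<open>v\<close> is a domain generated by the algebraic element \<open>c\<close>, hence a field.

  Consequently a prime \<open>P\<close> properly below an ideal \<open>Q\<close> lies in all powers of \<open>Q\<close>
  (\<open>P \<subseteq> G = G\<^sup>n \<subseteq> Q\<^sup>n\<close>), and \<open>X \<inter> P\<^sup>r \<subseteq> P\<^sup>s\<close> with \<open>X\<close> not below \<open>P\<close> and \<open>r < s\<close> forces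
  \<open>P\<^sup>r = P\<^sup>s\<close> (as \<open>P\<^sup>r = G P\<^sup>r \<subseteq> X P\<^sup>r + P\<^sup>r\<^sup>+\<^sup>1\<close>). These two properties give uniqueness: the primes of the
  finite decomposition are pairwise incomparable, each of them occurs among the \<open>Q\<^sub>j\<close> by irredundancy,
  and the exponents match by the second property.
\<close>

section \<open>Irredundant intersections of prime powers\<close>

text \<open>Two obstacles shape the proof. For infinite \<open>J\<close>, a prime that contains the
  intersection need not contain a member, so primeness cannot be applied to the \<open>Q j\<close>
  directly. But every \<open>Q j\<close> contains some \<open>P k\<close>, so the \<open>Q j\<close>
  fall into finitely many families, one above each \<open>P k\<close>. The intersection of such a
  family contains a power of \<open>P k\<close>, and primeness is applied to these finitely many
  intersections. The second obstacle is the missing unit together with vertices that emit infinitely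
  many edges: at such a vertex no diagonal idempotent is forced to be zero, so even a graded ideal
  is not determined by its vertices. Admitting all diagonal idempotents as generators treats every
  vertex alike. The closed walks come from the elements of a prime: multiplying a combination of
  real paths by the ghost of a shortest one turns it into a vertex plus closed walks.\<close>

lemma ideal_InterI: "x \<in> carrier R \<Longrightarrow> (\<And>j. j \<in> J \<Longrightarrow> x \<in> A j) \<Longrightarrow> x \<in> ideal_Inter R J A"
  by (simp add: ideal_Inter_def)

lemma ideal_Inter_insert_remove:
  "j \<in> J \<Longrightarrow> ideal_Inter R J A = ideal_Inter R (J - {j}) A \<inter> A j"
  by (auto simp: ideal_Inter_def)

lemma irredundant_pow_mono:
  assumes "irredundant R J A" "i \<in> J" "j \<in> J" "i \<noteq> j"
  shows "\<not> A i \<subseteq> A j"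
proof
  assume "A i \<subseteq> A j"
  then have "ideal_Inter R (J - {j}) A \<subseteq> A j"
    using assms by (auto simp: ideal_Inter_def)
  then show False
    using assms by (auto simp: irredundant_def)
qed

section \<open>Two-sided ideals, their products and powers in rings without unit\<close>

locale nonunital_ring = abelian_group R for R (structure) +
  assumes mult_closed [intro, simp]: "\<lbrakk>x \<in> carrier R; y \<in> carrier R\<rbrakk> \<Longrightarrow> x \<otimes> y \<in> carrier R"
    and mult_assoc: "\<lbrakk>x \<in> carrier R; y \<in> carrier R; z \<in> carrier R\<rbrakk> \<Longrightarrow> (x \<otimes> y) \<otimes> z = x \<otimes> (y \<otimes> z)"
    and distrib_right: "\<lbrakk>x \<in> carrier R; y \<in> carrier R; z \<in> carrier R\<rbrakk> \<Longrightarrow> (x \<oplus> y) \<otimes> z = x \<otimes> z \<oplus> y \<otimes> z"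
    and distrib_left: "\<lbrakk>x \<in> carrier R; y \<in> carrier R; z \<in> carrier R\<rbrakk> \<Longrightarrow> z \<otimes> (x \<oplus> y) = z \<otimes> x \<oplus> z \<otimes> y"
begin

lemma two_sided_idealI:
  assumes "I \<subseteq> carrier R" "\<zero> \<in> I"
    and "\<And>a b. a \<in> I \<Longrightarrow> b \<in> I \<Longrightarrow> a \<oplus> b \<in> I"
    and "\<And>a. a \<in> I \<Longrightarrow> \<ominus> a \<in> I"
    and "\<And>a x. a \<in> I \<Longrightarrow> x \<in> carrier R \<Longrightarrow> x \<otimes> a \<in> I"
    and "\<And>a x. a \<in> I \<Longrightarrow> x \<in> carrier R \<Longrightarrow> a \<otimes> x \<in> I"
  shows "two_sided_ideal R I"
  unfolding two_sided_ideal_def additive_subgroup_def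
proof (intro conjI ballI)
  show "subgroup I (add_monoid R)"
    by (rule add.subgroupI) (use assms in \<open>auto simp: a_inv_def\<close>)
qed (use assms in auto)

context
  fixes I assumes I: "two_sided_ideal R I"
begin

interpretation I: additive_subgroup I R
  using I by (simp add: two_sided_ideal_def)

lemma tsi_subset: "I \<subseteq> carrier R"
  by (rule I.a_subset)

lemma tsi_zero: "\<zero> \<in> I"
  by (rule I.zero_closed)

lemma tsi_add: "a \<in> I \<Longrightarrow> b \<in> I \<Longrightarrow> a \<oplus> b \<in> I"
  by (rule I.a_closed)

lemma tsi_minus: "a \<in> I \<Longrightarrow> \<ominus> a \<in> I"
  using subgroup.m_inv_closed[OF I.a_subgroup] by (simp add: a_inv_def)

lemma tsi_lmult: "a \<in> I \<Longrightarrow> x \<in> carrier R \<Longrightarrow> x \<otimes> a \<in> I"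
  using I by (simp add: two_sided_ideal_def)

lemma tsi_rmult: "a \<in> I \<Longrightarrow> x \<in> carrier R \<Longrightarrow> a \<otimes> x \<in> I"
  using I by (simp add: two_sided_ideal_def)

end

lemma ideal_prod_least:
  assumes "\<And>a b. a \<in> A \<Longrightarrow> b \<in> B \<Longrightarrow> a \<otimes> b \<in> C"
    and "\<And>x y. x \<in> C \<Longrightarrow> y \<in> C \<Longrightarrow> x \<oplus> y \<in> C"
  shows "A \<cdot> B \<subseteq> C"
proof
  fix x assume "x \<in> A \<cdot> B"
  then show "x \<in> C" by induction (use assms in auto)
qed

lemma ideal_prod_mono: "A \<subseteq> A' \<Longrightarrow> B \<subseteq> B' \<Longrightarrow> A \<cdot> B \<subseteq> A' \<cdot> B'"
  by (rule ideal_prod_least) (auto intro: ideal_prod.intros)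

lemma two_sided_ideal_carrier: "two_sided_ideal R (carrier R)"
  by (rule two_sided_idealI) auto

lemma two_sided_ideal_prod:
  assumes A: "two_sided_ideal R A" and B: "two_sided_ideal R B"
  shows "two_sided_ideal R (A \<cdot> B)"
proof -
  note cA = tsi_subset[OF A, THEN subsetD] and cB = tsi_subset[OF B, THEN subsetD]
  have sub: "A \<cdot> B \<subseteq> carrier R"
    by (rule ideal_prod_least) (auto dest: cA cB)
  show ?thesis
  proof (rule two_sided_idealI)
    \<comment> \<open>\<open>ideal_prod\<close> is generated by products and sums only, so zero has
      to be exhibited as a product.\<close>
    show "\<zero> \<in> A \<cdot> B"
    proof -
      have "\<zero> \<otimes> \<zero> \<oplus> \<zero> \<otimes> \<zero> = \<zero> \<otimes> \<zero>"
        using distrib_right[of \<zero> \<zero> \<zero>] by simp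
      then have "\<zero> \<otimes> \<zero> = \<zero>"
        using add.l_cancel_one by simp
      then show ?thesis
        using ideal_prod.prod[OF tsi_zero[OF A] tsi_zero[OF B]] by metis
    qed
  next
    fix a x assume a: "a \<in> A \<cdot> B" and x: "x \<in> carrier R"
    show "x \<otimes> a \<in> A \<cdot> B" using a
    proof induction
      case (prod i j)
      then have "x \<otimes> (i \<otimes> j) = (x \<otimes> i) \<otimes> j"
        using x cA cB by (simp add: mult_assoc)
      with prod show ?case
        by (auto intro!: ideal_prod.prod tsi_lmult[OF A] x)
    next
      case (sum s t)
      with sub x show ?case
        by (auto simp: distrib_left subset_eq intro!: ideal_prod.sum)
    qed
    show "a \<otimes> x \<in> A \<cdot> B" using a
    proof induction
      case (prod i j)
      then have "(i \<otimes> j) \<otimes> x = i \<otimes> (j \<otimes> x)"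
        using x cA cB by (simp add: mult_assoc)
      with prod show ?case
        by (auto intro!: ideal_prod.prod tsi_rmult[OF B] x)
    next
      case (sum s t)
      with sub x show ?case
        by (auto simp: distrib_right subset_eq intro!: ideal_prod.sum)
    qed
  next
    fix a assume "a \<in> A \<cdot> B"
    then show "\<ominus> a \<in> A \<cdot> B"
    proof induction
      case (prod i j)
      then have c: "i \<in> carrier R" "j \<in> carrier R" using cA cB by auto
      have "\<zero> \<otimes> j \<oplus> \<zero> \<otimes> j = \<zero> \<otimes> j"
        using distrib_right[of \<zero> \<zero> j] c by simp
      then have "\<zero> \<otimes> j = \<zero>"
        using add.l_cancel_one c by simp
      then have "i \<otimes> j \<oplus> (\<ominus> i) \<otimes> j = \<zero>"
        using distrib_right[of i "\<ominus> i" j] c by (simp add: r_neg)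
      then have "\<ominus> (i \<otimes> j) = (\<ominus> i) \<otimes> j"
        using c by (metis a_inv_closed mult_closed a_comm minus_equality)
      with prod show ?case
        by (auto intro!: ideal_prod.prod tsi_minus[OF A])
    next
      case (sum s t)
      with sub show ?case
        by (auto simp: minus_add subset_eq intro!: ideal_prod.sum)
    qed
  qed (use sub in \<open>auto intro: ideal_prod.sum\<close>)
qed

lemma ideal_prod_subset_Int:
  assumes "two_sided_ideal R A" "two_sided_ideal R B"
  shows "A \<cdot> B \<subseteq> A \<inter> B"
  by (rule ideal_prod_least)
     (auto intro: tsi_add[OF assms(1)] tsi_add[OF assms(2)] tsi_rmult[OF assms(1)]
        tsi_lmult[OF assms(2)] dest: tsi_subset[OF assms(1), THEN subsetD] tsi_subset[OF assms(2), THEN subsetD])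

lemma two_sided_ideal_power:
  "two_sided_ideal R P \<Longrightarrow> two_sided_ideal R (ideal_power R P n)"
proof (induction n)
  case 0
  then show ?case by (simp add: two_sided_ideal_carrier)
next
  case (Suc n)
  then show ?case by (cases n) (auto intro: two_sided_ideal_prod)
qed

lemma ideal_power_subset:
  assumes "two_sided_ideal R P" "n \<ge> 1"
  shows "ideal_power R P n \<subseteq> P"
proof -
  obtain k where k: "n = Suc k" using assms(2) by (cases n) auto
  show ?thesis
  proof (cases k)
    case (Suc i)
    then show ?thesis
      using ideal_prod_subset_Int[OF two_sided_ideal_power[OF assms(1), of k] assms(1)] k by auto
  qed (simp add: k)
qed

lemma ideal_power_antimono:
  assumes P: "two_sided_ideal R P" and "1 \<le> n" "n \<le> k"
  shows "ideal_power R P k \<subseteq> ideal_power R P n"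
  using \<open>n \<le> k\<close>
proof (induction k rule: dec_induct)
  case (step k)
  then obtain k' where "k = Suc k'" using \<open>1 \<le> n\<close> by (cases k) auto
  then have "ideal_power R P (Suc k) \<subseteq> ideal_power R P k"
    using ideal_prod_subset_Int[OF two_sided_ideal_power[OF P, of k] P] by auto
  with step show ?case by blast
qed auto

text \<open>Powers grow by a factor on the right, so a factor on the left is carried through the
  recursion by associativity. The left side matters because the units of the covering set
  \<open>G\<close> act from the left.\<close>

lemma mult_ideal_power:
  assumes P: "two_sided_ideal R P" and p: "p \<in> P" and "y \<in> ideal_power R P n" "n \<ge> 1"
  shows "p \<otimes> y \<in> ideal_power R P (Suc n)"
  using assms(3,4)
proof (induction n arbitrary: y)
  case (Suc n)
  note cP = tsi_subset[OF P, THEN subsetD]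
  show ?case
  proof (cases n)
    case 0
    with Suc p show ?thesis by (auto intro: ideal_prod.prod)
  next
    case (Suc k)
    have sub: "ideal_power R P n \<subseteq> carrier R"
      using tsi_subset[OF two_sided_ideal_power[OF P]] .
    from Suc.prems Suc have "y \<in> ideal_power R P n \<cdot> P" by simp
    then have "p \<otimes> y \<in> ideal_power R P (Suc n) \<cdot> P"
    proof induction
      case (prod i j)
      then have "p \<otimes> (i \<otimes> j) = (p \<otimes> i) \<otimes> j"
        using p cP sub by (auto simp: mult_assoc)
      moreover have "p \<otimes> i \<in> ideal_power R P (Suc n)"
        using Suc.IH[of i] prod Suc by auto
      ultimately show ?case
        using prod by (auto intro: ideal_prod.prod)
    next
      case (sum s t)
      have "ideal_power R P n \<cdot> P \<subseteq> carrier R"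
        using tsi_subset[OF two_sided_ideal_prod[OF two_sided_ideal_power[OF P] P]] .
      with sum p cP have "p \<otimes> (s \<oplus> t) = p \<otimes> s \<oplus> p \<otimes> t"
        by (auto intro!: distrib_left)
      with sum show ?case by (auto intro: ideal_prod.sum)
    qed
    then show ?thesis by simp
  qed
qed simp

lemma two_sided_ideal_Inter:
  assumes "\<And>j. j \<in> J \<Longrightarrow> two_sided_ideal R (A j)"
  shows "two_sided_ideal R (ideal_Inter R J A)"
  by (rule two_sided_idealI)
     (auto simp: ideal_Inter_def dest: assms[THEN tsi_zero] assms[THEN tsi_add] assms[THEN tsi_minus]
       assms[THEN tsi_lmult] assms[THEN tsi_rmult])

section \<open>Prime ideals\<close>

lemma prime_idealD:
  assumes "prime_ideal R P"
  shows "two_sided_ideal R P" "\<not> carrier R \<subseteq> P"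
    and "two_sided_ideal R A \<Longrightarrow> two_sided_ideal R B \<Longrightarrow> A \<cdot> B \<subseteq> P \<Longrightarrow> A \<subseteq> P \<or> B \<subseteq> P"
  using assms tsi_subset unfolding prime_ideal_def by blast+

lemma prime_ideal_Int:
  assumes "prime_ideal R P" "two_sided_ideal R A" "two_sided_ideal R B" "A \<inter> B \<subseteq> P"
  shows "A \<subseteq> P \<or> B \<subseteq> P"
  using prime_idealD(3)[OF assms(1-3)] ideal_prod_subset_Int[OF assms(2,3)] assms(4) by blast

lemma prime_ideal_finite_Inter:
  assumes P: "prime_ideal R P" and "finite J"
    and "\<And>j. j \<in> J \<Longrightarrow> two_sided_ideal R (A j)"
    and "ideal_Inter R J A \<subseteq> P"
  shows "\<exists>j \<in> J. A j \<subseteq> P"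
  using assms(2-)
proof (induction J rule: finite_induct)
  case empty
  then show ?case using prime_idealD(2)[OF P] by (auto simp: ideal_Inter_def)
next
  case (insert i J)
  have "A i \<inter> ideal_Inter R J A \<subseteq> P"
    using insert.prems(2) by (auto simp: ideal_Inter_def)
  with prime_ideal_Int[OF P, of "A i" "ideal_Inter R J A"] insert.prems(1)
  have "A i \<subseteq> P \<or> ideal_Inter R J A \<subseteq> P"
    by (auto intro: two_sided_ideal_Inter)
  with insert show ?case by auto
qed

lemma prime_ideal_power:
  assumes P: "prime_ideal R P" and Q: "two_sided_ideal R Q" and "n \<ge> 1" "ideal_power R Q n \<subseteq> P"
  shows "Q \<subseteq> P"
  using assms(3,4)
proof (induction n)
  case (Suc n)
  show ?case
  proof (cases n)
    case (Suc k)
    with Suc.prems Suc.IH show ?thesis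
      using prime_idealD(3)[OF P two_sided_ideal_power[OF Q, of n] Q] by auto
  qed (use Suc in auto)
qed simp

text \<open>The product criterion is applied to \<open>A\<close>, the elements x with x f b in
  \<open>P\<close> for all f, and to \<open>B\<close>, the elements y with x f y in \<open>P\<close>
  for all f and all x in \<open>A\<close>. Both are two-sided ideals, with a in \<open>A\<close> and
  b in \<open>B\<close>. A left unit u of y gives x y = x u y, so the product of \<open>A\<close>
  and \<open>B\<close> lies in \<open>P\<close>.\<close>

lemma prime_elementwise:
  assumes P: "prime_ideal R P"
    and units: "\<And>y. y \<in> carrier R \<Longrightarrow> \<exists>u \<in> carrier R. u \<otimes> y = y"
    and a: "a \<in> carrier R" and b: "b \<in> carrier R"
    and prod: "\<And>f. f \<in> carrier R \<Longrightarrow> a \<otimes> f \<otimes> b \<in> P"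
  shows "a \<in> P \<or> b \<in> P"
proof -
  note I = prime_idealD(1)[OF P]
  note [simp] = tsi_zero[OF I]
  note cl = tsi_add[OF I] tsi_minus[OF I] tsi_lmult[OF I] tsi_rmult[OF I]
  have zl: "\<zero> \<otimes> x = \<zero>" if "x \<in> carrier R" for x
    using distrib_right[of \<zero> \<zero> x] that add.l_cancel_one[of "\<zero> \<otimes> x" "\<zero> \<otimes> x"] by simp
  have zr: "x \<otimes> \<zero> = \<zero>" if "x \<in> carrier R" for x
    using distrib_left[of \<zero> \<zero> x] that add.l_cancel_one[of "x \<otimes> \<zero>" "x \<otimes> \<zero>"] by simp
  have nl: "(\<ominus> x) \<otimes> y = \<ominus> (x \<otimes> y)" if "x \<in> carrier R" "y \<in> carrier R" for x y
    using distrib_right[of "\<ominus> x" x y] zl[of y] that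
    by (simp add: l_neg minus_equality)
  have nr: "y \<otimes> (\<ominus> x) = \<ominus> (y \<otimes> x)" if "x \<in> carrier R" "y \<in> carrier R" for x y
    using distrib_left[of "\<ominus> x" x y] zr[of y] that
    by (simp add: l_neg minus_equality)
  define A where "A = {x \<in> carrier R. \<forall>f \<in> carrier R. x \<otimes> f \<otimes> b \<in> P}"
  define B where "B = {y \<in> carrier R. \<forall>x \<in> A. \<forall>f \<in> carrier R. x \<otimes> f \<otimes> y \<in> P}"
  have A: "two_sided_ideal R A"
  proof (rule two_sided_idealI)
    fix x y assume *: "x \<in> A" "y \<in> carrier R"
    then have x: "x \<in> carrier R" "\<And>f. f \<in> carrier R \<Longrightarrow> x \<otimes> f \<otimes> b \<in> P"
      by (auto simp: A_def)
    have "y \<otimes> x \<otimes> f \<otimes> b = y \<otimes> (x \<otimes> f \<otimes> b)" "x \<otimes> y \<otimes> f \<otimes> b = x \<otimes> (y \<otimes> f) \<otimes> b"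
      if "f \<in> carrier R" for f
      using that x(1) * b by (simp_all add: mult_assoc)
    with x * show "y \<otimes> x \<in> A" "x \<otimes> y \<in> A"
      by (auto simp: A_def intro: cl(3))
  qed (use b cl in \<open>auto simp: A_def zl nl distrib_right\<close>)
  have B: "two_sided_ideal R B"
  proof (rule two_sided_idealI)
    fix x y assume *: "x \<in> B" "y \<in> carrier R"
    show "y \<otimes> x \<in> B"
    proof -
      have "c \<otimes> f \<otimes> (y \<otimes> x) \<in> P" if "c \<in> A" "f \<in> carrier R" for c f
      proof -
        have "c \<otimes> (f \<otimes> y) \<otimes> x \<in> P"
          using * that by (auto simp: B_def)
        then show ?thesis
          using * that by (auto simp: B_def A_def mult_assoc)
      qed
      with * show ?thesis by (auto simp: B_def)
    qed
    show "x \<otimes> y \<in> B"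
    proof -
      have "c \<otimes> f \<otimes> (x \<otimes> y) \<in> P" if "c \<in> A" "f \<in> carrier R" for c f
      proof -
        have "c \<otimes> f \<otimes> x \<otimes> y \<in> P"
          using * that by (auto simp: B_def intro: cl)
        then show ?thesis
          using * that by (auto simp: B_def A_def mult_assoc)
      qed
      with * show ?thesis by (auto simp: B_def)
    qed
  qed (use cl in \<open>auto simp: B_def A_def zr nr distrib_left\<close>)
  have "A \<cdot> B \<subseteq> P"
  proof (rule ideal_prod_least)
    fix x y assume *: "x \<in> A" "y \<in> B"
    then obtain u where "u \<in> carrier R" "u \<otimes> y = y" using units[of y] by (auto simp: B_def)
    with * show "x \<otimes> y \<in> P"
      by (auto simp: A_def B_def mult_assoc) (metis mult_assoc)
  qed (auto intro: cl)
  then consider "A \<subseteq> P" | "B \<subseteq> P" using prime_idealD(3)[OF P A B] by blast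
  then show ?thesis
  proof cases
    case 1 then show ?thesis using a prod by (auto simp: A_def)
  next
    case 2 then show ?thesis using b by (auto simp: A_def B_def)
  qed
qed

end

text \<open>In a Leavitt path algebra the set \<open>G\<close> below is \<open>P\<close> itself if \<open>P\<close> is graded; otherwise
  \<open>G/gr(P)\<close> is generated by the vertices of a cycle without exits.\<close>

locale covered_primes_ring = nonunital_ring R for R (structure) +
  assumes prime_cover: "prime_ideal R P \<Longrightarrow> \<exists>G. P \<subseteq> G \<and> (\<forall>x \<in> G. \<exists>g \<in> G. g \<otimes> x = x) \<and>
      (\<forall>X. two_sided_ideal R X \<and> \<not> X \<subseteq> P \<longrightarrow> G \<subseteq> X <+>\<^bsub>R\<^esub> P)"
begin

section \<open>Comparison of prime powers and uniqueness\<close>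

lemma prime_subset_power:
  assumes P: "prime_ideal R P" and Q: "two_sided_ideal R Q" and "P \<subseteq> Q" "P \<noteq> Q"
  shows "P \<subseteq> ideal_power R Q n"
proof -
  from prime_cover[OF P] obtain G where PG: "P \<subseteq> G"
    and unit: "\<And>x. x \<in> G \<Longrightarrow> \<exists>g \<in> G. g \<otimes> x = x" and "G \<subseteq> Q <+>\<^bsub>R\<^esub> P"
    using Q assms by (metis subset_antisym)
  then have GQ: "G \<subseteq> Q"
    using \<open>P \<subseteq> Q\<close> tsi_add[OF Q] by (fastforce simp: set_add_def')
  have "G \<subseteq> ideal_power R Q n"
  proof (induction n)
    case 0
    then show ?case using GQ tsi_subset[OF Q] by auto
  next
    case (Suc n)
    have "x \<in> ideal_power R Q n \<cdot> Q" if "x \<in> G" for x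
      using unit[OF that] Suc GQ that ideal_prod.prod[of _ "ideal_power R Q n" x Q R] by force
    \<comment> \<open>The first power is \<open>Q\<close> itself, not the product of the ring with
      \<open>Q\<close>; hence the case split.\<close>
    then show ?case using GQ by (cases n) auto
  qed
  with PG show ?thesis by blast
qed

lemma prime_power_eq:
  assumes P: "prime_ideal R P" and X: "two_sided_ideal R X" "\<not> X \<subseteq> P"
    and le: "X \<inter> ideal_power R P r \<subseteq> ideal_power R P s" and "1 \<le> r" "r \<le> s"
  shows "ideal_power R P r = ideal_power R P s"
proof (cases "r = s")
  case False
  with \<open>r \<le> s\<close> have "Suc r \<le> s" by simp
  note I = prime_idealD(1)[OF P]
  from prime_cover[OF P] X obtain G where PG: "P \<subseteq> G"
    and unit: "\<And>x. x \<in> G \<Longrightarrow> \<exists>g \<in> G. g \<otimes> x = x" and G: "G \<subseteq> X <+>\<^bsub>R\<^esub> P"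
    by metis
  have base: "ideal_power R P r \<subseteq> ideal_power R P (Suc r)"
  proof
    fix y assume y: "y \<in> ideal_power R P r"
    then have yc: "y \<in> carrier R" "y \<in> G"
      using ideal_power_subset[OF I \<open>1 \<le> r\<close>] PG tsi_subset[OF I] by auto
    then obtain x p where x: "x \<in> X" and p: "p \<in> P" and eq: "(x \<oplus> p) \<otimes> y = y"
      using unit G by (fastforce simp: set_add_def')
    have "x \<otimes> y \<in> X \<inter> ideal_power R P r"
      using x y yc tsi_rmult[OF X(1)] tsi_lmult[OF two_sided_ideal_power[OF I]] tsi_subset[OF X(1)]
      by auto
    then have "x \<otimes> y \<in> ideal_power R P (Suc r)"
      using le ideal_power_antimono[OF I _ \<open>Suc r \<le> s\<close>] by auto
    moreover have "p \<otimes> y \<in> ideal_power R P (Suc r)"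
      using mult_ideal_power[OF I p y \<open>1 \<le> r\<close>] .
    moreover have "y = x \<otimes> y \<oplus> p \<otimes> y"
      using eq x p yc tsi_subset[OF I] tsi_subset[OF X(1)] distrib_right[of x p y] by auto
    ultimately show "y \<in> ideal_power R P (Suc r)"
      using tsi_add[OF two_sided_ideal_power[OF I]] by metis
  qed
  \<comment> \<open>Multiplying the inclusion of the r-th in the n-th power by \<open>P\<close>
    raises both exponents by one, and \<open>base\<close> lowers the left one again.\<close>
  have "ideal_power R P r \<subseteq> ideal_power R P s"
    using \<open>r \<le> s\<close>
  proof (induction s rule: dec_induct)
    case (step n)
    then obtain k where k: "n = Suc k" using \<open>1 \<le> r\<close> by (cases n) auto
    obtain j where j: "r = Suc j" using \<open>1 \<le> r\<close> by (cases r) auto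
    have "ideal_power R P (Suc r) \<subseteq> ideal_power R P (Suc n)"
      using ideal_prod_mono[OF step.IH order_refl[of P]] by (simp add: k j)
    with base show ?case by blast
  qed auto
  then show ?thesis
    using ideal_power_antimono[OF I \<open>1 \<le> r\<close> \<open>r \<le> s\<close>] by blast
qed auto

text \<open>A prime properly below \<open>Q j\<close> lies in every power of \<open>Q j\<close>, so
  its own power would make the component at j redundant.\<close>

lemma irredundant_incomparable:
  assumes "\<And>j. j \<in> J \<Longrightarrow> prime_ideal R (Q j)" "\<And>j. j \<in> J \<Longrightarrow> s j \<ge> 1"
    and "irredundant R J (\<lambda>j. ideal_power R (Q j) (s j))" "inj_on Q J"
    and "i \<in> J" "j \<in> J" "Q i \<subseteq> Q j"
  shows "i = j"
proof (rule ccontr)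
  assume "i \<noteq> j"
  then have "Q i \<noteq> Q j" using assms(4-6) by (auto dest: inj_onD)
  then have "Q i \<subseteq> ideal_power R (Q j) (s j)"
    using prime_subset_power[of "Q i" "Q j"] assms prime_idealD(1) by metis
  then have "ideal_power R (Q i) (s i) \<subseteq> ideal_power R (Q j) (s j)"
    using ideal_power_subset[of "Q i" "s i"] assms prime_idealD(1) by blast
  with irredundant_pow_mono[OF assms(3,5,6) \<open>i \<noteq> j\<close>] show False by blast
qed

text \<open>If the other components met inside \<open>Q j\<close>, primeness would put one of them,
  hence its prime, below \<open>Q j\<close>, against incomparability. So their intersection can
  serve as the ideal \<open>X\<close> of \<open>prime_power_eq\<close>.\<close>

lemma prime_power_exponents:
  assumes Q: "\<And>j. j \<in> J \<Longrightarrow> prime_ideal R (Q j)" and s: "\<And>j. j \<in> J \<Longrightarrow> s j \<ge> 1"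
    and irr: "irredundant R J (\<lambda>j. ideal_power R (Q j) (s j))" "inj_on Q J" and "finite J"
    and "j \<in> J" "s j \<le> n"
    and le: "ideal_Inter R J (\<lambda>j. ideal_power R (Q j) (s j)) \<subseteq> ideal_power R (Q j) n"
  shows "ideal_power R (Q j) (s j) = ideal_power R (Q j) n"
proof (rule prime_power_eq)
  let ?X = "ideal_Inter R (J - {j}) (\<lambda>j. ideal_power R (Q j) (s j))"
  have pow: "two_sided_ideal R (ideal_power R (Q i) (s i))" if "i \<in> J" for i
    using Q[OF that] by (intro two_sided_ideal_power prime_idealD)
  show "two_sided_ideal R ?X"
    using pow by (auto intro: two_sided_ideal_Inter)
  show "\<not> ?X \<subseteq> Q j"
  proof
    assume "?X \<subseteq> Q j"
    then obtain i where i: "i \<in> J" "i \<noteq> j" "ideal_power R (Q i) (s i) \<subseteq> Q j"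
      using prime_ideal_finite_Inter[OF Q[OF \<open>j \<in> J\<close>], of "J - {j}" "\<lambda>j. ideal_power R (Q j) (s j)"]
        pow \<open>finite J\<close> by auto
    then have "Q i \<subseteq> Q j"
      using prime_ideal_power[OF Q[OF \<open>j \<in> J\<close>] prime_idealD(1)[OF Q]] s by blast
    with i irredundant_incomparable[OF Q s irr] \<open>j \<in> J\<close> show False by blast
  qed
  show "?X \<inter> ideal_power R (Q j) (s j) \<subseteq> ideal_power R (Q j) n"
    using le \<open>j \<in> J\<close> by (simp add: ideal_Inter_insert_remove[OF \<open>j \<in> J\<close>])
qed (use assms in auto)

theorem irredundant_prime_powers_unique:
  assumes P: "\<And>i. i \<in> M \<Longrightarrow> prime_ideal R (P i)" and r: "\<And>i. i \<in> M \<Longrightarrow> r i \<ge> 1"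
    and injP: "inj_on P M" and irrP: "irredundant R M (\<lambda>i. ideal_power R (P i) (r i))"
    and "finite M"
    and Q: "\<And>j. j \<in> J \<Longrightarrow> prime_ideal R (Q j)" and s: "\<And>j. j \<in> J \<Longrightarrow> s j \<ge> 1"
    and injQ: "inj_on Q J" and irrQ: "irredundant R J (\<lambda>j. ideal_power R (Q j) (s j))"
    and eq: "ideal_Inter R M (\<lambda>i. ideal_power R (P i) (r i)) =
      ideal_Inter R J (\<lambda>j. ideal_power R (Q j) (s j))"
  shows "finite J \<and> card J = card M \<and>
    (\<lambda>i. ideal_power R (P i) (r i)) ` M = (\<lambda>j. ideal_power R (Q j) (s j)) ` J"
proof -
  let ?P = "\<lambda>i. ideal_power R (P i) (r i)" and ?Q = "\<lambda>j. ideal_power R (Q j) (s j)"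
  note P' = prime_idealD(1)[OF P] and Q' = prime_idealD(1)[OF Q]
  have pow: "two_sided_ideal R (?P i)" if "i \<in> M" for i
    by (intro two_sided_ideal_power P' that)
  have powQ: "two_sided_ideal R (?Q j)" if "j \<in> J" for j
    by (intro two_sided_ideal_power Q' that)
  have below: "\<exists>i \<in> M. P i \<subseteq> Q j" if j: "j \<in> J" for j
  proof -
    have "ideal_Inter R M ?P \<subseteq> Q j"
      using ideal_power_subset[OF Q'[OF j] s[OF j]] j by (subst eq) (auto simp: ideal_Inter_def)
    then obtain i where "i \<in> M" "?P i \<subseteq> Q j"
      using prime_ideal_finite_Inter[OF Q[OF j] \<open>finite M\<close>, of ?P] pow by blast
    then show ?thesis
      using prime_ideal_power[OF Q[OF j] P'] r by blast
  qed
  \<comment> \<open>By \<open>below\<close> these families cover \<open>J\<close>. They may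
    overlap.\<close>
  define J' where "J' k = {j \<in> J. P k \<subseteq> Q j}" for k
  define A where "A k = ideal_Inter R (J' k) ?Q" for k
  have idA: "two_sided_ideal R (A k)" for k
    unfolding A_def by (rule two_sided_ideal_Inter) (use powQ in \<open>auto simp: J'_def\<close>)
  \<comment> \<open>A \<open>Q j\<close> properly above \<open>P k\<close> contains
    \<open>P k\<close> in all its powers, so it imposes no condition on n. Only a \<open>Q j\<close>
    equal to \<open>P k\<close> does, and there is at most one; its exponent serves as n, and
    otherwise 1 does.\<close>
  have PA: "\<exists>n \<ge> 1. ideal_power R (P k) n \<subseteq> A k" if k: "k \<in> M" for k
  proof -
    have le: "P k \<subseteq> ?Q j" if "j \<in> J' k" "Q j \<noteq> P k" for j
      using that prime_subset_power[OF P[OF k] Q'] by (auto simp: J'_def)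
    have carr: "ideal_power R (P k) n \<subseteq> carrier R" for n
      by (intro tsi_subset two_sided_ideal_power P' k)
    show ?thesis
    proof (cases "\<exists>j \<in> J. Q j = P k")
      case True
      then obtain j where j: "j \<in> J" "Q j = P k" by blast
      have "ideal_power R (P k) (s j) \<subseteq> ?Q i" if "i \<in> J' k" for i
      proof (cases "i = j")
        case False
        then have "Q i \<noteq> P k" using j that inj_onD[OF injQ, of i j] by (auto simp: J'_def)
        then show ?thesis
          using le[OF that] ideal_power_subset[OF P'[OF k] s[OF j(1)]] by blast
      qed (use j in auto)
      then show ?thesis
        using s[OF j(1)] carr by (intro exI[of _ "s j"]) (auto simp: A_def ideal_Inter_def)
    next
      case False
      then have "P k \<subseteq> ?Q i" if "i \<in> J' k" for i
        using le[OF that] that by (auto simp: J'_def)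
      then show ?thesis
        using carr[of 1] by (intro exI[of _ 1]) (auto simp: A_def ideal_Inter_def)
    qed
  qed
  have ex_Q: "\<exists>j \<in> J. Q j = P i" if i: "i \<in> M" for i
  proof (rule ccontr)
    assume no: "\<not> (\<exists>j \<in> J. Q j = P i)"
    \<comment> \<open>Here the finitely many \<open>A k\<close> replace the possibly infinite family
      of the \<open>Q j\<close>, which makes primeness of \<open>P i\<close> applicable.\<close>
    have "ideal_Inter R M A \<subseteq> P i"
    proof -
      have "ideal_Inter R M A \<subseteq> ideal_Inter R J ?Q"
      proof
        fix x assume x: "x \<in> ideal_Inter R M A"
        show "x \<in> ideal_Inter R J ?Q"
        proof (rule ideal_InterI)
          fix j assume j: "j \<in> J"
          then obtain i where "i \<in> M" "P i \<subseteq> Q j" using below by blast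
          with x have "x \<in> A i" by (auto simp: ideal_Inter_def)
          with \<open>P i \<subseteq> Q j\<close> j show "x \<in> ?Q j" by (auto simp: ideal_Inter_def A_def J'_def)
        qed (use x in \<open>simp add: ideal_Inter_def\<close>)
      qed
      also have "\<dots> \<subseteq> ?P i"
        unfolding eq[symmetric] using i by (auto simp: ideal_Inter_def)
      also have "\<dots> \<subseteq> P i"
        using ideal_power_subset[OF P'[OF i] r[OF i]] .
      finally show ?thesis .
    qed
    then obtain k where k: "k \<in> M" "A k \<subseteq> P i"
      using prime_ideal_finite_Inter[OF P[OF i] \<open>finite M\<close>, of A] idA by blast
    then obtain n where "n \<ge> 1" "ideal_power R (P k) n \<subseteq> P i"
      using PA by blast
    then have "P k \<subseteq> P i"
      using prime_ideal_power[OF P[OF i] P'[OF k(1)]] by blast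
    then have "k = i"
      using irredundant_incomparable[OF P r irrP injP k(1) i] by blast
    with k have Ai: "A i \<subseteq> P i" by simp
    then have "J' i \<noteq> {}"
      using prime_idealD(2)[OF P[OF i]] by (auto simp: A_def ideal_Inter_def)
    \<comment> \<open>One component of the family above \<open>P i\<close> is split off. If the
      others meet inside \<open>P i\<close>, they meet inside the component at j, since
      \<open>P i\<close> lies in all powers of \<open>Q j\<close>, and j is redundant. Otherwise
      \<open>Q j\<close> lies below \<open>P i\<close> and so equals it.\<close>
    then obtain j where j: "j \<in> J" "P i \<subseteq> Q j" by (auto simp: J'_def)
    define B where "B = ideal_Inter R (J' i - {j}) ?Q"
    have "B \<inter> ?Q j \<subseteq> P i"
      using Ai j by (auto simp: A_def B_def ideal_Inter_def J'_def)
    moreover have "two_sided_ideal R B"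
      unfolding B_def by (rule two_sided_ideal_Inter) (use powQ in \<open>auto simp: J'_def\<close>)
    ultimately consider "B \<subseteq> P i" | "?Q j \<subseteq> P i"
      using prime_ideal_Int[OF P[OF i] _ powQ[OF j(1)]] by blast
    then show False
    proof cases
      case 1
      also have "P i \<subseteq> ?Q j"
        using prime_subset_power[OF P[OF i] Q'[OF j(1)] j(2)] no j by metis
      finally have "ideal_Inter R (J - {j}) ?Q \<subseteq> ?Q j"
        by (auto simp: B_def ideal_Inter_def J'_def)
      with irrQ j show False by (auto simp: irredundant_def)
    next
      case 2
      then have "Q j \<subseteq> P i"
        using prime_ideal_power[OF P[OF i] Q'[OF j(1)] s[OF j(1)]] by blast
      with j no show False by blast
    qed
  qed
  have ex_P: "\<exists>i \<in> M. P i = Q j" if j: "j \<in> J" for j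
  proof -
    obtain i where i: "i \<in> M" "P i \<subseteq> Q j" using below[OF j] by blast
    obtain j' where "j' \<in> J" "Q j' = P i" using ex_Q[OF i(1)] by blast
    with i j irredundant_incomparable[OF Q s irrQ injQ, of j' j] show ?thesis by auto
  qed
  have img: "P ` M = Q ` J"
    using ex_P ex_Q by (auto simp: image_iff) metis+
  then have fin: "finite J"
    using \<open>finite M\<close> injQ by (metis finite_imageD finite_imageI)
  have card: "card J = card M"
    using card_image[OF injP] card_image[OF injQ] img by simp
  \<comment> \<open>Both intersections are the same ideal, so \<open>prime_power_exponents\<close>
    can be applied to the representation that has the smaller exponent.\<close>
  have same: "?P i = ?Q j" if i: "i \<in> M" and j: "j \<in> J" and PQ: "P i = Q j" for i j
  proof (cases "r i \<le> s j")
    case True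
    have "ideal_Inter R M ?P \<subseteq> ?Q j"
      unfolding eq using j by (auto simp: ideal_Inter_def)
    then show ?thesis
      using prime_power_exponents[OF P r irrP injP \<open>finite M\<close> i True] PQ by simp
  next
    case False
    have "ideal_Inter R J ?Q \<subseteq> ?P i"
      unfolding eq[symmetric] using i by (auto simp: ideal_Inter_def)
    then show ?thesis
      using prime_power_exponents[OF Q s irrQ injQ fin j, of "r i"] PQ False by simp
  qed
  have "?P ` M = ?Q ` J"
  proof (intro equalityI image_subsetI)
    fix i assume i: "i \<in> M"
    then obtain j where j: "j \<in> J" "P i = Q j" using ex_Q by metis
    show "?P i \<in> ?Q ` J" using same[OF i j] j(1) unfolding image_iff by blast
  next
    fix j assume j: "j \<in> J"
    then obtain i where i: "i \<in> M" "P i = Q j" using ex_P by metis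
    show "?Q j \<in> ?P ` M" using same[OF i(1) j i(2)] i(1) unfolding image_iff by metis
  qed
  with fin card show ?thesis by blast
qed

end

section \<open>Calculus of paths modulo an ideal\<close>

text \<open>Scalars are included, so this is the unital algebra. It supplies the multipliers and
  lets 1 occur in computations; the elements of the path algebra proper form the set
  \<open>S\<close> below.\<close>

inductive_set subalgebra :: "('k \<Rightarrow> 'a::ring_1) \<Rightarrow> 'a set \<Rightarrow> 'a set"
  for sc :: "'k \<Rightarrow> 'a" and S :: "'a set" where
  scalar: "sc k \<in> subalgebra sc S"
| gen: "x \<in> S \<Longrightarrow> x \<in> subalgebra sc S"
| add: "x \<in> subalgebra sc S \<Longrightarrow> y \<in> subalgebra sc S \<Longrightarrow> x + y \<in> subalgebra sc S"
| mult: "x \<in> subalgebra sc S \<Longrightarrow> y \<in> subalgebra sc S \<Longrightarrow> x * y \<in> subalgebra sc S"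

text \<open>The algebra is \<open>subalgebra sc \<dots> / Z\<close>. Its elements are represented in the ring \<open>'a\<close> and
  compared modulo \<open>Z\<close>, since a quotient type cannot depend on the graph.\<close>

locale cohn_family = wf_digraph E for E :: "('v, 'e) pre_digraph" +
  fixes sc :: "'k::field \<Rightarrow> 'a::ring_1" and V :: "'v \<Rightarrow> 'a" and ed gh :: "'e \<Rightarrow> 'a"
    and Z :: "'a set"
  assumes sc_add: "sc (k + l) = sc k + sc l" and sc_mult: "sc (k * l) = sc k * sc l"
    and sc_one: "sc 1 = 1" and sc_comm: "sc k * x = x * sc k"
    and Z_zero: "0 \<in> Z" and Z_add: "x \<in> Z \<Longrightarrow> y \<in> Z \<Longrightarrow> x + y \<in> Z"
    and Z_subset: "Z \<subseteq> subalgebra sc (range V \<union> range ed \<union> range gh)"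
    and Z_left: "x \<in> Z \<Longrightarrow> b \<in> subalgebra sc (range V \<union> range ed \<union> range gh) \<Longrightarrow> b * x \<in> Z"
    and Z_right: "x \<in> Z \<Longrightarrow> b \<in> subalgebra sc (range V \<union> range ed \<union> range gh) \<Longrightarrow> x * b \<in> Z"
    and V_outside: "v \<notin> verts E \<Longrightarrow> V v = 0"
    and ed_outside: "e \<notin> arcs E \<Longrightarrow> ed e = 0"
    and gh_outside: "e \<notin> arcs E \<Longrightarrow> gh e = 0"
    and V_V: "V v * V v - V v \<in> Z" and V_V_neq: "v \<noteq> w \<Longrightarrow> V v * V w \<in> Z"
    and V_ed: "V (tail E e) * ed e - ed e \<in> Z" and ed_V: "ed e * V (head E e) - ed e \<in> Z"
    and V_gh: "V (head E e) * gh e - gh e \<in> Z" and gh_V: "gh e * V (tail E e) - gh e \<in> Z"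
    and gh_ed: "e \<in> arcs E \<Longrightarrow> gh e * ed e - V (head E e) \<in> Z"
    and gh_ed_neq: "e \<noteq> f \<Longrightarrow> gh e * ed f \<in> Z"
begin

declare awalk_append_iff [simp del]

lemma awalk_append: "awalk u (p @ q) w \<longleftrightarrow> (\<exists>v. awalk u p v \<and> awalk v q w)"
  using awalk_append_iff awalk_appendI by blast

lemma awalk_unique: "awalk u p v \<Longrightarrow> awalk u p w \<Longrightarrow> v = w"
  by (induction p arbitrary: u) (auto simp: awalk_simps)

abbreviation "B \<equiv> subalgebra sc (range V \<union> range ed \<union> range gh)"

lemma sc_zero: "sc 0 = 0"
  using sc_add[of 0 0] by simp

lemma sc_minus: "sc (- a) = - sc a"
  using sc_add[of a "- a"] by (simp add: sc_zero eq_neg_iff_add_eq_0 add.commute)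

lemma B_add [simp, intro]: "x \<in> B \<Longrightarrow> y \<in> B \<Longrightarrow> x + y \<in> B"
  and B_mult [simp, intro]: "x \<in> B \<Longrightarrow> y \<in> B \<Longrightarrow> x * y \<in> B"
  and B_sc [simp, intro]: "sc k \<in> B"
  and B_V [simp, intro]: "V v \<in> B" and B_ed [simp, intro]: "ed e \<in> B" and B_gh [simp, intro]: "gh e \<in> B"
  by (auto intro: subalgebra.intros)

lemma B_zero [simp, intro]: "0 \<in> B" and B_one [simp, intro]: "1 \<in> B"
  using B_sc[of 0] B_sc[of 1] by (simp_all add: sc_zero sc_one)

lemma uminus_sc: "- x = sc (- 1) * x"
  by (simp add: sc_minus sc_one)

lemma B_uminus [simp, intro]: "x \<in> B \<Longrightarrow> - x \<in> B"
  by (subst uminus_sc) blast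

lemma B_diff [simp, intro]: "x \<in> B \<Longrightarrow> y \<in> B \<Longrightarrow> x - y \<in> B"
  using B_add[of x "- y"] by simp

lemma B_sum [simp, intro]: "(\<And>i. i \<in> A \<Longrightarrow> f i \<in> B) \<Longrightarrow> sum f A \<in> B"
  by (induction A rule: infinite_finite_induct) auto

text \<open>Multiplication by \<open>B\<close> includes the scalars, so these sets are subspaces and
  closed under negation.\<close>

definition bimod :: "'a set \<Rightarrow> bool" where
  "bimod X \<longleftrightarrow> 0 \<in> X \<and> (\<forall>x \<in> X. \<forall>y \<in> X. x + y \<in> X) \<and> (\<forall>b \<in> B. \<forall>x \<in> X. b * x \<in> X \<and> x * b \<in> X)"

context
  fixes X assumes X: "bimod X"
begin

lemma bimod_zero: "0 \<in> X"
  and bimod_add: "x \<in> X \<Longrightarrow> y \<in> X \<Longrightarrow> x + y \<in> X"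
  and bimod_left: "x \<in> X \<Longrightarrow> b \<in> B \<Longrightarrow> b * x \<in> X"
  and bimod_right: "x \<in> X \<Longrightarrow> b \<in> B \<Longrightarrow> x * b \<in> X"
  using X by (auto simp: bimod_def)

lemma bimod_uminus: "x \<in> X \<Longrightarrow> - x \<in> X"
  by (subst uminus_sc) (auto intro: bimod_left)

lemma bimod_diff: "x \<in> X \<Longrightarrow> y \<in> X \<Longrightarrow> x - y \<in> X"
  using bimod_add[OF _ bimod_uminus, of x y] by simp

lemma bimod_sum: "(\<And>i. i \<in> A \<Longrightarrow> f i \<in> X) \<Longrightarrow> sum f A \<in> X"
  by (induction A rule: infinite_finite_induct) (auto intro: bimod_zero bimod_add)

lemma bimod_diff_iff: "x - y \<in> X \<Longrightarrow> x \<in> X \<longleftrightarrow> y \<in> X"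
  using bimod_add[of "x - y" y] bimod_diff[of x "x - y"] by auto

lemma bimod_sym: "x - y \<in> X \<Longrightarrow> y - x \<in> X"
  using bimod_uminus[of "x - y"] by simp

lemma bimod_trans: "x - y \<in> X \<Longrightarrow> y - z \<in> X \<Longrightarrow> x - z \<in> X"
  using bimod_add[of "x - y" "y - z"] by simp

lemma bimod_mult:
  assumes "x - x' \<in> X" "y - y' \<in> X" "y \<in> B" "x' \<in> B"
  shows "x * y - x' * y' \<in> X"
proof -
  have "x * y - x' * y' = (x - x') * y + x' * (y - y')" by (simp add: algebra_simps)
  then show ?thesis using assms by (simp add: bimod_add bimod_left bimod_right)
qed

end

lemma bimod_Z: "bimod Z"
  by (auto simp: bimod_def Z_zero Z_add Z_left Z_right)

section \<open>Congruence modulo the relations\<close>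

definition cgr :: "'a \<Rightarrow> 'a \<Rightarrow> bool" (infix "\<doteq>" 50) where
  "x \<doteq> y \<longleftrightarrow> x - y \<in> Z"

lemma cgr_refl [simp, intro]: "x \<doteq> x"
  by (simp add: cgr_def Z_zero)

lemma cgr_sym: "x \<doteq> y \<Longrightarrow> y \<doteq> x"
  unfolding cgr_def by (rule bimod_sym[OF bimod_Z])

lemma cgr_trans [trans]: "x \<doteq> y \<Longrightarrow> y \<doteq> z \<Longrightarrow> x \<doteq> z"
  unfolding cgr_def by (rule bimod_trans[OF bimod_Z])

lemma eq_cgr_trans [trans]: "x = y \<Longrightarrow> y \<doteq> z \<Longrightarrow> x \<doteq> z"
  and cgr_eq_trans [trans]: "x \<doteq> y \<Longrightarrow> y = z \<Longrightarrow> x \<doteq> z"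
  by simp_all

lemma cgr_zero_iff: "x \<doteq> 0 \<longleftrightarrow> x \<in> Z"
  by (simp add: cgr_def)

lemma cgr_add: "x \<doteq> x' \<Longrightarrow> y \<doteq> y' \<Longrightarrow> x + y \<doteq> x' + y'"
  unfolding cgr_def using Z_add[of "x - x'" "y - y'"] by (simp add: algebra_simps)

lemma cgr_diff: "x \<doteq> x' \<Longrightarrow> y \<doteq> y' \<Longrightarrow> x - y \<doteq> x' - y'"
  unfolding cgr_def using bimod_diff[OF bimod_Z, of "x - x'" "y - y'"] by (simp add: algebra_simps)

lemma cgr_sum: "(\<And>i. i \<in> A \<Longrightarrow> f i \<doteq> g i) \<Longrightarrow> sum f A \<doteq> sum g A"
  unfolding cgr_def sum_subtractf[symmetric] by (rule bimod_sum[OF bimod_Z])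

lemma cgr_mult: "x \<doteq> x' \<Longrightarrow> y \<doteq> y' \<Longrightarrow> y \<in> B \<Longrightarrow> x' \<in> B \<Longrightarrow> x * y \<doteq> x' * y'"
  unfolding cgr_def by (rule bimod_mult[OF bimod_Z])

lemma cgr_left: "x \<doteq> y \<Longrightarrow> b \<in> B \<Longrightarrow> b * x \<doteq> b * y"
  unfolding cgr_def right_diff_distrib[symmetric] by (rule Z_left)

lemma cgr_right: "x \<doteq> y \<Longrightarrow> b \<in> B \<Longrightarrow> x * b \<doteq> y * b"
  unfolding cgr_def left_diff_distrib[symmetric] by (rule Z_right)

lemma cgr_mid: "x * y \<doteq> z \<Longrightarrow> b \<in> B \<Longrightarrow> c \<in> B \<Longrightarrow> (b * x) * (y * c) \<doteq> b * z * c"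
  using cgr_left[OF cgr_right[of "x * y" z c], of b] by (simp add: mult.assoc)

lemmas V_V' = V_V[folded cgr_def] and V_V_neq' = V_V_neq[folded cgr_zero_iff]
  and V_ed' = V_ed[folded cgr_def] and ed_V' = ed_V[folded cgr_def]
  and V_gh' = V_gh[folded cgr_def] and gh_V' = gh_V[folded cgr_def]
  and gh_ed' = gh_ed[folded cgr_def] and gh_ed_neq' = gh_ed_neq[folded cgr_zero_iff]

lemma V_ed_neq: "v \<noteq> tail E e \<Longrightarrow> V v * ed e \<doteq> 0"
proof -
  assume "v \<noteq> tail E e"
  have "V v * ed e \<doteq> V v * (V (tail E e) * ed e)"
    by (rule cgr_left[OF cgr_sym[OF V_ed']]) simp
  also have "\<dots> = (V v * V (tail E e)) * ed e" by (simp add: mult.assoc)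
  also have "\<dots> \<doteq> 0 * ed e" by (rule cgr_right[OF V_V_neq']) (use \<open>v \<noteq> _\<close> in auto)
  finally show ?thesis by simp
qed

lemma ed_V_neq: "v \<noteq> head E e \<Longrightarrow> ed e * V v \<doteq> 0"
proof -
  assume "v \<noteq> head E e"
  have "ed e * V v \<doteq> ed e * V (head E e) * V v"
    by (rule cgr_right[OF cgr_sym[OF ed_V']]) simp
  also have "\<dots> = ed e * (V (head E e) * V v)" by (simp add: mult.assoc)
  also have "\<dots> \<doteq> ed e * 0" by (rule cgr_left[OF V_V_neq']) (use \<open>v \<noteq> _\<close> in auto)
  finally show ?thesis by simp
qed

lemma V_gh_neq: "v \<noteq> head E e \<Longrightarrow> V v * gh e \<doteq> 0"
proof -
  assume "v \<noteq> head E e"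
  have "V v * gh e \<doteq> V v * (V (head E e) * gh e)"
    by (rule cgr_left[OF cgr_sym[OF V_gh']]) simp
  also have "\<dots> = (V v * V (head E e)) * gh e" by (simp add: mult.assoc)
  also have "\<dots> \<doteq> 0 * gh e" by (rule cgr_right[OF V_V_neq']) (use \<open>v \<noteq> _\<close> in auto)
  finally show ?thesis by simp
qed

lemma gh_V_neq: "v \<noteq> tail E e \<Longrightarrow> gh e * V v \<doteq> 0"
proof -
  assume "v \<noteq> tail E e"
  have "gh e * V v \<doteq> gh e * V (tail E e) * V v"
    by (rule cgr_right[OF cgr_sym[OF gh_V']]) simp
  also have "\<dots> = gh e * (V (tail E e) * V v)" by (simp add: mult.assoc)
  also have "\<dots> \<doteq> gh e * 0" by (rule cgr_left[OF V_V_neq']) (use \<open>v \<noteq> _\<close> in auto)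
  finally show ?thesis by simp
qed

text \<open>The base point is an argument because the empty list does not determine a vertex. The
  product ends with the vertex reached, and the mirror image \<open>gp\<close> begins with
  it.\<close>

primrec pa :: "'e list \<Rightarrow> 'v \<Rightarrow> 'a" where
  "pa [] u = V u"
| "pa (e # p) u = ed e * pa p (head E e)"

primrec gp :: "'e list \<Rightarrow> 'v \<Rightarrow> 'a" where
  "gp [] u = V u"
| "gp (e # p) u = gp p (head E e) * gh e"

lemma pa_B [simp, intro]: "pa p u \<in> B" and gp_B [simp, intro]: "gp p u \<in> B"
  by (induction p arbitrary: u) auto

lemma V_pa: "awalk u p v \<Longrightarrow> V u * pa p u \<doteq> pa p u"
  using cgr_right[OF V_ed', of "pa _ _"] by (cases p) (auto simp: V_V' awalk_simps mult.assoc)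

lemma gp_V: "awalk u p v \<Longrightarrow> gp p u * V u \<doteq> gp p u"
  using cgr_left[OF gh_V', of "gp _ _"] by (cases p) (auto simp: V_V' awalk_simps mult.assoc)

lemma pa_V: "awalk u p v \<Longrightarrow> pa p u * V v \<doteq> pa p u"
  by (induction p arbitrary: u) (auto simp: V_V' awalk_simps mult.assoc intro: cgr_left)

lemma V_gp: "awalk u p v \<Longrightarrow> V v * gp p u \<doteq> gp p u"
  by (induction p arbitrary: u) (auto simp: V_V' awalk_simps mult.assoc[symmetric] intro: cgr_right)

lemma V_pa_neq: "awalk u p v \<Longrightarrow> w \<noteq> u \<Longrightarrow> V w * pa p u \<doteq> 0"
  using cgr_right[OF V_ed_neq, of w _ "pa _ _"] by (cases p) (auto simp: V_V_neq' awalk_simps mult.assoc)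

lemma gp_V_neq: "awalk u p v \<Longrightarrow> w \<noteq> u \<Longrightarrow> gp p u * V w \<doteq> 0"
  using cgr_left[OF gh_V_neq, of w _ "gp _ _"] by (cases p) (auto simp: V_V_neq' awalk_simps mult.assoc)

lemma pa_append: "awalk u p v \<Longrightarrow> awalk v q w \<Longrightarrow> pa p u * pa q v \<doteq> pa (p @ q) u"
  by (induction p arbitrary: u) (auto simp: awalk_simps mult.assoc V_pa intro: cgr_left)

lemma gp_append: "awalk u p v \<Longrightarrow> awalk v q w \<Longrightarrow> gp q v * gp p u \<doteq> gp (p @ q) u"
  by (induction p arbitrary: u) (auto simp: awalk_simps mult.assoc[symmetric] gp_V intro: cgr_right)

lemma gp_pa_self: "awalk u p v \<Longrightarrow> gp p u * pa p u \<doteq> V v"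
proof (induction p arbitrary: u)
  case (Cons e p)
  let ?h = "head E e"
  have e: "e \<in> arcs E" and p: "awalk ?h p v" using Cons.prems by (auto simp: awalk_simps)
  have "gp (e # p) u * pa (e # p) u \<doteq> gp p ?h * V ?h * pa p ?h"
    using cgr_mid[OF gh_ed'[OF e]] by simp
  also have "\<dots> \<doteq> gp p ?h * pa p ?h" by (rule cgr_right[OF gp_V[OF p]]) simp
  also have "\<dots> \<doteq> V v" using Cons.IH[OF p] .
  finally show ?case .
qed (auto simp: V_V' awalk_simps)

lemma gp_pa_append: "awalk u p v \<Longrightarrow> awalk v q w \<Longrightarrow> gp p u * pa (p @ q) u \<doteq> pa q v"
proof -
  assume p: "awalk u p v" and q: "awalk v q w"
  have "gp p u * pa (p @ q) u \<doteq> gp p u * (pa p u * pa q v)"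
    by (rule cgr_left[OF cgr_sym[OF pa_append[OF p q]]]) simp
  also have "\<dots> = gp p u * pa p u * pa q v" by (simp add: mult.assoc)
  also have "\<dots> \<doteq> V v * pa q v" by (rule cgr_right[OF gp_pa_self[OF p]]) simp
  also have "\<dots> \<doteq> pa q v" by (rule V_pa[OF q])
  finally show ?thesis .
qed

lemma gp_append_pa: "awalk u p v \<Longrightarrow> awalk v q w \<Longrightarrow> gp (p @ q) u * pa p u \<doteq> gp q v"
proof -
  assume p: "awalk u p v" and q: "awalk v q w"
  have "gp (p @ q) u * pa p u \<doteq> (gp q v * gp p u) * pa p u"
    by (rule cgr_right[OF cgr_sym[OF gp_append[OF p q]]]) simp
  also have "\<dots> = gp q v * (gp p u * pa p u)" by (simp add: mult.assoc)
  also have "\<dots> \<doteq> gp q v * V v" by (rule cgr_left[OF gp_pa_self[OF p]]) simp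
  also have "\<dots> \<doteq> gp q v" by (rule gp_V[OF q])
  finally show ?thesis .
qed

text \<open>Where the two walks part, the innermost factor is a ghost edge times a different
  edge.\<close>

lemma gp_pa_incomparable:
  "awalk u p v \<Longrightarrow> awalk u q w \<Longrightarrow> \<not> prefix p q \<Longrightarrow> \<not> prefix q p \<Longrightarrow> gp p u * pa q u \<doteq> 0"
proof (induction p arbitrary: u q)
  case (Cons e p)
  then obtain f q' where q: "q = f # q'" by (cases q) auto
  show ?case
  proof (cases "e = f")
    case True
    let ?h = "head E e"
    have e: "e \<in> arcs E" and p: "awalk ?h p v" "awalk ?h q' w"
      using Cons.prems q True by (auto simp: awalk_simps)
    have "gp (e # p) u * pa q u \<doteq> gp p ?h * V ?h * pa q' ?h"
      using cgr_mid[OF gh_ed'[OF e], of "gp p ?h" "pa q' ?h"] q True by simp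
    also have "\<dots> \<doteq> gp p ?h * pa q' ?h" by (rule cgr_right[OF gp_V[OF p(1)]]) simp
    also have "\<dots> \<doteq> 0" using Cons.IH[OF p] Cons.prems q True by auto
    finally show ?thesis .
  next
    case False
    then show ?thesis
      using cgr_mid[OF gh_ed_neq'[of e f], of "gp p (head E e)" "pa q' (head E f)"] q by simp
  qed
qed simp

lemma gp_pa_neq: "awalk u p v \<Longrightarrow> awalk u' q w \<Longrightarrow> u \<noteq> u' \<Longrightarrow> gp p u * pa q u' \<doteq> 0"
proof -
  assume p: "awalk u p v" and q: "awalk u' q w" and ne: "u \<noteq> u'"
  have "gp p u * pa q u' \<doteq> gp p u * (V u' * pa q u')"
    by (rule cgr_left[OF cgr_sym[OF V_pa[OF q]]]) simp
  also have "\<dots> = gp p u * V u' * pa q u'" by (simp add: mult.assoc)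
  also have "\<dots> \<doteq> 0 * pa q u'" by (rule cgr_right[OF gp_V_neq[OF p]]) (use ne in auto)
  finally show ?thesis by simp
qed

text \<open>Representatives of the elements of the path algebra: combinations of real paths times
  ghost paths, together with all of \<open>Z\<close>, so that membership respects congruence. For
  Leavitt path algebras \<open>S_eq_F\<close> identifies this set with the carrier of the free
  algebra.\<close>

inductive_set S :: "'a set" where
  rel: "z \<in> Z \<Longrightarrow> z \<in> S"
| mono: "awalk u p w \<Longrightarrow> awalk v q w \<Longrightarrow> pa p u * gp q v \<in> S"
| scal: "x \<in> S \<Longrightarrow> sc k * x \<in> S"
| add: "x \<in> S \<Longrightarrow> y \<in> S \<Longrightarrow> x + y \<in> S"

lemma S_cgr: "x \<in> S \<Longrightarrow> y \<doteq> x \<Longrightarrow> y \<in> S"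
  using S.add[OF _ S.rel, of x "y - x"] by (simp add: cgr_def)

lemma S_subset_B: "S \<subseteq> B"
proof
  fix x assume "x \<in> S"
  then show "x \<in> B" by induction (use Z_subset in auto)
qed

lemma S_zero: "0 \<in> S"
  by (rule S.rel[OF Z_zero])

lemma S_mono_cgr: "x \<doteq> pa p u * gp q v \<Longrightarrow> awalk u p w \<Longrightarrow> awalk v q w \<Longrightarrow> x \<in> S"
  using S_cgr S.mono by blast

lemma cgr_zero_S: "x \<doteq> 0 \<Longrightarrow> x \<in> S"
  by (simp add: cgr_zero_iff S.rel)

text \<open>Closure under \<open>B\<close> is reduced to its generators. Those outside the graph are
  zero, and a product with zero is covered by the scalar zero.\<close>

lemma left_closedI:
  assumes "\<And>x y. x \<in> X \<Longrightarrow> y \<in> X \<Longrightarrow> x + y \<in> X" "\<And>x k. x \<in> X \<Longrightarrow> sc k * x \<in> X"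
    and "\<And>x v. x \<in> X \<Longrightarrow> V v * x \<in> X" "\<And>x e. x \<in> X \<Longrightarrow> e \<in> arcs E \<Longrightarrow> ed e * x \<in> X"
    and "\<And>x e. x \<in> X \<Longrightarrow> e \<in> arcs E \<Longrightarrow> gh e * x \<in> X"
    and "b \<in> B" "x \<in> X"
  shows "b * x \<in> X"
proof -
  have z: "0 * y \<in> X" if "y \<in> X" for y using assms(2)[OF that, of 0] by (simp add: sc_zero)
  show ?thesis using assms(6,7)
  proof (induction b arbitrary: x rule: subalgebra.induct)
    case (gen b)
    then consider v where "b = V v" | e where "b = ed e" | e where "b = gh e" by blast
    then show ?case
      using assms(3-5) z gen(2) ed_outside gh_outside by cases metis+
  qed (auto simp: mult.assoc distrib_right intro: assms)
qed

lemma right_closedI: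
  assumes "\<And>x y. x \<in> X \<Longrightarrow> y \<in> X \<Longrightarrow> x + y \<in> X" "\<And>x k. x \<in> X \<Longrightarrow> sc k * x \<in> X"
    and "\<And>x v. x \<in> X \<Longrightarrow> x * V v \<in> X" "\<And>x e. x \<in> X \<Longrightarrow> e \<in> arcs E \<Longrightarrow> x * ed e \<in> X"
    and "\<And>x e. x \<in> X \<Longrightarrow> e \<in> arcs E \<Longrightarrow> x * gh e \<in> X"
    and "b \<in> B" "x \<in> X"
  shows "x * b \<in> X"
proof -
  have z: "y * 0 \<in> X" if "y \<in> X" for y using assms(2)[OF that, of 0] by (simp add: sc_zero)
  show ?thesis using assms(6,7)
  proof (induction b arbitrary: x rule: subalgebra.induct)
    case (scalar k)
    then show ?case using assms(2) by (simp add: sc_comm[symmetric])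
  next
    case (gen b)
    then consider v where "b = V v" | e where "b = ed e" | e where "b = gh e" by blast
    then show ?case
      using assms(3-5) z gen(2) ed_outside gh_outside by cases metis+
  qed (auto simp: mult.assoc[symmetric] distrib_left intro: assms)
qed

lemma sc_left: "b * (sc k * x) = sc k * (b * x)"
  by (metis mult.assoc sc_comm)

lemma S_leftI:
  assumes "\<And>u p w v q. awalk u p w \<Longrightarrow> awalk v q w \<Longrightarrow> b * (pa p u * gp q v) \<in> S"
    and "b \<in> B" "x \<in> S"
  shows "b * x \<in> S"
  using assms(3)
  by induction (auto simp: distrib_left sc_left intro: S.intros assms Z_left)

lemma S_rightI:
  assumes "\<And>u p w v q. awalk u p w \<Longrightarrow> awalk v q w \<Longrightarrow> (pa p u * gp q v) * b \<in> S"
    and "b \<in> B" "x \<in> S"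
  shows "x * b \<in> S"
  using assms(3)
  by induction (auto simp: distrib_right mult.assoc intro: S.intros assms[unfolded mult.assoc] Z_right)

text \<open>A generator times a monomial is again a monomial or zero modulo \<open>Z\<close>. A
  ghost edge from the left cancels the first edge of the real path or kills the monomial; if the
  real path is empty, it passes through and lengthens the ghost path. Edges from the right behave
  symmetrically.\<close>

lemma bimod_S: "bimod S"
  unfolding bimod_def
proof (intro conjI ballI)
  fix b x assume b: "b \<in> B" and x: "x \<in> S"
  show "b * x \<in> S"
  proof (rule left_closedI[OF _ _ _ _ _ b x])
    fix x v assume "x \<in> S"
    then show "V v * x \<in> S"
    proof (rule S_leftI[rotated 2])
      fix u p w v' q assume pq: "awalk u p w" "awalk v' q w"
      show "V v * (pa p u * gp q v') \<in> S"
      proof (cases "v = u")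
        case True
        then show ?thesis
          using cgr_right[OF V_pa[OF pq(1)], of "gp q v'"] pq
          by (intro S_mono_cgr[of _ p u q v' w]) (auto simp: mult.assoc)
      next
        case False
        then show ?thesis
          using cgr_right[OF V_pa_neq[OF pq(1)], of v "gp q v'"]
          by (intro cgr_zero_S) (auto simp: mult.assoc)
      qed
    qed simp
  next
    fix x e assume "x \<in> S" and e: "e \<in> arcs E"
    from this(1) show "ed e * x \<in> S"
    proof (rule S_leftI[rotated 2])
      fix u p w v' q assume pq: "awalk u p w" "awalk v' q w"
      show "ed e * (pa p u * gp q v') \<in> S"
      proof (cases "head E e = u")
        case True
        then show ?thesis
          using pq e S.mono[of "tail E e" "e # p" w v' q] by (auto simp: mult.assoc awalk_simps)
      next
        case False
        have "ed e * pa p u \<doteq> ed e * (V u * pa p u)"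
          by (rule cgr_left[OF cgr_sym[OF V_pa[OF pq(1)]]]) simp
        also have "\<dots> = ed e * V u * pa p u" by (simp add: mult.assoc)
        also have "\<dots> \<doteq> 0 * pa p u" by (rule cgr_right[OF ed_V_neq]) (use False in auto)
        finally show ?thesis using cgr_right[of "ed e * pa p u" 0 "gp q v'"]
          by (intro cgr_zero_S) (auto simp: mult.assoc)
      qed
    qed simp
  next
    fix x e assume "x \<in> S" and e: "e \<in> arcs E"
    from this(1) show "gh e * x \<in> S"
    proof (rule S_leftI[rotated 2])
      fix u p w v q assume pq: "awalk u p w" "awalk v q w"
      have e': "awalk (tail E e) [e] (head E e)" using e by (simp add: arc_implies_awalk)
      have zero: "gh e * (pa p u * gp q v) \<in> S" if "gh e * pa p u \<doteq> 0"
        using cgr_right[OF that, of "gp q v"] by (intro cgr_zero_S) (auto simp: mult.assoc)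
      show "gh e * (pa p u * gp q v) \<in> S"
      proof (cases "tail E e = u")
        case False
        have "gh e * pa p u \<doteq> gh e * (V u * pa p u)"
          by (rule cgr_left[OF cgr_sym[OF V_pa[OF pq(1)]]]) simp
        also have "\<dots> = gh e * V u * pa p u" by (simp add: mult.assoc)
        also have "\<dots> \<doteq> 0 * pa p u" by (rule cgr_right[OF gh_V_neq]) (use False in auto)
        finally show ?thesis by (intro zero) simp
      next
        case u: True
        show ?thesis
        proof (cases p)
          case Nil
          then have w: "w = u" using pq by (simp add: awalk_simps)
          have "gh e * (pa p u * gp q v) \<doteq> gh e * gp q v"
            using Nil w pq by (auto intro: cgr_left[OF V_gp])
          also have "\<dots> \<doteq> V (head E e) * gh e * gp q v"
            by (rule cgr_right[OF cgr_sym[OF V_gh']]) simp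
          also have "\<dots> = gp [e] u * gp q v" by simp
          also have "\<dots> \<doteq> gp (q @ [e]) v"
            using gp_append[of v q u "[e]" "head E e"] pq w u e' by simp
          also have "\<dots> \<doteq> V (head E e) * gp (q @ [e]) v"
            using pq w u e' by (intro cgr_sym[OF V_gp]) (auto simp: awalk_append)
          finally show ?thesis
            using pq w u e' e head_in_verts
            by (intro S_mono_cgr[of _ "[]" "head E e" "q @ [e]" v "head E e"])
               (auto simp: awalk_append awalk_Nil_iff)
        next
          case (Cons f p')
          show ?thesis
          proof (cases "e = f")
            case True
            have p': "awalk (head E e) p' w" using pq Cons True by (auto simp: awalk_simps)
            have "gh e * pa p u = gh e * ed e * pa p' (head E e)"
              using Cons True by (simp add: mult.assoc)
            also have "\<dots> \<doteq> V (head E e) * pa p' (head E e)"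
              by (rule cgr_right[OF gh_ed'[OF e]]) simp
            also have "\<dots> \<doteq> pa p' (head E e)" by (rule V_pa[OF p'])
            finally have "gh e * (pa p u * gp q v) \<doteq> pa p' (head E e) * gp q v"
              using cgr_right[of "gh e * pa p u" _ "gp q v"] by (simp add: mult.assoc)
            then show ?thesis using p' pq S_mono_cgr by blast
          next
            case False
            then show ?thesis
              using Cons cgr_right[OF gh_ed_neq'[OF False], of "pa p' (head E f)"]
              by (intro zero) (simp add: mult.assoc)
          qed
        qed
      qed
    qed simp
  qed (auto intro: S.intros)
  show "x * b \<in> S"
  proof (rule right_closedI[OF _ _ _ _ _ b x])
    fix x v assume "x \<in> S"
    then show "x * V v \<in> S"
    proof (rule S_rightI[rotated 2])
      fix u p w v' q assume pq: "awalk u p w" "awalk v' q w"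
      show "pa p u * gp q v' * V v \<in> S"
      proof (cases "v = v'")
        case True
        then show ?thesis
          using cgr_left[OF gp_V[OF pq(2)], of "pa p u"] pq
          by (intro S_mono_cgr[of _ p u q v' w]) (auto simp: mult.assoc)
      next
        case False
        then show ?thesis
          using cgr_left[OF gp_V_neq[OF pq(2)], of v "pa p u"]
          by (intro cgr_zero_S) (auto simp: mult.assoc)
      qed
    qed simp
  next
    fix x e assume "x \<in> S" and e: "e \<in> arcs E"
    from this(1) show "x * gh e \<in> S"
    proof (rule S_rightI[rotated 2])
      fix u p w v q assume pq: "awalk u p w" "awalk v q w"
      show "pa p u * gp q v * gh e \<in> S"
      proof (cases "head E e = v")
        case True
        then show ?thesis
          using pq e S.mono[of u p w "tail E e" "e # q"] by (auto simp: mult.assoc awalk_simps)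
      next
        case False
        have "gp q v * gh e \<doteq> gp q v * V v * gh e"
          by (rule cgr_right[OF cgr_sym[OF gp_V[OF pq(2)]]]) simp
        also have "\<dots> = gp q v * (V v * gh e)" by (simp add: mult.assoc)
        also have "\<dots> \<doteq> gp q v * 0" by (rule cgr_left[OF V_gh_neq]) (use False in auto)
        finally show ?thesis using cgr_left[of "gp q v * gh e" 0 "pa p u"]
          by (intro cgr_zero_S) (auto simp: mult.assoc)
      qed
    qed simp
  next
    fix x e assume "x \<in> S" and e: "e \<in> arcs E"
    from this(1) show "x * ed e \<in> S"
    proof (rule S_rightI[rotated 2])
      fix u p w v q assume pq: "awalk u p w" "awalk v q w"
      have e': "awalk (tail E e) [e] (head E e)" using e by (simp add: arc_implies_awalk)
      have zero: "pa p u * gp q v * ed e \<in> S" if "gp q v * ed e \<doteq> 0"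
        using cgr_left[OF that, of "pa p u"] by (intro cgr_zero_S) (auto simp: mult.assoc)
      show "pa p u * gp q v * ed e \<in> S"
      proof (cases "tail E e = v")
        case False
        have "gp q v * ed e \<doteq> gp q v * V v * ed e"
          by (rule cgr_right[OF cgr_sym[OF gp_V[OF pq(2)]]]) simp
        also have "\<dots> = gp q v * (V v * ed e)" by (simp add: mult.assoc)
        also have "\<dots> \<doteq> gp q v * 0" by (rule cgr_left[OF V_ed_neq]) (use False in auto)
        finally show ?thesis by (intro zero) simp
      next
        case v: True
        show ?thesis
        proof (cases q)
          case Nil
          then have w: "w = v" using pq by (simp add: awalk_simps)
          have "pa p u * gp q v * ed e \<doteq> pa p u * ed e"
            using Nil w pq by (auto intro!: cgr_right[OF pa_V])
          also have "\<dots> \<doteq> pa p u * (ed e * V (head E e))"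
            by (rule cgr_left[OF cgr_sym[OF ed_V']]) simp
          also have "\<dots> = pa p u * pa [e] v" by simp
          also have "\<dots> \<doteq> pa (p @ [e]) u"
            using pa_append[of u p v "[e]" "head E e"] pq w v e' by simp
          also have "\<dots> \<doteq> pa (p @ [e]) u * V (head E e)"
            using pq w v e' by (intro cgr_sym[OF pa_V]) (auto simp: awalk_append)
          finally show ?thesis
            using pq w v e' e head_in_verts
            by (intro S_mono_cgr[of _ "p @ [e]" u "[]" "head E e" "head E e"])
               (auto simp: awalk_append awalk_Nil_iff)
        next
          case (Cons f q')
          show ?thesis
          proof (cases "e = f")
            case True
            have q': "awalk (head E e) q' w" using pq Cons True by (auto simp: awalk_simps)
            have "gp q v * ed e = gp q' (head E e) * (gh e * ed e)"
              using Cons True by (simp add: mult.assoc)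
            also have "\<dots> \<doteq> gp q' (head E e) * V (head E e)"
              by (rule cgr_left[OF gh_ed'[OF e]]) simp
            also have "\<dots> \<doteq> gp q' (head E e)" by (rule gp_V[OF q'])
            finally have "pa p u * gp q v * ed e \<doteq> pa p u * gp q' (head E e)"
              using cgr_left[of "gp q v * ed e" _ "pa p u"] by (simp add: mult.assoc)
            then show ?thesis using q' pq S_mono_cgr by blast
          next
            case False
            then show ?thesis
              using Cons cgr_left[OF gh_ed_neq'[of f e], of "gp q' (head E f)"]
              by (intro zero) (simp add: mult.assoc)
          qed
        qed
      qed
    qed simp
  qed (auto intro: S.intros)
qed (auto intro: S.intros S_zero)

section \<open>Left units in ideals generated by diagonal idempotents\<close>

definition rest :: "'v \<Rightarrow> 'e set \<Rightarrow> 'a" where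
  "rest v F = V v - (\<Sum>e\<in>F. ed e * gh e)"

lemma rest_B [simp, intro]: "rest v F \<in> B"
  by (auto simp: rest_def)

lemma V_ed_tail: "tail E e = v \<Longrightarrow> V v * ed e \<doteq> ed e"
  and gh_V_tail: "tail E e = v \<Longrightarrow> gh e * V v \<doteq> gh e"
  using V_ed' gh_V' by auto

context
  fixes v :: 'v and F :: "'e set"
  assumes F: "finite F" "F \<subseteq> out_arcs E v"
begin

lemma V_rest: "V v * rest v F \<doteq> rest v F"
proof -
  have "V v * rest v F = V v * V v - (\<Sum>e\<in>F. V v * ed e * gh e)"
    by (simp add: rest_def right_diff_distrib sum_distrib_left mult.assoc)
  also have "\<dots> \<doteq> rest v F"
    unfolding rest_def using F(2)
    by (intro cgr_diff V_V' cgr_sum cgr_right[OF V_ed_tail]) auto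
  finally show ?thesis .
qed

lemma rest_V: "rest v F * V v \<doteq> rest v F"
proof -
  have "rest v F * V v = V v * V v - (\<Sum>e\<in>F. ed e * (gh e * V v))"
    by (simp add: rest_def left_diff_distrib sum_distrib_right mult.assoc)
  also have "\<dots> \<doteq> rest v F"
    unfolding rest_def using F(2)
    by (intro cgr_diff V_V' cgr_sum cgr_left[OF gh_V_tail]) auto
  finally show ?thesis .
qed

lemma sum_ed_gh_ed:
  assumes "tail E f = v" "f \<in> arcs E"
  shows "(\<Sum>e\<in>F. ed e * gh e) * ed f \<doteq> (if f \<in> F then ed f else 0)"
proof -
  have "(\<Sum>e\<in>F. ed e * gh e) * ed f = (\<Sum>e\<in>F. ed e * (gh e * ed f))"
    by (simp add: sum_distrib_right mult.assoc)
  also have "\<dots> \<doteq> (\<Sum>e\<in>F. ed e * (if e = f then V (head E f) else 0))"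
    using assms by (intro cgr_sum cgr_left) (auto intro: gh_ed' gh_ed_neq')
  also have "\<dots> = (\<Sum>e\<in>F. if e = f then ed f * V (head E f) else 0)"
    by (rule sum.cong) auto
  also have "\<dots> = (if f \<in> F then ed f * V (head E f) else 0)"
    using F(1) by simp
  also have "\<dots> \<doteq> (if f \<in> F then ed f else 0)"
    using ed_V' by simp
  finally show ?thesis .
qed

lemma gh_sum_ed_gh:
  assumes "tail E f = v" "f \<in> arcs E"
  shows "gh f * (\<Sum>e\<in>F. ed e * gh e) \<doteq> (if f \<in> F then gh f else 0)"
proof -
  have "gh f * (\<Sum>e\<in>F. ed e * gh e) = (\<Sum>e\<in>F. gh f * ed e * gh e)"
    by (simp add: sum_distrib_left mult.assoc)
  also have "\<dots> \<doteq> (\<Sum>e\<in>F. (if e = f then V (head E f) else 0) * gh e)"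
    using assms by (intro cgr_sum cgr_right) (auto intro: gh_ed' gh_ed_neq')
  also have "\<dots> = (\<Sum>e\<in>F. if e = f then V (head E f) * gh f else 0)"
    by (rule sum.cong) auto
  also have "\<dots> = (if f \<in> F then V (head E f) * gh f else 0)"
    using F(1) by simp
  also have "\<dots> \<doteq> (if f \<in> F then gh f else 0)"
    using V_gh' by simp
  finally show ?thesis .
qed

lemma rest_ed:
  assumes "tail E f = v" "f \<in> arcs E"
  shows "rest v F * ed f \<doteq> (if f \<in> F then 0 else ed f)"
  using cgr_diff[OF V_ed_tail[OF assms(1)] sum_ed_gh_ed[OF assms]]
  by (auto simp: rest_def left_diff_distrib)

lemma gh_rest:
  assumes "tail E f = v" "f \<in> arcs E"
  shows "gh f * rest v F \<doteq> (if f \<in> F then 0 else gh f)"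
  using cgr_diff[OF gh_V_tail[OF assms(1)] gh_sum_ed_gh[OF assms]]
  by (auto simp: rest_def right_diff_distrib)

text \<open>Enlarging the edge set makes the idempotent smaller; equal sets give
  idempotence.\<close>

lemma rest_rest:
  assumes "F' \<subseteq> F"
  shows "rest v F * rest v F' \<doteq> rest v F"
proof -
  have "rest v F * rest v F' = rest v F * V v - (\<Sum>e\<in>F'. rest v F * ed e * gh e)"
    by (simp add: rest_def[of v F'] right_diff_distrib sum_distrib_left mult.assoc)
  also have "\<dots> \<doteq> rest v F - (\<Sum>e\<in>F'. 0 * gh e)"
    using F assms rest_ed by (intro cgr_diff rest_V cgr_sum cgr_right) fastforce+
  finally show ?thesis by simp
qed

lemma rest_pa:
  assumes "awalk v p u" "p \<noteq> []"
  shows "rest v F * pa p v \<doteq> (if hd p \<in> F then 0 else pa p v)"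
proof (cases p)
  case (Cons e q)
  with assms have e: "tail E e = v" "e \<in> arcs E" by (auto simp: awalk_simps)
  show ?thesis
    using cgr_right[OF rest_ed[OF e], of "pa q (head E e)"] Cons by (auto simp: mult.assoc)
qed (use assms in auto)

end

lemma rest_empty: "rest v {} = V v"
  by (simp add: rest_def)

lemma pa_ed:
  assumes "awalk u p v" "e \<in> arcs E" "tail E e = v"
  shows "pa p u * ed e \<doteq> pa (p @ [e]) u"
proof -
  have "awalk v [e] (head E e)" using assms by (auto simp: arc_implies_awalk)
  from cgr_trans[OF cgr_left[OF cgr_sym[OF ed_V']] pa_append[OF assms(1) this, simplified]]
  show ?thesis by simp
qed

lemma gh_gp:
  assumes "awalk u p v" "e \<in> arcs E" "tail E e = v"
  shows "gh e * gp p u \<doteq> gp (p @ [e]) u"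
proof -
  have "awalk v [e] (head E e)" using assms by (auto simp: arc_implies_awalk)
  from cgr_trans[OF cgr_right[OF cgr_sym[OF V_gh']] gp_append[OF assms(1) this, simplified]]
  show ?thesis by simp
qed

section \<open>Commuting projections of paths\<close>

definition proj :: "'e list \<Rightarrow> 'v \<Rightarrow> 'a" where
  "proj p u = pa p u * gp p u"

lemma proj_B [simp, intro]: "proj p u \<in> B"
  by (simp add: proj_def)

lemma proj_absorb:
  assumes p: "awalk u p v" and q: "awalk v q w"
  shows "proj p u * pa (p @ q) u \<doteq> pa (p @ q) u" "gp (p @ q) u * proj p u \<doteq> gp (p @ q) u"
proof -
  have "proj p u * pa (p @ q) u = pa p u * (gp p u * pa (p @ q) u)"
    by (simp add: proj_def mult.assoc)
  also have "\<dots> \<doteq> pa p u * pa q v" by (rule cgr_left[OF gp_pa_append[OF p q]]) simp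
  also have "\<dots> \<doteq> pa (p @ q) u" by (rule pa_append[OF p q])
  finally show "proj p u * pa (p @ q) u \<doteq> pa (p @ q) u" .
  have "gp (p @ q) u * proj p u = (gp (p @ q) u * pa p u) * gp p u"
    by (simp add: proj_def mult.assoc)
  also have "\<dots> \<doteq> gp q v * gp p u" by (rule cgr_right[OF gp_append_pa[OF p q]]) simp
  also have "\<dots> \<doteq> gp (p @ q) u" by (rule gp_append[OF p q])
  finally show "gp (p @ q) u * proj p u \<doteq> gp (p @ q) u" .
qed

lemma proj_proj_append:
  assumes p: "awalk u p v" and q: "awalk v q w"
  shows "proj p u * proj (p @ q) u \<doteq> proj (p @ q) u" "proj (p @ q) u * proj p u \<doteq> proj (p @ q) u"
  using cgr_right[OF proj_absorb(1)[OF p q], of "gp (p @ q) u"]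
    cgr_left[OF proj_absorb(2)[OF p q], of "pa (p @ q) u"]
  by (auto simp: proj_def mult.assoc)

lemma proj_orth: "gp p u * pa q w \<doteq> 0 \<Longrightarrow> proj p u * proj q w \<doteq> 0"
  using cgr_mid[of "gp p u" "pa q w" 0 "pa p u" "gp q w"] by (simp add: proj_def mult.assoc)

text \<open>For comparable walks the projection of the longer one lies below the other; for
  incomparable walks or different starting vertices the two are orthogonal.\<close>

lemma proj_comm:
  assumes p: "awalk u p v" and q: "awalk u' q w"
  shows "proj p u * proj q u' \<doteq> proj q u' * proj p u"
proof (cases "u = u'")
  case False
  then show ?thesis
    using proj_orth[OF gp_pa_neq[OF p q]] proj_orth[OF gp_pa_neq[OF q p]]
    by (metis cgr_sym cgr_trans)
next
  case u: True
  show ?thesis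
  proof (cases "prefix p q \<or> prefix q p")
    case True
    then consider r where "q = p @ r" | r where "p = q @ r" by (auto simp: prefix_def)
    then show ?thesis
    proof cases
      case (1 r)
      then have "awalk v r w" using p q u awalk_append awalk_unique by blast
      from proj_proj_append[OF p this] show ?thesis using 1 u by (metis cgr_sym cgr_trans)
    next
      case (2 r)
      then have "awalk w r v" using p q u awalk_append awalk_unique by blast
      from proj_proj_append[OF q this] show ?thesis using 2 u by (metis cgr_sym cgr_trans)
    qed
  next
    case False
    then have "proj p u * proj q u \<doteq> 0" "proj q u * proj p u \<doteq> 0"
      using p q u by (auto intro!: proj_orth gp_pa_incomparable)
    then show ?thesis using u by (metis cgr_sym cgr_trans)
  qed
qed

text \<open>The commutant of the projections takes the place of the algebra they generate:
  membership is tested on single projections and passes to joins without any normal form. Since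
  corners are combinations of projections, all its members commute with corners.\<close>

definition diag_comm :: "'a set" where
  "diag_comm = {x \<in> B. \<forall>u p v. awalk u p v \<longrightarrow> x * proj p u \<doteq> proj p u * x}"

text \<open>The diagonal idempotent at \<open>v\<close> transported along the path to its source
  \<open>u\<close>.\<close>

definition corner :: "'e list \<Rightarrow> 'v \<Rightarrow> 'v \<Rightarrow> 'e set \<Rightarrow> 'a" where
  "corner p u v F = pa p u * rest v F * gp p u"

lemma corner_B [simp, intro]: "corner p u v F \<in> B"
  by (auto simp: corner_def)

lemma corner_eq:
  assumes p: "awalk u p v" and F: "F \<subseteq> out_arcs E v"
  shows "corner p u v F \<doteq> proj p u - (\<Sum>e\<in>F. proj (p @ [e]) u)"
proof -
  have "corner p u v F = pa p u * V v * gp p u - (\<Sum>e\<in>F. (pa p u * ed e) * (gh e * gp p u))"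
    by (simp add: corner_def rest_def right_diff_distrib left_diff_distrib sum_distrib_left
        sum_distrib_right mult.assoc)
  also have "\<dots> \<doteq> proj p u - (\<Sum>e\<in>F. proj (p @ [e]) u)"
    unfolding proj_def using F
    by (intro cgr_diff cgr_sum cgr_mult cgr_right[OF pa_V[OF p]] pa_ed[OF p] gh_gp[OF p]) auto
  finally show ?thesis .
qed

lemma corner_comm:
  assumes p: "awalk u p v" and F: "F \<subseteq> out_arcs E v" and x: "x \<in> diag_comm"
  shows "x * corner p u v F \<doteq> corner p u v F * x"
proof -
  let ?d = "proj p u - (\<Sum>e\<in>F. proj (p @ [e]) u)"
  have xB: "x \<in> B" and comm: "\<And>u p v. awalk u p v \<Longrightarrow> x * proj p u \<doteq> proj p u * x"
    using x by (auto simp: diag_comm_def)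
  have pe: "awalk u (p @ [e]) (head E e)" if "e \<in> F" for e
  proof -
    have "awalk v [e] (head E e)" using F that arc_implies_awalk[of e] by auto
    with p show ?thesis by (auto simp: awalk_append)
  qed
  have "x * corner p u v F \<doteq> x * ?d"
    by (rule cgr_left[OF corner_eq[OF p F] xB])
  also have "\<dots> = x * proj p u - (\<Sum>e\<in>F. x * proj (p @ [e]) u)"
    by (simp add: right_diff_distrib sum_distrib_left)
  also have "\<dots> \<doteq> proj p u * x - (\<Sum>e\<in>F. proj (p @ [e]) u * x)"
    using comm p pe by (intro cgr_diff cgr_sum) blast+
  also have "\<dots> = ?d * x"
    by (simp add: left_diff_distrib sum_distrib_right)
  also have "\<dots> \<doteq> corner p u v F * x"
    by (rule cgr_right[OF cgr_sym[OF corner_eq[OF p F]] xB])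
  finally show ?thesis .
qed

lemma corner_diag_comm:
  assumes p: "awalk u p v" and F: "F \<subseteq> out_arcs E v"
  shows "corner p u v F \<in> diag_comm"
proof -
  have "proj q w \<in> diag_comm" if "awalk w q w'" for w q w'
    using that proj_comm by (auto simp: diag_comm_def)
  then show ?thesis
    using corner_comm[OF p F] by (auto simp: diag_comm_def intro: cgr_sym)
qed

lemma diag_comm_join:
  assumes x: "x \<in> diag_comm" and y: "y \<in> diag_comm"
  shows "x + y - x * y \<in> diag_comm"
proof -
  have B: "x \<in> B" "y \<in> B" using assms by (auto simp: diag_comm_def)
  have "(x + y - x * y) * proj p u \<doteq> proj p u * (x + y - x * y)" if p: "awalk u p v" for u p v
  proof -
    have c: "x * proj p u \<doteq> proj p u * x" "y * proj p u \<doteq> proj p u * y"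
      using p x y unfolding diag_comm_def by blast+
    have "x * y * proj p u = x * (y * proj p u)" by (simp add: mult.assoc)
    also have "\<dots> \<doteq> x * (proj p u * y)" by (rule cgr_left[OF c(2) B(1)])
    also have "\<dots> = x * proj p u * y" by (simp add: mult.assoc)
    also have "\<dots> \<doteq> proj p u * x * y" by (rule cgr_right[OF c(1) B(2)])
    also have "\<dots> = proj p u * (x * y)" by (simp add: mult.assoc)
    finally have xy: "x * y * proj p u \<doteq> proj p u * (x * y)" .
    show ?thesis
      using cgr_diff[OF cgr_add[OF c] xy] by (simp add: algebra_simps)
  qed
  then show ?thesis using B by (auto simp: diag_comm_def)
qed

lemma corner_rest:
  assumes p: "awalk u p v" and F: "finite F" "F \<subseteq> out_arcs E v"
  shows "corner p u v F * (pa p u * rest v F) \<doteq> pa p u * rest v F"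
proof -
  have "corner p u v F * (pa p u * rest v F) = (pa p u * rest v F) * ((gp p u * pa p u) * rest v F)"
    by (simp add: corner_def mult.assoc)
  also have "\<dots> \<doteq> (pa p u * rest v F) * (V v * rest v F)"
    by (rule cgr_left[OF cgr_right[OF gp_pa_self[OF p] rest_B]]) auto
  also have "\<dots> \<doteq> (pa p u * rest v F) * rest v F"
    by (rule cgr_left[OF V_rest[OF F]]) auto
  also have "\<dots> = pa p u * (rest v F * rest v F)" by (simp add: mult.assoc)
  also have "\<dots> \<doteq> pa p u * rest v F"
    by (rule cgr_left[OF rest_rest[OF F order_refl]]) auto
  finally show ?thesis .
qed

lemma corner_idem:
  assumes p: "awalk u p v" and F: "finite F" "F \<subseteq> out_arcs E v"
  shows "corner p u v F * corner p u v F \<doteq> corner p u v F"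
  using cgr_right[OF corner_rest[OF assms], of "gp p u"]
  by (simp add: corner_def mult.assoc)

lemma idem_join:
  assumes "a \<in> B" "b \<in> B" "a * a \<doteq> a" "b * b \<doteq> b" "a * b \<doteq> b * a"
  shows "(a + b - a * b) * (a + b - a * b) \<doteq> a + b - a * b" "(a + b - a * b) * a \<doteq> a"
proof -
  \<comment> \<open>With the complements c and d the join is 1 - c d, and a product of commuting
    idempotents is idempotent.\<close>
  define c d where "c = 1 - a" and "d = 1 - b"
  have B: "c \<in> B" "d \<in> B" using assms by (auto simp: c_def d_def)
  have cc: "c * c \<doteq> c"
    using assms(3) by (simp add: c_def cgr_def algebra_simps)
  have dd: "d * d \<doteq> d"
    using assms(4) by (simp add: d_def cgr_def algebra_simps)
  have cd: "d * c \<doteq> c * d"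
    using cgr_sym[OF assms(5)] by (simp add: c_def d_def cgr_def algebra_simps)
  have "(c * d) * (c * d) = c * (d * c) * d" by (simp add: mult.assoc)
  also have "\<dots> \<doteq> c * (c * d) * d" by (intro cgr_right cgr_left cd B)
  also have "\<dots> = (c * c) * (d * d)" by (simp add: mult.assoc)
  also have "\<dots> \<doteq> c * d" using B by (intro cgr_mult cc dd) auto
  finally have "(c * d) * (c * d) \<doteq> c * d" .
  moreover have "(1 - c * d) * (1 - c * d) - (1 - c * d) = (c * d) * (c * d) - c * d"
    by (simp add: algebra_simps)
  moreover have eq: "a + b - a * b = 1 - c * d" by (simp add: c_def d_def algebra_simps)
  ultimately show "(a + b - a * b) * (a + b - a * b) \<doteq> a + b - a * b"
    unfolding eq by (simp add: cgr_def)
  \<comment> \<open>An expansion in which every summand carries one of the assumed congruences as a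
    factor.\<close>
  have "(a + b - a * b) * a - a = (a * a - a) + (b * a - a * b) + a * (a * b - b * a) - (a * a - a) * b"
    by (simp add: algebra_simps)
  then show "(a + b - a * b) * a \<doteq> a"
    using assms unfolding cgr_def
    by (metis Z_add bimod_Z bimod_diff bimod_left bimod_right bimod_sym)
qed

text \<open>Full preimages of ideals of the quotient by \<open>Z\<close>. Stability under the unital
  algebra \<open>B\<close> is demanded; for ideals of the ring it comes from local units, see
  \<open>ideal_lift\<close>.\<close>

definition algebra_ideal :: "'a set \<Rightarrow> bool" where
  "algebra_ideal X \<longleftrightarrow> bimod X \<and> Z \<subseteq> X \<and> X \<subseteq> S"

lemma ideal_bimod: "algebra_ideal X \<Longrightarrow> bimod X"
  by (simp add: algebra_ideal_def)

lemma ideal_cgr: "algebra_ideal X \<Longrightarrow> x \<doteq> y \<Longrightarrow> x \<in> X \<longleftrightarrow> y \<in> X"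
  using bimod_diff_iff[of X x y] by (auto simp: algebra_ideal_def cgr_def)

lemma ideal_cgr_zero: "algebra_ideal X \<Longrightarrow> x \<doteq> 0 \<Longrightarrow> x \<in> X"
  using ideal_cgr[of X x 0] bimod_zero[OF ideal_bimod] by auto

inductive_set genideal :: "'a set \<Rightarrow> 'a set" for W :: "'a set" where
  rel: "z \<in> Z \<Longrightarrow> z \<in> genideal W"
| gen: "x \<in> W \<Longrightarrow> x \<in> genideal W"
| add: "x \<in> genideal W \<Longrightarrow> y \<in> genideal W \<Longrightarrow> x + y \<in> genideal W"
| left: "x \<in> genideal W \<Longrightarrow> b \<in> B \<Longrightarrow> b * x \<in> genideal W"
| right: "x \<in> genideal W \<Longrightarrow> b \<in> B \<Longrightarrow> x * b \<in> genideal W"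

lemma genideal_least: "algebra_ideal X \<Longrightarrow> W \<subseteq> X \<Longrightarrow> genideal W \<subseteq> X"
proof
  fix x assume X: "algebra_ideal X" "W \<subseteq> X" and "x \<in> genideal W"
  from this(3) show "x \<in> X"
    by induction (use X in \<open>auto simp: algebra_ideal_def intro: bimod_add bimod_left bimod_right\<close>)
qed

lemma ideal_S: "algebra_ideal S"
  by (auto simp: algebra_ideal_def bimod_S S.rel)

lemma ideal_genideal: "W \<subseteq> S \<Longrightarrow> algebra_ideal (genideal W)"
  using genideal_least[OF ideal_S] by (auto simp: algebra_ideal_def bimod_def intro: genideal.rel genideal.add genideal.left genideal.right Z_zero)

text \<open>Vertices belong to this set, as the case of no edges.\<close>

definition rests :: "'a set" where
  "rests = {rest v F | v F. v \<in> verts E \<and> finite F \<and> F \<subseteq> out_arcs E v}"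

lemma V_S: "V v \<in> S"
proof (cases "v \<in> verts E")
  case True
  then show ?thesis using S_mono_cgr[of "V v" "[]" v "[]" v v] by (auto simp: awalk_Nil_iff cgr_sym V_V')
qed (auto simp: V_outside S_zero)

lemma ed_S: "ed e \<in> S"
  using bimod_left[OF bimod_S V_S, of "ed e" "head E e"] S_cgr[OF _ cgr_sym[OF ed_V']] by auto

lemma gh_S: "gh e \<in> S"
  using bimod_right[OF bimod_S V_S, of "gh e" "head E e"] S_cgr[OF _ cgr_sym[OF V_gh']] by auto

lemma rest_S: "rest v F \<in> S"
  unfolding rest_def
  by (intro bimod_diff[OF bimod_S] bimod_sum[OF bimod_S] bimod_right[OF bimod_S] V_S ed_S B_gh)

lemma rests_subset_S: "rests \<subseteq> S"
  by (auto simp: rests_def rest_S)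

text \<open>Rewriting every element of an ideal generated by diagonal idempotents with such an
  idempotent next to a real path on its left exposes a left unit for it.\<close>

inductive_set span_rest :: "'a set \<Rightarrow> 'a set" for G :: "'a set" where
  rel: "z \<in> Z \<Longrightarrow> z \<in> span_rest G"
| mono: "awalk u p v \<Longrightarrow> finite F \<Longrightarrow> F \<subseteq> out_arcs E v \<Longrightarrow> rest v F \<in> G \<Longrightarrow> b \<in> B \<Longrightarrow>
    pa p u * rest v F * b \<in> span_rest G"
| add: "x \<in> span_rest G \<Longrightarrow> y \<in> span_rest G \<Longrightarrow> x + y \<in> span_rest G"

lemma span_rest_cgr: "x \<in> span_rest G \<Longrightarrow> y \<doteq> x \<Longrightarrow> y \<in> span_rest G"
  using span_rest.add[OF _ span_rest.rel, of x G "y - x"] by (simp add: cgr_def)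

lemma span_rest_zero: "x \<doteq> 0 \<Longrightarrow> x \<in> span_rest G"
  by (simp add: cgr_zero_iff span_rest.rel)

lemma span_rest_subset_B: "span_rest G \<subseteq> B"
proof
  fix x assume "x \<in> span_rest G"
  then show "x \<in> B" by induction (use Z_subset in auto)
qed

lemma span_rest_right: "x \<in> span_rest G \<Longrightarrow> b \<in> B \<Longrightarrow> x * b \<in> span_rest G"
  by (induction rule: span_rest.induct) (auto simp: distrib_right mult.assoc Z_right
    intro: span_rest.rel span_rest.add span_rest.mono[unfolded mult.assoc])

lemma span_rest_leftI:
  assumes "\<And>u p v F. awalk u p v \<Longrightarrow> finite F \<Longrightarrow> F \<subseteq> out_arcs E v \<Longrightarrow> rest v F \<in> G \<Longrightarrow>
    b * (pa p u * rest v F) \<in> span_rest G"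
    and "b \<in> B" "x \<in> span_rest G"
  shows "b * x \<in> span_rest G"
  using assms(3)
proof induction
  case (mono u p v F c)
  then show ?case using span_rest_right[OF assms(1)[OF mono(1-4)] mono(5)] by (simp add: mult.assoc)
qed (auto simp: distrib_left Z_left assms(2) intro: span_rest.intros)

lemma span_rest_left:
  assumes G: "algebra_ideal G" and "b \<in> B" "x \<in> span_rest G"
  shows "b * x \<in> span_rest G"
proof (rule left_closedI[OF _ _ _ _ _ assms(2,3)])
  fix x k assume "x \<in> span_rest G"
  then show "sc k * x \<in> span_rest G"
    using span_rest_right[of x G "sc k"] by (simp add: sc_comm)
next
  fix x w assume "x \<in> span_rest G"
  then show "V w * x \<in> span_rest G"
  proof (rule span_rest_leftI[rotated 2])
    fix u p v F assume *: "awalk u p v" "finite F" "F \<subseteq> out_arcs E v" "rest v F \<in> G"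
    show "V w * (pa p u * rest v F) \<in> span_rest G"
    proof (cases "w = u")
      case True
      have "V u * (pa p u * rest v F) \<doteq> pa p u * rest v F * 1"
        using cgr_right[OF V_pa[OF *(1)], of "rest v F"] by (simp add: mult.assoc)
      then show ?thesis using True * span_rest.mono[OF *, of 1] span_rest_cgr by blast
    next
      case False
      then show ?thesis
        using cgr_right[OF V_pa_neq[OF *(1) False], of "rest v F"]
        by (intro span_rest_zero) (auto simp: mult.assoc)
    qed
  qed simp
next
  fix x e assume "x \<in> span_rest G" and e: "e \<in> arcs E"
  from this(1) show "ed e * x \<in> span_rest G"
  proof (rule span_rest_leftI[rotated 2])
    fix u p v F assume *: "awalk u p v" "finite F" "F \<subseteq> out_arcs E v" "rest v F \<in> G"
    show "ed e * (pa p u * rest v F) \<in> span_rest G"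
    proof (cases "head E e = u")
      case True
      then show ?thesis
        using * e span_rest.mono[of "tail E e" "e # p" v F G 1] by (auto simp: awalk_simps mult.assoc)
    next
      case False
      have "ed e * pa p u \<doteq> ed e * (V u * pa p u)"
        by (rule cgr_left[OF cgr_sym[OF V_pa[OF *(1)]]]) simp
      also have "\<dots> = ed e * V u * pa p u" by (simp add: mult.assoc)
      also have "\<dots> \<doteq> 0 * pa p u" by (rule cgr_right[OF ed_V_neq]) (use False in auto)
      finally show ?thesis using cgr_right[of "ed e * pa p u" 0 "rest v F"]
        by (intro span_rest_zero) (auto simp: mult.assoc)
    qed
  qed simp
next
  fix x e assume "x \<in> span_rest G" and e: "e \<in> arcs E"
  from this(1) show "gh e * x \<in> span_rest G"
  proof (rule span_rest_leftI[rotated 2])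
    fix u p v F assume *: "awalk u p v" "finite F" "F \<subseteq> out_arcs E v" "rest v F \<in> G"
    have zero: "gh e * (pa p u * rest v F) \<in> span_rest G" if "gh e * pa p u \<doteq> 0"
      using cgr_right[OF that, of "rest v F"] by (intro span_rest_zero) (auto simp: mult.assoc)
    show "gh e * (pa p u * rest v F) \<in> span_rest G"
    proof (cases "tail E e = u")
      case False
      have "gh e * pa p u \<doteq> gh e * (V u * pa p u)"
        by (rule cgr_left[OF cgr_sym[OF V_pa[OF *(1)]]]) simp
      also have "\<dots> = gh e * V u * pa p u" by (simp add: mult.assoc)
      also have "\<dots> \<doteq> 0 * pa p u" by (rule cgr_right[OF gh_V_neq]) (use False in auto)
      finally show ?thesis by (intro zero) simp
    next
      case u: True
      show ?thesis
      proof (cases p)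
        case Nil
        then have v: "v = u" using * by (simp add: awalk_simps)
        have r: "gh e * (pa p u * rest v F) \<doteq> gh e * rest v F"
          using Nil v * by (auto intro: cgr_left[OF V_rest])
        also have "\<dots> \<doteq> (if e \<in> F then 0 else gh e)"
          using * u v e by (intro gh_rest) auto
        finally have *: "gh e * (pa p u * rest v F) \<doteq> (if e \<in> F then 0 else gh e)" .
        show ?thesis
        proof (cases "e \<in> F")
          case False
          \<comment> \<open>The ghost edge survives and the idempotent to its left is lost. But
            multiplying by the edge from the right shows that the vertex \<open>head E e\<close>
            lies in \<open>G\<close>, and this vertex, itself a diagonal idempotent, can be written
            in front of the ghost edge.\<close>
          then have ghe: "gh e * (pa p u * rest v F) \<doteq> gh e" using * by simp
          have "gh e * (pa p u * rest v F) * ed e \<doteq> gh e * ed e"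
            by (rule cgr_right[OF ghe]) simp
          also have "\<dots> \<doteq> V (head E e)" by (rule gh_ed'[OF e])
          finally have "V (head E e) \<in> G"
            using \<open>rest v F \<in> G\<close> ideal_cgr[OF G] bimod_left[OF ideal_bimod[OF G]]
              bimod_right[OF ideal_bimod[OF G]] by (metis B_ed B_gh B_mult pa_B)
          then have "pa [] (head E e) * rest (head E e) {} * gh e \<in> span_rest G"
            using e by (intro span_rest.mono) (auto simp: rest_empty awalk_Nil_iff)
          moreover have "gh e * (pa p u * rest v F) \<doteq> pa [] (head E e) * rest (head E e) {} * gh e"
          proof -
            have "pa [] (head E e) * rest (head E e) {} * gh e \<doteq> V (head E e) * gh e"
              using cgr_right[OF V_V'] by (simp add: rest_empty)
            also have "\<dots> \<doteq> gh e" by (rule V_gh')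
            finally show ?thesis using ghe cgr_sym cgr_trans by blast
          qed
          ultimately show ?thesis using span_rest_cgr by blast
        qed (use * span_rest_zero in auto)
      next
        case (Cons f q)
        show ?thesis
        proof (cases "e = f")
          case True
          have q: "awalk (head E e) q v" using * Cons True by (auto simp: awalk_simps)
          have "gh e * pa p u = gh e * ed e * pa q (head E e)"
            using Cons True by (simp add: mult.assoc)
          also have "\<dots> \<doteq> V (head E e) * pa q (head E e)"
            by (rule cgr_right[OF gh_ed'[OF e]]) simp
          also have "\<dots> \<doteq> pa q (head E e)" by (rule V_pa[OF q])
          finally have "gh e * (pa p u * rest v F) \<doteq> pa q (head E e) * rest v F * 1"
            using cgr_right[of "gh e * pa p u" _ "rest v F"] by (simp add: mult.assoc)
          then show ?thesis using span_rest.mono[OF q *(2-4), of 1] span_rest_cgr by blast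
        next
          case False
          then show ?thesis
            using Cons cgr_right[OF gh_ed_neq'[OF False], of "pa q (head E f)"]
            by (intro zero) (simp add: mult.assoc)
        qed
      qed
    qed
  qed simp
qed (auto intro: span_rest.add)

lemma genideal_span_rest:
  assumes "W \<subseteq> rests"
  shows "genideal W \<subseteq> span_rest (genideal W)"
proof
  have G: "algebra_ideal (genideal W)" using assms rests_subset_S by (intro ideal_genideal) auto
  fix x assume "x \<in> genideal W"
  then show "x \<in> span_rest (genideal W)"
  proof induction
    case (gen x)
    then obtain v F where *: "x = rest v F" "v \<in> verts E" "finite F" "F \<subseteq> out_arcs E v"
      using assms by (auto simp: rests_def)
    then have "pa [] v * rest v F * 1 \<in> span_rest (genideal W)"
      using gen by (intro span_rest.mono) (auto simp: awalk_Nil_iff intro: genideal.gen)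
    moreover have "x \<doteq> pa [] v * rest v F * 1"
      using * V_rest by (auto intro: cgr_sym)
    ultimately show ?case using span_rest_cgr by blast
  qed (auto intro: span_rest.intros span_rest_left[OF G] span_rest_right)
qed

text \<open>Idempotents are accumulated by joins. The clause \<open>h * g \<doteq> g\<close> ensures
  that a later idempotent still fixes whatever an earlier one fixed, as a sum of two elements
  requires; commuting with the projections keeps each join with a corner idempotent.\<close>

lemma span_rest_unit:
  assumes G: "algebra_ideal G" and "x \<in> span_rest G"
    and "g \<in> G \<inter> diag_comm" "g * g \<doteq> g"
  shows "\<exists>h \<in> G \<inter> diag_comm. h * h \<doteq> h \<and> h * x \<doteq> x \<and> h * g \<doteq> g"
  using assms(2-)
proof (induction arbitrary: g)
  case (rel z)
  then show ?case
    by (intro bexI[of _ g]) (auto simp: diag_comm_def cgr_def Z_left intro: bimod_diff[OF bimod_Z])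
next
  case (mono u p v F b)
  let ?t = "pa p u * rest v F" and ?c = "corner p u v F"
  have gB: "g \<in> B" using mono by (simp add: diag_comm_def)
  have cG: "?c \<in> G"
    unfolding corner_def using mono(4)
    by (intro bimod_left[OF ideal_bimod[OF G]] bimod_right[OF ideal_bimod[OF G]]) auto
  have gc: "g * ?c \<doteq> ?c * g"
    using corner_comm[OF mono(1,3)] mono by auto
  let ?h = "g + ?c - g * ?c"
  have "?h \<in> G"
    using mono cG gB by (auto intro: bimod_diff[OF ideal_bimod[OF G]] bimod_add[OF ideal_bimod[OF G]]
      bimod_left[OF ideal_bimod[OF G]])
  moreover have "?h \<in> diag_comm"
    using diag_comm_join[OF _ corner_diag_comm[OF mono(1,3)]] mono by auto
  moreover note idem_join[OF gB _ \<open>g * g \<doteq> g\<close> corner_idem[OF mono(1-3)] gc]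
  moreover have "?h * (?t * b) \<doteq> ?t * b"
  proof -
    have c: "?c * ?t \<doteq> ?t" by (rule corner_rest[OF mono(1-3)])
    have "?h * ?t = g * ?t + ?c * ?t - g * (?c * ?t)" by (simp add: algebra_simps)
    also have "\<dots> \<doteq> g * ?t + ?t - g * ?t"
      using gB by (intro cgr_add cgr_diff cgr_left c) auto
    finally have "?h * ?t \<doteq> ?t" by simp
    from cgr_right[OF this mono(5)] show ?thesis by (simp only: mult.assoc)
  qed
  ultimately show ?case by auto
next
  case (add x y)
  from add.IH(1)[OF add.prems] obtain h where h: "h \<in> G \<inter> diag_comm" "h * h \<doteq> h"
    "h * x \<doteq> x" "h * g \<doteq> g" by blast
  from add.IH(2)[OF h(1,2)] obtain k where k: "k \<in> G \<inter> diag_comm" "k * k \<doteq> k"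
    "k * y \<doteq> y" "k * h \<doteq> h" by blast
  have xyG: "x \<in> B" "g \<in> B" "h \<in> B" "k \<in> B"
    using add.hyps add.prems h k span_rest_subset_B[of G] unfolding diag_comm_def by blast+
  have absorb: "k * z \<doteq> z" if "h * z \<doteq> z" "z \<in> B" for z
  proof -
    have "k * z \<doteq> k * (h * z)" by (rule cgr_left[OF cgr_sym[OF that(1)] xyG(4)])
    also have "\<dots> = k * h * z" by (simp add: mult.assoc)
    also have "\<dots> \<doteq> h * z" by (rule cgr_right[OF k(4) that(2)])
    also note that(1)
    finally show ?thesis .
  qed
  have "k * (x + y) \<doteq> x + y"
    using cgr_add[OF absorb[OF h(3) xyG(1)] k(3)] by (simp add: distrib_left)
  then show ?case using k absorb[OF h(4) xyG(2)] by blast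
qed

lemma genideal_unit:
  assumes "W \<subseteq> rests" "x \<in> genideal W"
  shows "\<exists>g \<in> genideal W. g * x \<doteq> x"
proof -
  have G: "algebra_ideal (genideal W)" using assms rests_subset_S by (intro ideal_genideal) auto
  have "0 \<in> genideal W \<inter> diag_comm"
    by (auto simp: diag_comm_def genideal.rel Z_zero)
  then show ?thesis
    using span_rest_unit[OF G, of x 0] genideal_span_rest[OF assms(1)] assms(2) by auto
qed

section \<open>Reduction to closed walks\<close>

definition closed_poly :: "'v \<Rightarrow> 'i set \<Rightarrow> ('i \<Rightarrow> 'k) \<Rightarrow> ('i \<Rightarrow> 'e list) \<Rightarrow> 'a" where
  "closed_poly v I k d = V v + (\<Sum>i\<in>I. sc (k i) * pa (d i) v)"

definition closed_family :: "'v \<Rightarrow> 'i set \<Rightarrow> ('i \<Rightarrow> 'e list) \<Rightarrow> bool" where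
  "closed_family v I d \<longleftrightarrow> finite I \<and> (\<forall>i \<in> I. awalk v (d i) v \<and> d i \<noteq> [])"

text \<open>The indices are pairs of a path and its source because these are what
  \<open>real_lead\<close> delivers, and the definition has to fix one type.\<close>

definition good :: "'a set \<Rightarrow> 'v \<Rightarrow> bool" where
  "good P v \<longleftrightarrow> v \<in> verts E \<and> V v \<notin> P \<and>
    (\<exists>(I :: ('e list \<times> 'v) set) k d. closed_family v I d \<and> closed_poly v I k d \<in> P)"

text \<open>A filtration of the elements ending at \<open>v\<close> by the length of their ghost
  paths. Modulo \<open>Z\<close>, level 0 consists of the combinations of real paths into
  \<open>v\<close>.\<close>

inductive_set M :: "nat \<Rightarrow> 'v \<Rightarrow> 'a set" for n :: nat and v :: 'v where
  rel: "z \<in> Z \<Longrightarrow> z \<in> M n v"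
| mono: "awalk u p w \<Longrightarrow> awalk v q w \<Longrightarrow> length q \<le> n \<Longrightarrow> pa p u * gp q v \<in> M n v"
| scal: "x \<in> M n v \<Longrightarrow> sc k * x \<in> M n v"
| add: "x \<in> M n v \<Longrightarrow> y \<in> M n v \<Longrightarrow> x + y \<in> M n v"

lemma M_cgr: "x \<in> M n v \<Longrightarrow> y \<doteq> x \<Longrightarrow> y \<in> M n v"
  using M.add[OF _ M.rel, of x n v "y - x"] by (simp add: cgr_def)

lemma M_zero: "x \<doteq> 0 \<Longrightarrow> x \<in> M n v"
  by (simp add: cgr_zero_iff M.rel)

lemma M_subset_B: "M n v \<subseteq> B"
proof
  fix x assume "x \<in> M n v"
  then show "x \<in> B" by induction (use Z_subset in auto)
qed

lemma M_V: "x \<in> M n v \<Longrightarrow> x * V v \<doteq> x"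
proof (induction rule: M.induct)
  case (rel z)
  then show ?case by (auto simp: cgr_def intro: bimod_diff[OF bimod_Z] Z_right)
next
  case (mono u p w q)
  then show ?case using cgr_left[OF gp_V[OF mono(2)], of "pa p u"] by (simp add: mult.assoc)
next
  case (scal x k)
  then show ?case using cgr_left[OF scal(2), of "sc k"] by (simp add: mult.assoc)
next
  case (add x y)
  then show ?case using cgr_add by (simp add: distrib_right)
qed

text \<open>The edge cancels the first ghost edge or kills the monomial. A monomial without ghost
  edges gets a longer real path, which the bound does not count.\<close>

lemma M_ed:
  assumes "x \<in> M (Suc n) v" "e \<in> arcs E" "tail E e = v"
  shows "x * ed e \<in> M n (head E e)"
  using assms(1)
proof (induction rule: M.induct)
  case (mono u p w q)
  let ?h = "head E e"
  have e: "awalk v [e] ?h" using assms(2,3) arc_implies_awalk by auto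
  show ?case
  proof (cases q)
    case Nil
    then have w: "w = v" using mono by (simp add: awalk_simps)
    have pe: "awalk u (p @ [e]) ?h" using mono(1) e w by (auto simp: awalk_append)
    have "pa p u * gp q v * ed e \<doteq> pa p u * ed e"
      using Nil w mono by (auto intro!: cgr_right[OF pa_V])
    also have "\<dots> \<doteq> pa (p @ [e]) u" using mono w assms by (intro pa_ed) auto
    also have "\<dots> \<doteq> pa (p @ [e]) u * gp [] ?h"
      using cgr_sym[OF pa_V[OF pe]] by simp
    finally show ?thesis
      using pe assms(2) by (intro M_cgr[OF M.mono[OF pe, of ?h "[]"]]) (auto simp: awalk_Nil_iff)
  next
    case (Cons f q')
    show ?thesis
    proof (cases "e = f")
      case True
      have q': "awalk ?h q' w" using mono Cons True by (auto simp: awalk_simps)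
      have "gp q v * ed e = gp q' ?h * (gh e * ed e)"
        using Cons True by (simp add: mult.assoc)
      also have "\<dots> \<doteq> gp q' ?h * V ?h"
        by (rule cgr_left[OF gh_ed'[OF assms(2)]]) simp
      also have "\<dots> \<doteq> gp q' ?h" by (rule gp_V[OF q'])
      finally have "pa p u * gp q v * ed e \<doteq> pa p u * gp q' ?h"
        using cgr_left[of "gp q v * ed e" _ "pa p u"] by (simp add: mult.assoc)
      then show ?thesis using M.mono[OF mono(1) q', of n] mono Cons M_cgr by auto
    next
      case False
      then have "gp q v * ed e \<doteq> 0"
        using Cons cgr_left[OF gh_ed_neq'[of f e], of "gp q' (head E f)"] by (simp add: mult.assoc)
      from cgr_left[OF this, of "pa p u"] show ?thesis
        by (intro M_zero) (simp add: mult.assoc)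
    qed
  qed
qed (auto simp: mult.assoc distrib_right Z_right intro: M.rel M.add M.scal)

text \<open>Once \<open>F\<close> contains the first edges of all nontrivial ghost paths, the
  diagonal idempotent annihilates their monomials, and y is what remains. The claim covers every
  larger \<open>F\<close> because \<open>ex_real\<close> has to enlarge it further.\<close>

lemma M_rest:
  assumes "x \<in> M n v"
  shows "\<exists>y \<in> M 0 v. \<exists>F\<^sub>0. finite F\<^sub>0 \<and> F\<^sub>0 \<subseteq> out_arcs E v \<and>
    (\<forall>F. finite F \<longrightarrow> F\<^sub>0 \<subseteq> F \<longrightarrow> F \<subseteq> out_arcs E v \<longrightarrow> x * rest v F \<doteq> y * rest v F)"
  using assms
proof (induction rule: M.induct)
  case (rel z)
  then show ?case by (intro bexI[of _ z] exI[of _ "{}"]) (auto intro: M.rel)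
next
  case (mono u p w q)
  show ?case
  proof (cases q)
    case Nil
    then show ?thesis
      using M.mono[OF mono(1,2), of 0]
      by (intro bexI[of _ "pa p u * gp q v"] exI[of _ "{}"]) auto
  next
    case (Cons f q')
    then have f: "f \<in> arcs E" "tail E f = v" using mono by (auto simp: awalk_simps)
    have "pa p u * gp q v * rest v F \<doteq> 0 * rest v F"
      if F: "finite F" "{f} \<subseteq> F" "F \<subseteq> out_arcs E v" for F
    proof -
      have "gh f * rest v F \<doteq> 0"
        using gh_rest[OF F(1,3) f(2,1)] F(2) by simp
      from cgr_left[OF this, of "pa p u * gp q' (head E f)"] show ?thesis
        using Cons by (simp add: mult.assoc)
    qed
    then show ?thesis
      using f by (intro bexI[of _ 0] exI[of _ "{f}"]) (auto intro: M_zero)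
  qed
next
  case (scal x k)
  then obtain y F0 where y: "y \<in> M 0 v" "finite F0" "F0 \<subseteq> out_arcs E v"
    and eq: "\<And>F. finite F \<Longrightarrow> F0 \<subseteq> F \<Longrightarrow> F \<subseteq> out_arcs E v \<Longrightarrow> x * rest v F \<doteq> y * rest v F"
    by blast
  have "sc k * x * rest v F \<doteq> sc k * y * rest v F" if "finite F" "F0 \<subseteq> F" "F \<subseteq> out_arcs E v" for F
    using cgr_left[OF eq[OF that], of "sc k"] by (simp add: mult.assoc)
  with y show ?case
    by (intro bexI[of _ "sc k * y"] exI[of _ F0]) (auto intro: M.scal)
next
  case (add x x')
  from add.IH(1) obtain y F0 where y: "y \<in> M 0 v" "finite F0" "F0 \<subseteq> out_arcs E v"
    and eq: "\<And>F. finite F \<Longrightarrow> F0 \<subseteq> F \<Longrightarrow> F \<subseteq> out_arcs E v \<Longrightarrow> x * rest v F \<doteq> y * rest v F"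
    by blast
  from add.IH(2) obtain y' F1 where y': "y' \<in> M 0 v" "finite F1" "F1 \<subseteq> out_arcs E v"
    and eq': "\<And>F. finite F \<Longrightarrow> F1 \<subseteq> F \<Longrightarrow> F \<subseteq> out_arcs E v \<Longrightarrow> x' * rest v F \<doteq> y' * rest v F"
    by blast
  have "(x + x') * rest v F \<doteq> (y + y') * rest v F"
    if "finite F" "F0 \<union> F1 \<subseteq> F" "F \<subseteq> out_arcs E v" for F
  proof -
    have "x * rest v F \<doteq> y * rest v F" "x' * rest v F \<doteq> y' * rest v F"
      using that by (auto intro: eq eq')
    from cgr_add[OF this] show ?thesis by (simp only: distrib_right)
  qed
  moreover have "y + y' \<in> M 0 v" "finite (F0 \<union> F1)" "F0 \<union> F1 \<subseteq> out_arcs E v"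
    using y y' by (auto intro: M.add)
  ultimately show ?case
    by (intro bexI[of _ "y + y'"] exI[of _ "F0 \<union> F1"] conjI allI impI)
qed

text \<open>Coefficient functions merge repeated paths. Hence all other paths extending the shortest
  one in \<open>real_lead\<close> do so by nontrivial closed walks.\<close>

lemma M_0_sum:
  assumes "x \<in> M 0 v"
  shows "\<exists>k. finite {a. k a \<noteq> 0} \<and> (\<forall>a. k a \<noteq> 0 \<longrightarrow> awalk (snd a) (fst a) v) \<and>
    x \<doteq> (\<Sum>a | k a \<noteq> 0. sc (k a) * pa (fst a) (snd a))"
  using assms
proof (induction rule: M.induct)
  case (rel z)
  then show ?case by (intro exI[of _ "\<lambda>_. 0"]) (simp add: cgr_zero_iff)
next
  case (mono u p w q)
  then have q: "q = []" "w = v" by (auto simp: awalk_simps)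
  let ?k = "\<lambda>a. if a = (p, u) then 1 else 0 :: 'k"
  have k: "{a. ?k a \<noteq> 0} = {(p, u)}" by auto
  have "pa p u * gp q v \<doteq> (\<Sum>a | ?k a \<noteq> 0. sc (?k a) * pa (fst a) (snd a))"
    unfolding k using pa_V[OF mono(1)] q by (simp add: sc_one)
  moreover have "\<forall>a. ?k a \<noteq> 0 \<longrightarrow> awalk (snd a) (fst a) v"
    using mono(1) q by simp
  moreover have "finite {a. ?k a \<noteq> 0}" unfolding k by simp
  ultimately show ?case by (intro exI[of _ ?k] conjI)
next
  case (scal x c)
  then obtain k where k: "finite {a. k a \<noteq> 0}" "\<And>a. k a \<noteq> 0 \<Longrightarrow> awalk (snd a) (fst a) v"
    "x \<doteq> (\<Sum>a | k a \<noteq> 0. sc (k a) * pa (fst a) (snd a))" by blast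
  have "sc c * x \<doteq> sc c * (\<Sum>a | k a \<noteq> 0. sc (k a) * pa (fst a) (snd a))"
    by (rule cgr_left[OF k(3)]) simp
  also have "\<dots> = (\<Sum>a | k a \<noteq> 0. sc (c * k a) * pa (fst a) (snd a))"
    by (simp add: sum_distrib_left sc_mult mult.assoc)
  also have "\<dots> = (\<Sum>a | c * k a \<noteq> 0. sc (c * k a) * pa (fst a) (snd a))"
    using k(1) by (intro sum.mono_neutral_right) (auto simp: sc_zero)
  finally show ?case
    using k by (intro exI[of _ "\<lambda>a. c * k a"]) auto
next
  case (add x x')
  from add.IH(1) obtain k where k: "finite {a. k a \<noteq> 0}"
    "\<And>a. k a \<noteq> 0 \<Longrightarrow> awalk (snd a) (fst a) v"
    "x \<doteq> (\<Sum>a | k a \<noteq> 0. sc (k a) * pa (fst a) (snd a))" by blast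
  from add.IH(2) obtain k' where k': "finite {a. k' a \<noteq> 0}"
    "\<And>a. k' a \<noteq> 0 \<Longrightarrow> awalk (snd a) (fst a) v"
    "x' \<doteq> (\<Sum>a | k' a \<noteq> 0. sc (k' a) * pa (fst a) (snd a))" by blast
  define A where "A = {a. k a \<noteq> 0} \<union> {a. k' a \<noteq> 0}"
  have A: "finite A" using k(1) k'(1) by (simp add: A_def)
  have sub: "{a. k a \<noteq> 0} \<subseteq> A" "{a. k' a \<noteq> 0} \<subseteq> A" "{a. k a + k' a \<noteq> 0} \<subseteq> A"
    by (auto simp: A_def)
  have "x \<doteq> (\<Sum>a\<in>A. sc (k a) * pa (fst a) (snd a))"
    using k(3) sum.mono_neutral_left[OF A sub(1), of "\<lambda>a. sc (k a) * pa (fst a) (snd a)"]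
    by (simp add: sc_zero)
  moreover have "x' \<doteq> (\<Sum>a\<in>A. sc (k' a) * pa (fst a) (snd a))"
    using k'(3) sum.mono_neutral_left[OF A sub(2), of "\<lambda>a. sc (k' a) * pa (fst a) (snd a)"]
    by (simp add: sc_zero)
  ultimately have "x + x' \<doteq> (\<Sum>a\<in>A. sc (k a) * pa (fst a) (snd a)) + (\<Sum>a\<in>A. sc (k' a) * pa (fst a) (snd a))"
    by (rule cgr_add)
  also have "\<dots> = (\<Sum>a\<in>A. sc (k a + k' a) * pa (fst a) (snd a))"
    by (simp add: sc_add distrib_right sum.distrib)
  also have "\<dots> = (\<Sum>a | k a + k' a \<noteq> 0. sc (k a + k' a) * pa (fst a) (snd a))"
    using A sub(3) by (rule sum.mono_neutral_right) (auto simp: sc_zero)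
  finally have sum: "x + x' \<doteq> (\<Sum>a | k a + k' a \<noteq> 0. sc (k a + k' a) * pa (fst a) (snd a))" .
  have ne: "k a \<noteq> 0 \<or> k' a \<noteq> 0" if "k a + k' a \<noteq> 0" for a
    using that by auto
  have "finite {a. k a + k' a \<noteq> 0}"
    using finite_subset[OF sub(3) A] .
  moreover have "awalk (snd a) (fst a) v" if "k a + k' a \<noteq> 0" for a
    using ne[OF that] k(2) k'(2) by blast
  ultimately show ?case
    using sum by (intro exI[of _ "\<lambda>a. k a + k' a"]) blast
qed

text \<open>The ghost of a shortest path p occurring in x kills all paths incomparable with p. The
  comparable ones extend p, by a closed walk at \<open>v\<close> since all of them end there.
  Dividing by the coefficient of p normalises the vertex term.\<close>

lemma real_lead:
  assumes "x \<in> M 0 v" "x \<notin> Z"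
  shows "\<exists>b \<in> B. \<exists>(I :: ('e list \<times> 'v) set) k d. closed_family v I d \<and> b * x \<doteq> closed_poly v I k d"
proof -
  obtain k where k: "finite {a. k a \<noteq> 0}" "\<And>a. k a \<noteq> 0 \<Longrightarrow> awalk (snd a) (fst a) v"
    and x: "x \<doteq> (\<Sum>a | k a \<noteq> 0. sc (k a) * pa (fst a) (snd a))"
    using M_0_sum[OF assms(1)] by blast
  have "\<exists>a. k a \<noteq> 0"
  proof (rule ccontr)
    assume "\<not> ?thesis"
    then have "{a. k a \<noteq> 0} = {}" by blast
    with x have "x \<doteq> 0" by simp
    with assms(2) show False by (simp add: cgr_zero_iff)
  qed
  then obtain a where a: "k a \<noteq> 0" "\<And>b. k b \<noteq> 0 \<Longrightarrow> length (fst a) \<le> length (fst b)"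
    using ex_has_least_nat[of "\<lambda>a. k a \<noteq> 0" _ "\<lambda>a. length (fst a)"] by blast
  obtain p u where pu: "a = (p, u)" by (cases a)
  have p: "awalk u p v" using k(2)[OF a(1)] pu by simp
  define I where "I = {a. k a \<noteq> 0 \<and> snd a = u \<and> strict_prefix p (fst a)}"
  define d where "d b = drop (length p) (fst b)" for b :: "'e list \<times> 'v"
  have d: "fst b = p @ d b" "awalk v (d b) v" "d b \<noteq> []" if "b \<in> I" for b
  proof -
    obtain r where r: "fst b = p @ r" "r \<noteq> []"
      using \<open>b \<in> I\<close> by (auto simp: I_def strict_prefix_def prefix_def)
    then have "awalk u (p @ r) v" using k(2)[of b] that by (auto simp: I_def)
    then have "awalk v r v" using p awalk_append awalk_unique by blast
    with r show "fst b = p @ d b" "awalk v (d b) v" "d b \<noteq> []" by (auto simp: d_def)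
  qed
  let ?t = "\<lambda>b. if b = a then V v else if b \<in> I then pa (d b) v else 0"
  have summand: "gp p u * pa (fst b) (snd b) \<doteq> ?t b" if b: "k b \<noteq> 0" for b
  proof -
    consider "b = a" | "b \<noteq> a" "b \<in> I" | "b \<noteq> a" "snd b \<noteq> u" | "b \<noteq> a" "b \<notin> I" "snd b = u" by blast
    then show ?thesis
    proof cases
      case 1 then show ?thesis using gp_pa_self[OF p] pu by simp
    next
      case 2
      then show ?thesis using gp_pa_append[OF p d(2)[OF 2(2)]] d(1)[OF 2(2)] by (simp add: I_def)
    next
      case 3 then show ?thesis using gp_pa_neq[OF p k(2)[OF b]] by (auto simp: I_def)
    next
      case 4
      have "\<not> prefix p (fst b)"
        using 4 b pu unfolding I_def strict_prefix_def by (metis (mono_tags, lifting) mem_Collect_eq prod.collapse)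
      moreover have "\<not> prefix (fst b) p"
        using a(2)[OF b] pu \<open>\<not> prefix p (fst b)\<close> prefix_length_prefix[of p p "fst b"] by auto
      ultimately show ?thesis using gp_pa_incomparable[OF p, of "fst b"] k(2)[OF b] 4 by simp
    qed
  qed
  let ?b = "sc (1 / k a) * gp p u" and ?k = "\<lambda>b. k b / k a"
  have "?b * x \<doteq> ?b * (\<Sum>b | k b \<noteq> 0. sc (k b) * pa (fst b) (snd b))"
    by (rule cgr_left[OF x]) simp
  also have "\<dots> = (\<Sum>b | k b \<noteq> 0. sc (?k b) * (gp p u * pa (fst b) (snd b)))"
    unfolding sum_distrib_left
  proof (rule sum.cong)
    fix b assume "b \<in> {b. k b \<noteq> 0}"
    have "?b * (sc (k b) * pa (fst b) (snd b)) = sc (1 / k a) * (sc (k b) * (gp p u * pa (fst b) (snd b)))"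
      by (simp only: mult.assoc sc_left[of "gp p u"])
    then show "?b * (sc (k b) * pa (fst b) (snd b)) = sc (?k b) * (gp p u * pa (fst b) (snd b))"
      by (simp add: mult.assoc[symmetric] sc_mult[symmetric])
  qed simp
  also have "\<dots> \<doteq> (\<Sum>b | k b \<noteq> 0. sc (?k b) * ?t b)"
    by (intro cgr_sum cgr_left summand) auto
  also have "\<dots> = (\<Sum>b\<in>insert a I. sc (?k b) * ?t b)"
  proof (rule sum.mono_neutral_right[OF k(1)])
    show "insert a I \<subseteq> {b. k b \<noteq> 0}" using a(1) by (auto simp: I_def)
  qed simp
  also have "\<dots> = closed_poly v I ?k d"
  proof -
    have "a \<notin> I" using pu by (auto simp: I_def)
    moreover have "finite I" using k(1) by (auto simp: I_def)
    ultimately have "(\<Sum>b\<in>insert a I. sc (?k b) * ?t b) = sc (?k a) * V v + (\<Sum>b\<in>I. sc (?k b) * ?t b)"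
      by simp
    also have "(\<Sum>b\<in>I. sc (?k b) * ?t b) = (\<Sum>b\<in>I. sc (?k b) * pa (d b) v)"
      using \<open>a \<notin> I\<close> by (intro sum.cong) auto
    finally show ?thesis using a(1) by (simp add: closed_poly_def sc_one)
  qed
  finally have "?b * x \<doteq> closed_poly v I ?k d" .
  moreover have "closed_family v I d"
    using d k(1) by (auto simp: closed_family_def I_def)
  moreover have "?b \<in> B" by auto
  ultimately show ?thesis by blast
qed

lemma rest_closed_poly:
  assumes "closed_family v I d" "finite F" "F \<subseteq> out_arcs E v" "hd ` d ` I \<subseteq> F"
  shows "rest v F * closed_poly v I k d \<doteq> rest v F"
proof -
  have "rest v F * (sc (k i) * pa (d i) v) \<doteq> 0" if "i \<in> I" for i
  proof -
    have "hd (d i) \<in> F" using that assms(4) by auto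
    then have "rest v F * pa (d i) v \<doteq> 0"
      using that assms(1) rest_pa[OF assms(2,3), of "d i" v] by (auto simp: closed_family_def)
    from cgr_left[OF this, of "sc (k i)"] show ?thesis by (simp add: sc_left)
  qed
  then have "(\<Sum>i\<in>I. rest v F * (sc (k i) * pa (d i) v)) \<doteq> (\<Sum>i\<in>I. 0)"
    by (intro cgr_sum)
  from cgr_add[OF rest_V[OF assms(2,3)] this] show ?thesis
    by (simp add: closed_poly_def distrib_left sum_distrib_left)
qed

text \<open>Edges on the right remove ghosts level by level as long as one of the products stays
  outside \<open>G\<close>. If all of them lay in \<open>G\<close>, then x and
  \<open>x * rest v F\<close> would agree modulo \<open>G\<close> for every \<open>F\<close>. For a
  suitable \<open>F\<close> the idempotent \<open>rest v F\<close> would lie in \<open>P\<close>,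
  hence in \<open>G\<close>, and so would x.\<close>

lemma ex_real:
  assumes P: "algebra_ideal P" and G: "algebra_ideal G"
    and gr: "\<And>v F. finite F \<Longrightarrow> F \<subseteq> out_arcs E v \<Longrightarrow> rest v F \<in> P \<Longrightarrow> rest v F \<in> G"
    and "x \<in> M n v" "x \<in> P" "x \<notin> G"
  shows "\<exists>u. \<exists>y \<in> M 0 u. y \<in> P \<and> y \<notin> G"
  using assms(4-)
proof (induction n arbitrary: x v)
  case (Suc n)
  note Gb = ideal_bimod[OF G] and Pb = ideal_bimod[OF P]
  show ?case
  proof (cases "\<exists>e \<in> out_arcs E v. x * ed e \<notin> G")
    case True
    then obtain e where e: "e \<in> arcs E" "tail E e = v" "x * ed e \<notin> G" by auto
    have "x * ed e \<in> P" using Suc.prems(2) by (auto intro: bimod_right[OF Pb])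
    with Suc.IH[OF M_ed[OF Suc.prems(1) e(1,2)]] e(3) show ?thesis by blast
  next
    case False
    have xrest: "x * rest v F \<notin> G" if F: "finite F" "F \<subseteq> out_arcs E v" for F
    proof
      assume "x * rest v F \<in> G"
      moreover have "(\<Sum>e\<in>F. x * ed e * gh e) \<in> G"
        using False F by (intro bimod_sum[OF Gb] bimod_right[OF Gb _ B_gh]) auto
      ultimately have "x * rest v F + (\<Sum>e\<in>F. x * ed e * gh e) \<in> G"
        by (rule bimod_add[OF Gb])
      then have "x * V v \<in> G"
        by (simp add: rest_def right_diff_distrib sum_distrib_left mult.assoc)
      with Suc.prems(3) ideal_cgr[OF G M_V[OF Suc.prems(1)]] show False by blast
    qed
    obtain y F0 where y: "y \<in> M 0 v" "finite F0" "F0 \<subseteq> out_arcs E v"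
      and eq: "\<And>F. finite F \<Longrightarrow> F0 \<subseteq> F \<Longrightarrow> F \<subseteq> out_arcs E v \<Longrightarrow> x * rest v F \<doteq> y * rest v F"
      using M_rest[OF Suc.prems(1)] by blast
    have "y \<notin> Z"
    proof
      assume "y \<in> Z"
      then have "y * rest v F0 \<in> G" using Z_right G by (auto simp: algebra_ideal_def)
      with ideal_cgr[OF G eq[OF y(2) order_refl y(3)]] xrest[OF y(2,3)] show False by blast
    qed
    then obtain b k d and I :: "('e list \<times> 'v) set" where b: "b \<in> B" and fam: "closed_family v I d"
      and lead: "b * y \<doteq> closed_poly v I k d"
      using real_lead[OF y(1)] by blast
    \<comment> \<open>\<open>F0\<close> removes the ghosts from x; the first edges of the closed
      walks let the idempotent absorb \<open>closed_poly\<close>.\<close>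
    define F where "F = F0 \<union> hd ` d ` I"
    have F: "finite F" "F0 \<subseteq> F" "F \<subseteq> out_arcs E v" "hd ` d ` I \<subseteq> F"
    proof -
      have "hd (d i) \<in> out_arcs E v" if "i \<in> I" for i
        using that fam by (cases "d i") (auto simp: closed_family_def awalk_simps)
      then show "F \<subseteq> out_arcs E v" using y(3) by (auto simp: F_def)
    qed (use fam y(2) in \<open>auto simp: F_def closed_family_def\<close>)
    have xB: "x \<in> B" "y \<in> B" using Suc.prems(1) y(1) M_subset_B by auto
    have "rest v F * b * (x * rest v F) \<doteq> rest v F * b * (y * rest v F)"
      by (rule cgr_left[OF eq[OF F(1-3)]]) (use b in auto)
    also have "\<dots> = rest v F * (b * y) * rest v F" by (simp add: mult.assoc)
    also have "\<dots> \<doteq> rest v F * closed_poly v I k d * rest v F"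
      by (rule cgr_right[OF cgr_left[OF lead]]) auto
    also have "\<dots> \<doteq> rest v F * rest v F"
      by (rule cgr_right[OF rest_closed_poly[OF fam F(1,3,4)]]) auto
    also have "\<dots> \<doteq> rest v F" by (rule rest_rest[OF F(1,3) order_refl])
    finally have r: "rest v F * b * (x * rest v F) \<doteq> rest v F" .
    have "rest v F * b * (x * rest v F) \<in> P"
      using bimod_left[OF Pb bimod_right[OF Pb Suc.prems(2) rest_B]] b by auto
    then have "rest v F \<in> P" using ideal_cgr[OF P r] by blast
    then have "x * rest v F \<in> G" using gr[OF F(1,3)] bimod_left[OF Gb] xB by blast
    with xrest[OF F(1,3)] show ?thesis by blast
  qed
qed blast

section \<open>Local units and the existence of good vertices\<close>

lemma S_V_M: "x \<in> S \<Longrightarrow> \<exists>n. \<forall>m \<ge> n. \<forall>v. x * V v \<in> M m v"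
proof (induction rule: S.induct)
  case (mono u p w v q)
  have "pa p u * gp q v * V v' \<in> M m v'" if "m \<ge> length q" for m v'
  proof (cases "v' = v")
    case True
    then show ?thesis
      using M.mono[OF mono that] cgr_left[OF gp_V[OF mono(2)], of "pa p u"] M_cgr
      by (simp add: mult.assoc)
  next
    case False
    then show ?thesis
      using cgr_left[OF gp_V_neq[OF mono(2) False], of "pa p u"]
      by (intro M_zero) (simp add: mult.assoc)
  qed
  then show ?case by blast
next
  case (scal x k)
  then show ?case by (auto simp: mult.assoc intro: M.scal)
next
  case (add x y)
  then obtain n n' where "\<forall>m \<ge> n. \<forall>v. x * V v \<in> M m v" "\<forall>m \<ge> n'. \<forall>v. y * V v \<in> M m v" by blast
  then show ?case by (intro exI[of _ "max n n'"]) (auto simp: distrib_right intro: M.add)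
qed (auto intro: M.rel Z_right)

text \<open>A sum of vertices acts as a unit once it includes the source of the real path and the
  source of the ghosted path of each monomial. Allowing every larger \<open>W\<close> lets two
  summands share one set.\<close>

lemma S_units:
  assumes "x \<in> S"
  shows "\<exists>U. finite U \<and> (\<forall>W. finite W \<longrightarrow> U \<subseteq> W \<longrightarrow> (\<Sum>v\<in>W. x * V v) \<doteq> x \<and> (\<Sum>v\<in>W. V v * x) \<doteq> x)"
  using assms
proof (induction rule: S.induct)
  case (rel z)
  then show ?case
    by (intro exI[of _ "{}"]) (auto simp: cgr_def Z_left Z_right intro!: bimod_diff[OF bimod_Z] bimod_sum[OF bimod_Z])
next
  case (mono u p w v q)
  let ?x = "pa p u * gp q v"
  have "(\<Sum>v'\<in>W. ?x * V v') \<doteq> ?x" "(\<Sum>v'\<in>W. V v' * ?x) \<doteq> ?x" if W: "finite W" "{u, v} \<subseteq> W" for W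
  proof -
    have "(\<Sum>v'\<in>W. ?x * V v') \<doteq> (\<Sum>v'\<in>W. if v' = v then ?x else 0)"
      using cgr_left[OF gp_V[OF mono(2)], of "pa p u"] cgr_left[OF gp_V_neq[OF mono(2)], of _ "pa p u"]
      by (intro cgr_sum) (auto simp: mult.assoc)
    then show "(\<Sum>v'\<in>W. ?x * V v') \<doteq> ?x" using W by simp
    have "(\<Sum>v'\<in>W. V v' * ?x) \<doteq> (\<Sum>v'\<in>W. if v' = u then ?x else 0)"
      using cgr_right[OF V_pa[OF mono(1)], of "gp q v"] cgr_right[OF V_pa_neq[OF mono(1)], of _ "gp q v"]
      by (intro cgr_sum) (auto simp: mult.assoc)
    then show "(\<Sum>v'\<in>W. V v' * ?x) \<doteq> ?x" using W by simp
  qed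
  then show ?case by (intro exI[of _ "{u, v}"]) auto
next
  case (scal x k)
  then obtain U where U: "finite U" "\<And>W. finite W \<Longrightarrow> U \<subseteq> W \<Longrightarrow> (\<Sum>v\<in>W. x * V v) \<doteq> x"
    "\<And>W. finite W \<Longrightarrow> U \<subseteq> W \<Longrightarrow> (\<Sum>v\<in>W. V v * x) \<doteq> x" by blast
  have "(\<Sum>v\<in>W. sc k * x * V v) = sc k * (\<Sum>v\<in>W. x * V v)"
    "(\<Sum>v\<in>W. V v * (sc k * x)) = sc k * (\<Sum>v\<in>W. V v * x)" for W
    by (simp_all add: sum_distrib_left sc_left[of "V _"] mult.assoc)
  then show ?case using U(1) cgr_left[OF U(2), of _ "sc k"] cgr_left[OF U(3), of _ "sc k"]
    by (intro exI[of _ U]) auto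
next
  case (add x y)
  from add.IH(1) obtain U where U: "finite U"
    "\<And>W. finite W \<Longrightarrow> U \<subseteq> W \<Longrightarrow> (\<Sum>v\<in>W. x * V v) \<doteq> x"
    "\<And>W. finite W \<Longrightarrow> U \<subseteq> W \<Longrightarrow> (\<Sum>v\<in>W. V v * x) \<doteq> x" by blast
  from add.IH(2) obtain U' where U': "finite U'" "\<And>W. finite W \<Longrightarrow> U' \<subseteq> W \<Longrightarrow> (\<Sum>v\<in>W. y * V v) \<doteq> y"
    "\<And>W. finite W \<Longrightarrow> U' \<subseteq> W \<Longrightarrow> (\<Sum>v\<in>W. V v * y) \<doteq> y" by blast
  show ?case
    using U(1) U'(1) cgr_add[OF U(2) U'(2)] cgr_add[OF U(3) U'(3)]
    by (intro exI[of _ "U \<union> U'"]) (auto simp: distrib_left distrib_right sum.distrib)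
qed

lemma S_left_unit:
  assumes "x \<in> S"
  shows "\<exists>u \<in> S. u * x \<doteq> x"
proof -
  obtain U where "(\<Sum>v\<in>U. V v * x) \<doteq> x" using S_units[OF assms] by blast
  then show ?thesis
    by (intro bexI[of _ "\<Sum>v\<in>U. V v"]) (auto simp: sum_distrib_right intro: bimod_sum[OF bimod_S] V_S)
qed

lemma S_right_unit:
  assumes "x \<in> S"
  shows "\<exists>u \<in> S. x * u \<doteq> x"
proof -
  obtain U where "(\<Sum>v\<in>U. x * V v) \<doteq> x" using S_units[OF assms] by blast
  then show ?thesis
    by (intro bexI[of _ "\<Sum>v\<in>U. V v"]) (auto simp: sum_distrib_left intro: bimod_sum[OF bimod_S] V_S)
qed

theorem ex_good:
  assumes P: "algebra_ideal P" and G: "algebra_ideal G"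
    and gr: "\<And>v F. finite F \<Longrightarrow> F \<subseteq> out_arcs E v \<Longrightarrow> rest v F \<in> P \<Longrightarrow> rest v F \<in> G"
    and "\<not> P \<subseteq> G"
  shows "\<exists>v. good P v \<and> V v \<notin> G"
proof -
  note Gb = ideal_bimod[OF G] and Pb = ideal_bimod[OF P]
  from assms(4) obtain x where x: "x \<in> P" "x \<notin> G" by blast
  then have "x \<in> S" using P by (auto simp: algebra_ideal_def)
  obtain U where U: "finite U" "(\<Sum>v\<in>U. x * V v) \<doteq> x" using S_units[OF \<open>x \<in> S\<close>] by blast
  have "\<exists>v. x * V v \<notin> G"
  proof (rule ccontr)
    assume "\<not> ?thesis"
    then have "(\<Sum>v\<in>U. x * V v) \<in> G" by (intro bimod_sum[OF Gb]) auto
    with ideal_cgr[OF G U(2)] x(2) show False by blast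
  qed
  then obtain w where w: "x * V w \<notin> G" by blast
  obtain n where "x * V w \<in> M n w" using S_V_M[OF \<open>x \<in> S\<close>] by blast
  moreover have "x * V w \<in> P" using x(1) by (auto intro: bimod_right[OF Pb])
  ultimately obtain v y where y: "y \<in> M 0 v" "y \<in> P" "y \<notin> G"
    using ex_real[OF P G gr] w by blast
  then have "y \<notin> Z" using G by (auto simp: algebra_ideal_def)
  from real_lead[OF y(1) this] obtain b k d and I :: "('e list \<times> 'v) set"
    where b: "b \<in> B" "closed_family v I d" "b * y \<doteq> closed_poly v I k d" by blast
  have poly: "closed_poly v I k d \<in> P"
    using ideal_cgr[OF P b(3)] bimod_left[OF Pb y(2) b(1)] by blast
  moreover have vG: "V v \<notin> G"
  proof
    assume "V v \<in> G"
    then have "y * V v \<in> G" using y(1) M_subset_B by (auto intro: bimod_left[OF Gb])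
    with ideal_cgr[OF G M_V[OF y(1)]] y(3) show False by blast
  qed
  moreover have "V v \<notin> P"
    using gr[of "{}" v] vG by (auto simp: rest_empty)
  moreover have "v \<in> verts E"
    using vG V_outside bimod_zero[OF Gb] by metis
  ultimately have "good P v" using b(2)
    unfolding good_def by (intro conjI exI[of _ I] exI[of _ k] exI[of _ d]) simp_all
  with vG show ?thesis by blast
qed

section \<open>Cycles without exits\<close>

text \<open>The elementwise form of primeness, which \<open>prime_elementwise\<close> derives from
  products of ideals.\<close>

definition algebra_prime :: "'a set \<Rightarrow> bool" where
  "algebra_prime P \<longleftrightarrow> algebra_ideal P \<and> (\<forall>a \<in> S. \<forall>b \<in> S. (\<forall>f \<in> S. a * f * b \<in> P) \<longrightarrow> a \<in> P \<or> b \<in> P)"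

lemma conj_closed_poly:
  assumes p: "awalk v p u"
  shows "gp p v * closed_poly v I k d * pa p v \<doteq> V u + (\<Sum>i\<in>I. sc (k i) * (gp p v * pa (d i) v * pa p v))"
proof -
  have "gp p v * closed_poly v I k d * pa p v =
      gp p v * V v * pa p v + (\<Sum>i\<in>I. sc (k i) * (gp p v * pa (d i) v * pa p v))"
    by (simp only: closed_poly_def distrib_left distrib_right sum_distrib_left sum_distrib_right
        sc_left[of "gp p v"] mult.assoc)
  also have "\<dots> \<doteq> V u + (\<Sum>i\<in>I. sc (k i) * (gp p v * pa (d i) v * pa p v))"
    by (intro cgr_add cgr_refl cgr_trans[OF cgr_right[OF gp_V[OF p] pa_B] gp_pa_self[OF p]])
  finally show ?thesis .
qed

text \<open>Conjugation rotates closed walks: q = p r becomes r p. For p = q r the result is the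
  ghost of r times p, which is t if p = r t and zero otherwise. Lengths are preserved, so the walk
  stays nontrivial.\<close>

lemma conj_closed_walk:
  assumes p: "awalk v p v" and q: "awalk v q v" "q \<noteq> []"
  shows "gp p v * pa q v * pa p v \<doteq> 0 \<or>
    (\<exists>r. awalk v r v \<and> r \<noteq> [] \<and> gp p v * pa q v * pa p v \<doteq> pa r v)"
proof (cases "prefix p q \<or> prefix q p")
  case False
  then show ?thesis
    using cgr_right[OF gp_pa_incomparable[OF p q(1)], of "pa p v"] by simp
next
  case True
  then consider r where "q = p @ r" | r where "p = q @ r" by (auto simp: prefix_def)
  then show ?thesis
  proof cases
    case (1 r)
    then have r: "awalk v r v" using p q awalk_append awalk_unique by blast
    have "gp p v * pa q v * pa p v \<doteq> pa r v * pa p v"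
      using cgr_right[OF gp_pa_append[OF p r], of "pa p v"] 1 by simp
    also have "\<dots> \<doteq> pa (r @ p) v" by (rule pa_append[OF r p])
    finally show ?thesis using r p q 1 awalk_appendI by blast
  next
    case (2 r)
    then have r: "awalk v r v" using p q awalk_append awalk_unique by blast
    have e: "gp p v * pa q v * pa p v \<doteq> gp r v * pa p v"
      using cgr_right[OF gp_append_pa[OF q(1) r], of "pa p v"] 2 by simp
    show ?thesis
    proof (cases "prefix r p")
      case True
      then obtain t where t: "p = r @ t" by (auto simp: prefix_def)
      then have "awalk v t v" using p r awalk_append awalk_unique by blast
      moreover have "t \<noteq> []" using t 2 q by auto
      moreover have "gp r v * pa p v \<doteq> pa t v"
        using gp_pa_append[OF r \<open>awalk v t v\<close>] t by simp
      ultimately show ?thesis using cgr_trans[OF e] by blast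
    next
      case False
      then have "\<not> prefix p r" using 2 q prefix_length_le[of p r] by auto
      with False show ?thesis using cgr_trans[OF e gp_pa_incomparable[OF r p]] by blast
    qed
  qed
qed

text \<open>Conjugating a shortest \<open>closed_poly\<close> in \<open>P\<close> by a closed walk cannot lose a term, so that
  each of its walks is comparable with every closed walk at \<open>v\<close>.\<close>

lemma good_cycle:
  assumes P: "algebra_ideal P" and "good P v"
  obtains c k d and I :: "('e list \<times> 'v) set" where "awalk v c v" "c \<noteq> []" "closed_family v I d"
    "closed_poly v I k d \<in> P" "\<And>p. awalk v p v \<Longrightarrow> p \<noteq> [] \<Longrightarrow> prefix c p"
proof -
  note Pb = ideal_bimod[OF P]
  let ?Q = "\<lambda>(I :: ('e list \<times> 'v) set, k, d). closed_family v I d \<and> closed_poly v I k d \<in> P"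
  obtain t where "?Q t" using assms(2) unfolding good_def by fast
  from ex_has_least_nat[of ?Q, OF this, of "\<lambda>(I, k, d). card I"]
  obtain t where t: "?Q t" "\<And>t'. ?Q t' \<Longrightarrow> (\<lambda>(I, k, d). card I) t \<le> (\<lambda>(I, k, d). card I) t'"
    by blast
  obtain I k d where tI: "t = (I, k, d)" by (cases t)
  have fam: "closed_family v I d" and poly: "closed_poly v I k d \<in> P" using t(1) tI by auto
  have min: "card I \<le> card I'" if "closed_family v I' d'" "closed_poly v I' k' d' \<in> P"
    for k' d' and I' :: "('e list \<times> 'v) set"
    using t(2)[of "(I', k', d')"] that tI by simp
  have fin: "finite I" and walk: "\<And>i. i \<in> I \<Longrightarrow> awalk v (d i) v" "\<And>i. i \<in> I \<Longrightarrow> d i \<noteq> []"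
    using fam by (auto simp: closed_family_def)
  have comparable: "prefix p (d i) \<or> prefix (d i) p" if p: "awalk v p v" and i: "i \<in> I" for p i
  proof (rule ccontr)
    assume "\<not> ?thesis"
    then have zi: "gp p v * pa (d i) v * pa p v \<doteq> 0"
      using cgr_right[OF gp_pa_incomparable[OF p walk(1)[OF i]], of "pa p v"] by simp
    define I' where "I' = {j \<in> I. \<not> gp p v * pa (d j) v * pa p v \<doteq> 0}"
    have "\<forall>j \<in> I'. \<exists>r. awalk v r v \<and> r \<noteq> [] \<and> gp p v * pa (d j) v * pa p v \<doteq> pa r v"
      using conj_closed_walk[OF p walk] by (auto simp: I'_def)
    then obtain d' where d': "\<And>j. j \<in> I' \<Longrightarrow> awalk v (d' j) v" "\<And>j. j \<in> I' \<Longrightarrow> d' j \<noteq> []"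
      "\<And>j. j \<in> I' \<Longrightarrow> gp p v * pa (d j) v * pa p v \<doteq> pa (d' j) v"
      by metis
    have "(\<Sum>j\<in>I. sc (k j) * (gp p v * pa (d j) v * pa p v)) \<doteq>
        (\<Sum>j\<in>I. if j \<in> I' then sc (k j) * pa (d' j) v else 0)"
    proof (rule cgr_sum)
      fix j assume "j \<in> I"
      then show "sc (k j) * (gp p v * pa (d j) v * pa p v) \<doteq> (if j \<in> I' then sc (k j) * pa (d' j) v else 0)"
        using cgr_left[OF d'(3), of j "sc (k j)"] cgr_left[of "gp p v * pa (d j) v * pa p v" 0 "sc (k j)"]
        by (auto simp: I'_def)
    qed
    also have "\<dots> = (\<Sum>j\<in>I'. sc (k j) * pa (d' j) v)"
    proof -
      have "I \<inter> I' = I'" by (auto simp: I'_def)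
      then show ?thesis using sum.inter_restrict[OF fin, of "\<lambda>j. sc (k j) * pa (d' j) v" I'] by simp
    qed
    finally have "gp p v * closed_poly v I k d * pa p v \<doteq> closed_poly v I' k d'"
      unfolding closed_poly_def[of v I'] by (intro cgr_trans[OF conj_closed_poly[OF p]] cgr_add) auto
    moreover have "gp p v * closed_poly v I k d * pa p v \<in> P"
      using poly by (intro bimod_left[OF Pb] bimod_right[OF Pb]) auto
    ultimately have "closed_poly v I' k d' \<in> P" using ideal_cgr[OF P] by blast
    moreover have "closed_family v I' d'"
      using d' fin by (auto simp: closed_family_def I'_def)
    ultimately have "card I \<le> card I'" by (intro min)
    moreover have "I' \<subset> I" using i zi by (auto simp: I'_def)
    then have "card I' < card I" using fin by (rule psubset_card_mono[rotated])
    ultimately show False by simp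
  qed
  \<comment> \<open>With no walk left the element would be \<open>V v\<close>, which is outside
    \<open>P\<close>.\<close>
  have "I \<noteq> {}"
    using poly assms(2) by (auto simp: closed_poly_def good_def)
  then obtain i where i: "i \<in> I" by blast
  \<comment> \<open>A shortest nontrivial closed walk is a prefix of every other one, since both are
    comparable with \<open>d i\<close>.\<close>
  obtain c where c: "awalk v c v \<and> c \<noteq> []"
    and least: "\<And>p. awalk v p v \<and> p \<noteq> [] \<Longrightarrow> length c \<le> length p"
    using ex_has_least_nat[of "\<lambda>p. awalk v p v \<and> p \<noteq> []" "d i" length] walk[OF i] by blast
  have "prefix c p" if p: "awalk v p v" "p \<noteq> []" for p
  proof -
    have "prefix c (d i)"
      using comparable[of c i] c i least[of "d i"] walk[OF i]
      by (metis prefix_length_le prefix_order.eq_iff le_antisym not_equal_is_parallel parallel_def)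
    with comparable[OF p(1) i] show ?thesis
      using least[of p] p prefix_length_prefix prefix_order.trans by blast
  qed
  with c fam poly that show thesis by blast
qed

end

text \<open>The data supplied by \<open>good_cycle\<close>. The absence of exits is meant modulo
  \<open>P\<close>: a walk may leave the cycle, but then it ends in a vertex of \<open>P\<close>,
  see \<open>return_walk\<close>.\<close>

locale exitless_cycle = cohn_family E sc V ed gh Z
  for E :: "('v, 'e) pre_digraph" and sc :: "'k::field \<Rightarrow> 'a::ring_1"
    and V :: "'v \<Rightarrow> 'a" and ed gh :: "'e \<Rightarrow> 'a" and Z :: "'a set" +
  fixes P :: "'a set" and v :: 'v and c :: "'e list" and I :: "'i set" and k d
  assumes P: "algebra_prime P" and v_notin: "V v \<notin> P"
    and c: "awalk v c v" "c \<noteq> []" and fam: "closed_family v I d" and poly: "closed_poly v I k d \<in> P"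
    and c_prefix: "\<And>p. awalk v p v \<Longrightarrow> p \<noteq> [] \<Longrightarrow> prefix c p"
begin

lemma idP: "algebra_ideal P" and bP: "bimod P"
  using P ideal_bimod by (auto simp: algebra_prime_def)

abbreviation "C \<equiv> pa c v"
abbreviation "C' \<equiv> gp c v"

section \<open>The corner at \<open>v\<close> as an image of a polynomial ring\<close>

lemma closed_split:
  assumes "awalk v p v" "p \<noteq> []"
  obtains q where "p = c @ q" "awalk v q v"
proof -
  obtain q where q: "p = c @ q" using c_prefix[OF assms] by (auto simp: prefix_def)
  with assms c have "awalk v q v" using awalk_append awalk_unique by blast
  with q that show thesis by blast
qed

text \<open>Evaluation at the cycle by Horner's rule in the ambient ring, where it is exactly
  multiplicative. The map \<open>W\<close> moves it into the corner at \<open>v\<close>, where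
  multiplicativity holds modulo \<open>Z\<close>.\<close>

definition ev :: "'k poly \<Rightarrow> 'a" where
  "ev p = fold_coeffs (\<lambda>a x. sc a + C * x) p 0"

lemma ev_0 [simp]: "ev 0 = 0"
  by (simp add: ev_def)

lemma ev_pCons: "ev (pCons a p) = sc a + C * ev p"
  by (cases "a = 0 \<and> p = 0") (auto simp: ev_def sc_zero)

lemma ev_B [simp, intro]: "ev p \<in> B"
  by (induction p) (auto simp: ev_pCons)

lemma ev_add: "ev (p + q) = ev p + ev q"
  by (induction p q rule: poly_induct2) (auto simp: ev_pCons sc_add distrib_left)

lemma ev_smult: "ev (smult a p) = sc a * ev p"
  by (induction p) (auto simp: ev_pCons sc_mult distrib_left sc_left[of C])

lemma ev_mult: "ev (p * q) = ev p * ev q"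
  by (induction p) (auto simp: ev_pCons ev_add ev_smult distrib_right mult.assoc sc_zero)

lemma V_C: "V v * C \<doteq> C" and C_V: "C * V v \<doteq> C" and V_C': "V v * C' \<doteq> C'" and C'_V: "C' * V v \<doteq> C'"
  using V_pa pa_V V_gp gp_V c(1) by auto

lemma C'_C: "C' * C \<doteq> V v"
  by (rule gp_pa_self[OF c(1)])

lemma ev_V: "V v * ev p \<doteq> ev p * V v"
proof (induction p)
  case (pCons a p)
  have "V v * (C * ev p) = (V v * C) * ev p" by (simp add: mult.assoc)
  also have "\<dots> \<doteq> C * ev p" by (rule cgr_right[OF V_C ev_B])
  also have "\<dots> \<doteq> (C * V v) * ev p" by (rule cgr_right[OF cgr_sym[OF C_V] ev_B])
  also have "\<dots> = C * (V v * ev p)" by (simp add: mult.assoc)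
  also have "\<dots> \<doteq> C * (ev p * V v)" by (rule cgr_left[OF pCons.IH]) simp
  finally have "V v * (C * ev p) \<doteq> C * ev p * V v" by (simp add: mult.assoc)
  from cgr_add[OF cgr_refl this] show ?case
    by (simp add: ev_pCons distrib_left distrib_right sc_comm[of _ "V v"])
qed simp

definition W :: "'k poly \<Rightarrow> 'a" where
  "W p = V v * ev p"

lemma W_B [simp, intro]: "W p \<in> B"
  by (auto simp: W_def)

lemma W_S: "W p \<in> S"
  unfolding W_def by (intro bimod_right[OF bimod_S] V_S ev_B)

lemma W_0: "W 0 = 0" and W_1: "W 1 = V v" and W_add: "W (p + q) = W p + W q"
  and W_smult: "W (smult a p) = sc a * W p"
  by (simp_all add: W_def ev_pCons one_pCons sc_one ev_add distrib_left ev_smult sc_left[of "V v"])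

lemma W_sum: "W (sum f A) = (\<Sum>i\<in>A. W (f i))"
  by (induction A rule: infinite_finite_induct) (auto simp: W_0 W_add)

lemma W_uminus: "W (- p) = - W p"
  using W_add[of p "- p"] by (simp add: W_0 eq_neg_iff_add_eq_0 add.commute)

lemma W_diff: "W (p - q) = W p - W q"
  using W_add[of p "- q"] by (simp add: W_uminus)

lemma V_W: "V v * W p \<doteq> W p"
  using cgr_right[OF V_V', of "ev p"] by (simp add: W_def mult.assoc)

lemma W_V: "W p * V v \<doteq> W p"
proof -
  have "W p * V v \<doteq> ev p * V v * V v"
    unfolding W_def by (rule cgr_right[OF ev_V]) simp
  also have "\<dots> = ev p * (V v * V v)" by (simp add: mult.assoc)
  also have "\<dots> \<doteq> ev p * V v" by (rule cgr_left[OF V_V']) simp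
  also have "\<dots> \<doteq> W p" unfolding W_def by (rule cgr_sym[OF ev_V])
  finally show ?thesis .
qed

lemma W_mult: "W (p * q) \<doteq> W p * W q"
proof -
  have "W p * W q = W p * V v * ev q" by (simp add: W_def mult.assoc)
  also have "\<dots> \<doteq> W p * ev q" by (rule cgr_right[OF W_V ev_B])
  also have "\<dots> = W (p * q)" by (simp add: W_def ev_mult mult.assoc)
  finally show ?thesis by (rule cgr_sym)
qed

lemma W_pCons_0: "C * W p \<doteq> W (pCons 0 p)"
proof -
  have "C * W p = C * V v * ev p" by (simp add: W_def mult.assoc)
  also have "\<dots> \<doteq> C * ev p" by (rule cgr_right[OF C_V ev_B])
  also have "\<dots> \<doteq> V v * C * ev p" by (rule cgr_right[OF cgr_sym[OF V_C] ev_B])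
  also have "\<dots> = W (pCons 0 p)" by (simp add: W_def ev_pCons sc_zero mult.assoc)
  finally show ?thesis .
qed

text \<open>The polynomials in the cycle, modulo \<open>P\<close>. By \<open>corner_Pol\<close> they
  fill the corner at \<open>v\<close>, which is therefore commutative modulo
  \<open>P\<close>.\<close>

definition Pol :: "'a set" where
  "Pol = {x \<in> B. \<exists>p. x - W p \<in> P}"

lemma Pol_W: "W p \<in> Pol"
  by (auto simp: Pol_def intro!: exI[of _ p] bimod_zero[OF bP])

lemma Z_P: "z \<in> Z \<Longrightarrow> z \<in> P"
  using idP by (auto simp: algebra_ideal_def)

lemma Pol_trans: "y \<in> Pol \<Longrightarrow> x - y \<in> P \<Longrightarrow> x \<in> B \<Longrightarrow> x \<in> Pol"
  unfolding Pol_def using bimod_trans[OF bP, of x y] by blast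

lemma Pol_cgr: "y \<in> Pol \<Longrightarrow> x \<doteq> y \<Longrightarrow> x \<in> B \<Longrightarrow> x \<in> Pol"
  by (rule Pol_trans) (auto simp: cgr_def Z_P)

lemma P_Pol: "x \<in> P \<Longrightarrow> x \<in> B \<Longrightarrow> x \<in> Pol"
  using Pol_trans[OF Pol_W[of 0]] by (simp add: W_0)

lemma Pol_add: "x \<in> Pol \<Longrightarrow> y \<in> Pol \<Longrightarrow> x + y \<in> Pol"
proof -
  assume "x \<in> Pol" "y \<in> Pol"
  then obtain p q where pq: "x \<in> B" "y \<in> B" "x - W p \<in> P" "y - W q \<in> P" by (auto simp: Pol_def)
  have "x + y - W (p + q) \<in> P"
    using bimod_add[OF bP pq(3,4)] by (simp add: W_add algebra_simps)
  with pq show ?thesis by (auto simp: Pol_def)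
qed

lemma Pol_mult:
  assumes "x \<in> Pol" "y \<in> Pol"
  shows "x * y \<in> Pol"
proof -
  obtain p q where pq: "x - W p \<in> P" "y - W q \<in> P" "x \<in> B" "y \<in> B" using assms by (auto simp: Pol_def)
  have "x * y - W p * W q \<in> P" using bimod_mult[OF bP pq(1,2)] pq by blast
  moreover have "W p * W q \<in> Pol" using Pol_cgr[OF Pol_W cgr_sym[OF W_mult]] by blast
  ultimately show ?thesis using Pol_trans pq by blast
qed

lemma Pol_scal: "x \<in> Pol \<Longrightarrow> sc a * x \<in> Pol"
proof -
  assume "x \<in> Pol"
  then obtain p where p: "x \<in> B" "x - W p \<in> P" by (auto simp: Pol_def)
  have "sc a * x - W (smult a p) \<in> P"
    using bimod_left[OF bP p(2), of "sc a"] by (simp add: W_smult right_diff_distrib)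
  with p show ?thesis by (auto simp: Pol_def)
qed

lemma closed_walk_W: "awalk v p v \<Longrightarrow> \<exists>q. pa p v \<doteq> W q \<and> (p \<noteq> [] \<longrightarrow> coeff q 0 = 0)"
proof (induction "length p" arbitrary: p rule: less_induct)
  case less
  show ?case
  proof (cases "p = []")
    case True
    then show ?thesis by (intro exI[of _ 1]) (simp add: W_1)
  next
    case False
    then obtain q where q: "p = c @ q" "awalk v q v" using closed_split[OF less.prems] by blast
    then obtain r where r: "pa q v \<doteq> W r" using less.hyps[of q] c(2) by auto
    have "pa p v \<doteq> C * pa q v" using pa_append[OF c(1) q(2)] q by (auto intro: cgr_sym)
    also have "\<dots> \<doteq> C * W r" by (rule cgr_left[OF r]) simp
    also have "\<dots> \<doteq> W (pCons 0 r)" by (rule W_pCons_0)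
    finally show ?thesis by (intro exI[of _ "pCons 0 r"]) simp
  qed
qed

text \<open>Each \<open>d i\<close> is a power of the cycle with positive exponent, so the constant
  coefficient 1 comes from the vertex term alone.\<close>

lemma ex_poly: "\<exists>q. W (pCons 1 q) \<in> P"
proof -
  have "\<forall>i \<in> I. \<exists>q. pa (d i) v \<doteq> W q \<and> coeff q 0 = 0"
    using closed_walk_W fam by (fastforce simp: closed_family_def)
  then obtain q where q: "\<And>i. i \<in> I \<Longrightarrow> pa (d i) v \<doteq> W (q i)" "\<And>i. i \<in> I \<Longrightarrow> coeff (q i) 0 = 0"
    by metis
  define p where "p = 1 + (\<Sum>i\<in>I. smult (k i) (q i))"
  have "closed_poly v I k d \<doteq> V v + (\<Sum>i\<in>I. sc (k i) * W (q i))"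
    unfolding closed_poly_def by (intro cgr_add cgr_refl cgr_sum cgr_left q(1) B_sc)
  also have "\<dots> = W p" by (simp add: p_def W_add W_1 W_sum W_smult)
  finally have "W p \<in> P" using poly ideal_cgr[OF idP] by blast
  moreover have "coeff p 0 = 1" using q(2) by (simp add: p_def coeff_sum)
  then obtain r where "p = pCons 1 r" by (cases p) auto
  ultimately show ?thesis by blast
qed

text \<open>As \<open>C' * C\<close> is congruent to \<open>V v\<close>, the element
  \<open>V v - C * C'\<close> annihilates \<open>C\<close> on its right. Multiplied by the
  polynomial of \<open>ex_poly\<close> it only keeps the constant term, so it lies in
  \<open>P\<close>. Multiplying that polynomial by \<open>C'\<close> instead leaves
  \<open>C' + W q\<close>, so the inverse of the cycle is a polynomial in the cycle modulo
  \<open>P\<close>.\<close>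

lemma C_C': "C * C' - V v \<in> P" and C'_Pol: "C' \<in> Pol"
proof -
  obtain q where q: "W (pCons 1 q) \<in> P" using ex_poly by blast
  have W: "W (pCons 1 q) \<doteq> V v + C * ev q"
    using cgr_add[OF cgr_refl[of "V v"] cgr_right[OF V_C, of "ev q"]]
    by (simp add: W_def ev_pCons sc_one distrib_left mult.assoc)
  have "(V v - C * C') * W (pCons 1 q) \<doteq> (V v - C * C') * (V v + C * ev q)"
    by (rule cgr_left[OF W]) auto
  also have "\<dots> = (V v * V v - C * (C' * V v)) + ((V v * C) - C * (C' * C)) * ev q"
    by (simp add: algebra_simps)
  also have "\<dots> \<doteq> (V v - C * C') + (C - C * V v) * ev q"
    by (intro cgr_add cgr_diff cgr_right cgr_left V_V' C'_V V_C C'_C) auto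
  also have "\<dots> \<doteq> (V v - C * C') + (C - C) * ev q"
    by (intro cgr_add cgr_diff cgr_right C_V cgr_refl) auto
  finally have 1: "(V v - C * C') * W (pCons 1 q) \<doteq> V v - C * C'" by simp
  have "(V v - C * C') * W (pCons 1 q) \<in> P" using q by (intro bimod_left[OF bP]) auto
  then have "V v - C * C' \<in> P" using ideal_cgr[OF idP 1] by blast
  then show "C * C' - V v \<in> P" by (rule bimod_sym[OF bP])
  have "C' * W (pCons 1 q) \<doteq> C' * (V v + C * ev q)" by (rule cgr_left[OF W]) auto
  also have "\<dots> = C' * V v + (C' * C) * ev q" by (simp add: algebra_simps)
  also have "\<dots> \<doteq> C' + V v * ev q" by (intro cgr_add C'_V cgr_right C'_C) auto
  finally have 2: "C' * W (pCons 1 q) \<doteq> C' + W q" by (simp add: W_def)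
  have "C' * W (pCons 1 q) \<in> P" using q by (intro bimod_left[OF bP]) auto
  then have "C' - W (- q) \<in> P" using ideal_cgr[OF idP 2] by (simp add: W_uminus)
  then show "C' \<in> Pol" by (auto simp: Pol_def)
qed

lemma pa_Pol: "awalk v p v \<Longrightarrow> pa p v \<in> Pol"
  using closed_walk_W Pol_cgr[OF Pol_W] by blast

lemma closed_walk_ghost: "awalk v p v \<Longrightarrow> gp p v \<in> Pol \<and> pa p v * gp p v - V v \<in> P"
proof (induction "length p" arbitrary: p rule: less_induct)
  case less
  show ?case
  proof (cases "p = []")
    case True
    then show ?thesis using Pol_W[of 1] Z_P[OF V_V] by (simp add: W_1)
  next
    case False
    then obtain q where q: "p = c @ q" "awalk v q v" using closed_split[OF less.prems] by blast
    then have IH: "gp q v \<in> Pol" "pa q v * gp q v - V v \<in> P" using less.hyps[of q] c(2) by auto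
    have g: "gp p v \<doteq> gp q v * C'" using gp_append[OF c(1) q(2)] q by (auto intro: cgr_sym)
    have "pa p v * gp p v \<doteq> (C * pa q v) * (gp q v * C')"
      using g pa_append[OF c(1) q(2)] q by (intro cgr_mult) (auto intro: cgr_sym)
    also have "\<dots> = C * (pa q v * gp q v) * C'" by (simp add: mult.assoc)
    finally have "pa p v * gp p v - C * (pa q v * gp q v) * C' \<in> P" by (simp add: cgr_def Z_P)
    moreover have "C * (pa q v * gp q v) * C' - C * V v * C' \<in> P"
      using bimod_right[OF bP bimod_left[OF bP IH(2)], of C C'] by (simp add: algebra_simps)
    moreover have "C * V v * C' - C * C' \<in> P"
      using cgr_right[OF C_V, of C'] by (simp add: cgr_def Z_P)
    ultimately have "pa p v * gp p v - V v \<in> P"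
      using C_C' bimod_trans[OF bP] by blast
    moreover have "gp p v \<in> Pol" using Pol_cgr[OF Pol_mult[OF IH(1) C'_Pol] g] by blast
    ultimately show ?thesis by blast
  qed
qed

text \<open>Copies of the cycle are stripped from the front of p. If the remainder is a prefix of
  the cycle, the rest of the cycle leads back. If it parts from the cycle, it is incomparable with
  every \<open>d i\<close>, and conjugating \<open>closed_poly\<close> by it leaves only
  \<open>V u\<close>, which would then lie in \<open>P\<close>.\<close>

lemma return_walk: "awalk v p u \<Longrightarrow> V u \<notin> P \<Longrightarrow> \<exists>q. awalk u q v"
proof (induction "length p" arbitrary: p rule: less_induct)
  case less
  consider q where "p = c @ q" | q where "c = p @ q" | "\<not> prefix c p" "\<not> prefix p c"
    by (auto simp: prefix_def)
  then show ?case
  proof cases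
    case (1 q)
    then have "awalk v q u" using less.prems c awalk_append awalk_unique by blast
    then show ?thesis using less.hyps[of q] less.prems 1 c(2) by auto
  next
    case (2 q)
    then show ?thesis using less.prems c awalk_append awalk_unique by blast
  next
    case 3
    have zero: "sc (k i) * (gp p v * pa (d i) v * pa p v) \<doteq> 0" if "i \<in> I" for i
    proof -
      have i: "awalk v (d i) v" "d i \<noteq> []" using fam that by (auto simp: closed_family_def)
      then have "prefix c (d i)" using c_prefix by blast
      then have "\<not> prefix p (d i)" "\<not> prefix (d i) p"
        using 3 prefix_same_cases prefix_order.trans by blast+
      then have "gp p v * pa (d i) v \<doteq> 0" using gp_pa_incomparable[OF less.prems(1) i(1)] by blast
      from cgr_left[OF cgr_right[OF this], of "pa p v" "sc (k i)"] show ?thesis by simp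
    qed
    have "gp p v * closed_poly v I k d * pa p v \<doteq> V u + (\<Sum>i\<in>I. 0)"
      by (intro cgr_trans[OF conj_closed_poly[OF less.prems(1)]] cgr_add cgr_sum zero cgr_refl)
    then have *: "gp p v * closed_poly v I k d * pa p v \<doteq> V u" by simp
    have "gp p v * closed_poly v I k d * pa p v \<in> P"
      by (intro bimod_right[OF bP] bimod_left[OF bP] poly) auto
    then show ?thesis using ideal_cgr[OF idP *] less.prems(2) by blast
  qed
qed

text \<open>A return walk r from u is inserted: r times its ghost is \<open>V u\<close> modulo
  \<open>P\<close>, which follows by conjugating the corresponding fact for the closed walk p r. The
  monomial thus agrees modulo \<open>P\<close> with one formed from closed walks.\<close>

lemma mono_Pol:
  assumes p: "awalk v p u" and q: "awalk v q u"
  shows "pa p v * gp q v \<in> Pol"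
proof (cases "V u \<in> P")
  case True
  have "pa p v * V u * gp q v \<in> P" using True by (intro bimod_right[OF bP] bimod_left[OF bP]) auto
  then have "pa p v * gp q v \<in> P"
    using ideal_cgr[OF idP cgr_right[OF pa_V[OF p] gp_B]] by blast
  then show ?thesis by (rule P_Pol) auto
next
  case False
  then obtain r where r: "awalk u r v" using return_walk[OF p] by blast
  have pr: "awalk v (p @ r) v" and qr: "awalk v (q @ r) v" using p q r awalk_appendI by blast+
  have "gp p v * (pa (p @ r) v * gp (p @ r) v - V v) * pa p v \<in> P"
    using closed_walk_ghost[OF pr] by (intro bimod_right[OF bP] bimod_left[OF bP]) auto
  moreover have "gp p v * (pa (p @ r) v * gp (p @ r) v - V v) * pa p v \<doteq> pa r u * gp r u - V u"
  proof -
    have "gp p v * (pa (p @ r) v * gp (p @ r) v - V v) * pa p v =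
        (gp p v * pa (p @ r) v) * (gp (p @ r) v * pa p v) - gp p v * V v * pa p v"
      by (simp add: algebra_simps)
    also have "\<dots> \<doteq> pa r u * gp r u - gp p v * pa p v"
      by (intro cgr_diff cgr_mult gp_pa_append[OF p r] gp_append_pa[OF p r] cgr_right[OF gp_V[OF p]]) auto
    also have "\<dots> \<doteq> pa r u * gp r u - V u"
      by (intro cgr_diff cgr_refl gp_pa_self[OF p])
    finally show ?thesis .
  qed
  ultimately have "pa r u * gp r u - V u \<in> P" using ideal_cgr[OF idP] by blast
  then have "pa p v * (pa r u * gp r u - V u) * gp q v \<in> P"
    by (intro bimod_right[OF bP] bimod_left[OF bP]) auto
  moreover have "pa p v * (pa r u * gp r u - V u) * gp q v \<doteq> pa (p @ r) v * gp (q @ r) v - pa p v * gp q v"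
  proof -
    have "pa p v * (pa r u * gp r u - V u) * gp q v =
        (pa p v * pa r u) * (gp r u * gp q v) - pa p v * V u * gp q v"
      by (simp add: algebra_simps)
    also have "\<dots> \<doteq> pa (p @ r) v * gp (q @ r) v - pa p v * gp q v"
      by (intro cgr_diff cgr_mult pa_append[OF p r] gp_append[OF q r] cgr_right[OF pa_V[OF p]]) auto
    finally show ?thesis .
  qed
  ultimately have "pa (p @ r) v * gp (q @ r) v - pa p v * gp q v \<in> P" using ideal_cgr[OF idP] by blast
  then have "pa p v * gp q v - pa (p @ r) v * gp (q @ r) v \<in> P" by (rule bimod_sym[OF bP])
  moreover have "pa (p @ r) v * gp (q @ r) v \<in> Pol"
    using Pol_mult[OF pa_Pol[OF pr]] closed_walk_ghost[OF qr] by blast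
  ultimately show ?thesis using Pol_trans by blast
qed

lemma corner_Pol: "x \<in> S \<Longrightarrow> V v * x * V v \<in> Pol"
proof (induction rule: S.induct)
  case (rel z)
  then show ?case using Z_subset by (intro P_Pol Z_P Z_left Z_right) auto
next
  case (mono u p w u' q)
  show ?case
  proof (cases "u = v \<and> u' = v")
    case True
    have "(V v * pa p u) * (gp q u' * V v) \<doteq> pa p u * gp q u'"
      using V_pa[OF mono(1)] gp_V[OF mono(2)] True by (intro cgr_mult) auto
    then show ?thesis using mono_Pol[of p w q] mono True Pol_cgr by (auto simp: mult.assoc)
  next
    case False
    then have "V v * pa p u \<doteq> 0 \<or> gp q u' * V v \<doteq> 0"
      using V_pa_neq[OF mono(1)] gp_V_neq[OF mono(2)] by metis
    then have "V v * (pa p u * gp q u') * V v \<doteq> 0"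
      using cgr_right[of "V v * pa p u" 0 "gp q u' * V v"] cgr_left[of "gp q u' * V v" 0 "V v * pa p u"]
      by (auto simp: mult.assoc)
    then show ?thesis using ideal_cgr_zero[OF idP] by (intro P_Pol) auto
  qed
next
  case (scal x a)
  have "V v * (sc a * x) * V v = sc a * (V v * x * V v)" by (simp only: mult.assoc sc_left[of "V v"])
  with scal show ?case using Pol_scal by simp
next
  case (add x y)
  then show ?case using Pol_add by (simp add: distrib_left distrib_right)
qed

text \<open>Any f between the two factors may be replaced by a polynomial in the cycle, which
  commutes with them modulo \<open>P\<close> and moves to the front. So the polynomials that
  \<open>W\<close> sends into \<open>P\<close> form a prime ideal.\<close>

lemma W_prime:
  assumes "W (p * q) \<in> P"
  shows "W p \<in> P \<or> W q \<in> P"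
proof -
  have "W p * f * W q \<in> P" if f: "f \<in> S" for f
  proof -
    obtain h where h: "V v * f * V v - W h \<in> P" using corner_Pol[OF f] by (auto simp: Pol_def)
    have "S \<subseteq> B" using S_subset_B .
    then have fB: "f \<in> B" using f by blast
    have "W p * f * W q \<doteq> (W p * V v) * f * (V v * W q)"
      using fB by (intro cgr_mult cgr_sym[OF W_V] cgr_sym[OF V_W] cgr_refl) auto
    also have "\<dots> = W p * (V v * f * V v) * W q" by (simp add: mult.assoc)
    finally have 1: "W p * f * W q \<doteq> W p * (V v * f * V v) * W q" .
    have "W p * (V v * f * V v) * W q - W p * W h * W q \<in> P"
      using bimod_right[OF bP bimod_left[OF bP h], of "W p" "W q"] by (simp add: algebra_simps)
    moreover have "W p * W h * W q \<in> P"
    proof -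
      have "W p * W h * W q \<doteq> W (p * h) * W q" by (rule cgr_right[OF cgr_sym[OF W_mult]]) simp
      also have "\<dots> \<doteq> W (p * h * q)" by (rule cgr_sym[OF W_mult])
      also have "\<dots> = W (h * (p * q))" by (simp add: algebra_simps)
      also have "\<dots> \<doteq> W h * W (p * q)" by (rule W_mult)
      finally show ?thesis using ideal_cgr[OF idP] bimod_left[OF bP assms, of "W h"] by blast
    qed
    ultimately have "W p * (V v * f * V v) * W q \<in> P" using bimod_diff_iff[OF bP] by blast
    then show ?thesis using ideal_cgr[OF idP 1] by blast
  qed
  then show ?thesis using P W_S unfolding algebra_prime_def by blast
qed

text \<open>The polynomials sent into \<open>P\<close> form a nonzero prime ideal of the polynomial
  ring over a field, and those sent into \<open>X\<close> a strictly larger one. Nonzero primes are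
  maximal there, so 1 is sent into \<open>X\<close>. The comparison of degrees spells out this
  maximality.\<close>

lemma vertex_in_larger:
  assumes X: "algebra_ideal X" and PX: "P \<subseteq> X" "\<not> X \<subseteq> P"
  shows "V v \<in> X"
proof -
  note bX = ideal_bimod[OF X]
  \<comment> \<open>Primeness is applied twice, with \<open>V v\<close> on either side, to move an
    element of \<open>X\<close> into the corner without entering \<open>P\<close>.\<close>
  obtain q where q: "W q \<in> X" "W q \<notin> P"
  proof -
    obtain x where x: "x \<in> X" "x \<notin> P" using PX by blast
    have xS: "x \<in> S" using X x by (auto simp: algebra_ideal_def)
    have SB: "\<And>y. y \<in> S \<Longrightarrow> y \<in> B" using S_subset_B by blast
    note [intro] = bimod_left[OF bimod_S] bimod_right[OF bimod_S] V_S
    have pr: "\<And>a b. a \<in> S \<Longrightarrow> b \<in> S \<Longrightarrow> (\<And>f. f \<in> S \<Longrightarrow> a * f * b \<in> P) \<Longrightarrow> a \<in> P \<or> b \<in> P"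
      using P by (simp add: algebra_prime_def)
    obtain f where f: "f \<in> S" "V v * f * x \<notin> P"
      using pr[OF V_S xS] v_notin x by blast
    have "V v * f * x \<in> S" using f xS SB by blast
    then obtain g where g: "g \<in> S" "V v * f * x * g * V v \<notin> P"
      using pr[OF _ V_S, of "V v * f * x" v] f v_notin by blast
    let ?y = "V v * (f * x * g) * V v"
    have "f * x * g \<in> S" using f g xS SB by blast
    then obtain q where qP: "?y - W q \<in> P" using corner_Pol by (auto simp: Pol_def)
    have "?y \<notin> P" using g by (simp add: mult.assoc)
    then have 1: "W q \<notin> P" using bimod_diff_iff[OF bP qP] by blast
    have "f * x * g \<in> X"
      by (rule bimod_right[OF bX bimod_left[OF bX x(1) SB[OF f(1)]] SB[OF g(1)]])
    then have "?y \<in> X" by (rule bimod_right[OF bX bimod_left[OF bX _ B_V] B_V])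
    moreover have "?y - W q \<in> X" using qP PX by blast
    ultimately have "W q \<in> X" using bimod_diff_iff[OF bX, of ?y "W q"] by blast
    with 1 show thesis using that by blast
  qed
  have mult: "W (a * b) \<in> Y" if "algebra_ideal Y" "W b \<in> Y" for a b Y
    using ideal_cgr[OF that(1) W_mult[of a b]] bimod_left[OF ideal_bimod[OF that(1)] that(2), of "W a"] by blast
  obtain p0 where "W (pCons 1 p0) \<in> P" using ex_poly by blast
  \<comment> \<open>Nonzero polynomials of least degree, here p for \<open>P\<close> and below g for
    \<open>X\<close>, generate the two ideals.\<close>
  then obtain p where p: "W p \<in> P \<and> p \<noteq> 0" and p_least: "\<And>p'. W p' \<in> P \<and> p' \<noteq> 0 \<Longrightarrow> degree p \<le> degree p'"
    using ex_has_least_nat[of "\<lambda>p. W p \<in> P \<and> p \<noteq> 0" "pCons 1 p0" degree] by auto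
  have "q \<noteq> 0" using q bimod_zero[OF bP] by (auto simp: W_0)
  then obtain g where g: "W g \<in> X \<and> g \<noteq> 0" and g_least: "\<And>g'. W g' \<in> X \<and> g' \<noteq> 0 \<Longrightarrow> degree g \<le> degree g'"
    using ex_has_least_nat[of "\<lambda>p. W p \<in> X \<and> p \<noteq> 0" q degree] q by auto
  have g_dvd: "g dvd h" if "W h \<in> X" for h
  proof (rule ccontr)
    assume ndvd: "\<not> g dvd h"
    have "W (h mod g) = W h - W (h div g * g)"
      by (simp add: W_diff[symmetric] minus_div_mult_eq_mod)
    then have "W (h mod g) \<in> X"
      using that mult[OF X, of g "h div g"] g bimod_diff[OF bX] by simp
    then have "degree g \<le> degree (h mod g)" using g_least[of "h mod g"] ndvd by (auto simp: mod_eq_0_iff_dvd)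
    moreover have "degree (h mod g) < degree g"
      using degree_mod_less[of g h] g ndvd by (auto simp: mod_eq_0_iff_dvd)
    ultimately show False by simp
  qed
  obtain h where h: "p = g * h" using g_dvd[of p] p PX by (auto elim: dvdE)
  have "W g \<notin> P"
  proof
    assume "W g \<in> P"
    moreover obtain b where "q = b * g" using g_dvd[OF q(1)] by (metis dvdE mult.commute)
    ultimately show False using mult[OF idP, of g b] q(2) by simp
  qed
  \<comment> \<open>The generator g of the larger ideal is not sent into \<open>P\<close>, so its
    cofactor h in p is. Since p has least degree, g must be constant.\<close>
  then have "W h \<in> P" using W_prime[of g h] p h by auto
  moreover have "h \<noteq> 0" using p h by auto
  ultimately have "degree p \<le> degree h" by (intro p_least) auto
  moreover have "degree p = degree g + degree h" using h g \<open>h \<noteq> 0\<close> by (simp add: degree_mult_eq)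
  ultimately have "degree g = 0" by simp
  then obtain a where a: "g = [:a:]" by (auto elim: degree_eq_zeroE)
  with g have "a \<noteq> 0" by auto
  then have "[:1 / a:] * g = 1" using a by (simp add: one_pCons)
  then show ?thesis using mult[OF X, of g "[:1 / a:]"] g by (simp add: W_1)
qed

end

context cohn_family
begin

theorem prime_cover:
  assumes P: "algebra_prime P"
  shows "\<exists>G. algebra_ideal G \<and> P \<subseteq> G \<and> (\<forall>x \<in> G. \<exists>g \<in> G. g * x \<doteq> x) \<and>
    (\<forall>X. algebra_ideal X \<and> \<not> X \<subseteq> P \<longrightarrow> (\<forall>g \<in> G. \<exists>x \<in> X. \<exists>p \<in> P. g = x + p))"
proof -
  have idP: "algebra_ideal P" using P by (simp add: algebra_prime_def)
  note bP = ideal_bimod[OF idP]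
  define W where "W = {rest v F | v F. v \<in> verts E \<and> finite F \<and> F \<subseteq> out_arcs E v \<and> rest v F \<in> P} \<union> V ` {v. good P v}"
  have "V v \<in> rests" if "good P v" for v
    using that by (auto simp: rests_def good_def rest_empty intro!: exI[of _ v] exI[of _ "{}"])
  then have W: "W \<subseteq> rests" by (auto simp: W_def rests_def)
  let ?G = "genideal W"
  have G: "algebra_ideal ?G" using W rests_subset_S by (intro ideal_genideal) auto
  have PG: "P \<subseteq> ?G"
  proof (rule ccontr)
    assume "\<not> P \<subseteq> ?G"
    moreover have "rest v F \<in> ?G" if "finite F" "F \<subseteq> out_arcs E v" "rest v F \<in> P" for v F
    proof (cases "v \<in> verts E")
      case True
      then show ?thesis using that by (intro genideal.gen) (auto simp: W_def)
    next
      case False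
      then have "F = {}" using that(2) tail_in_verts by fastforce
      then show ?thesis using False by (simp add: rest_empty V_outside genideal.rel Z_zero)
    qed
    ultimately obtain v where "good P v" "V v \<notin> ?G" using ex_good[OF idP G] by blast
    then show False using genideal.gen[of "V v" W] by (auto simp: W_def)
  qed
  have cover: "\<exists>x \<in> X. \<exists>p \<in> P. g = x + p" if X: "algebra_ideal X" "\<not> X \<subseteq> P" and g: "g \<in> ?G" for X g
  proof -
    note bX = ideal_bimod[OF X(1)]
    \<comment> \<open>As an ideal strictly above \<open>P\<close>, the sum of \<open>X\<close> and
      \<open>P\<close> contains all good vertices by \<open>vertex_in_larger\<close>; the diagonal
      idempotents in \<open>P\<close> belong to it through \<open>P\<close>.\<close>
    define Y where "Y = {x + p | x p. x \<in> X \<and> p \<in> P}"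
    have XY: "X \<subseteq> Y" using bimod_zero[OF bP] by (force simp: Y_def)
    have PY: "P \<subseteq> Y" using bimod_zero[OF bX] by (force simp: Y_def)
    have "bimod Y"
      unfolding bimod_def
    proof (intro conjI ballI)
      fix y z assume "y \<in> Y" "z \<in> Y"
      then obtain a p b q where "a \<in> X" "p \<in> P" "b \<in> X" "q \<in> P" "y = a + p" "z = b + q"
        by (auto simp: Y_def)
      then have "y + z = (a + b) + (p + q)" "a + b \<in> X" "p + q \<in> P"
        by (auto intro: bimod_add[OF bX] bimod_add[OF bP])
      then show "y + z \<in> Y" unfolding Y_def by blast
    next
      fix b y assume b: "b \<in> B" and "y \<in> Y"
      then obtain a p where *: "a \<in> X" "p \<in> P" "y = a + p" by (auto simp: Y_def)
      then have "b * y = b * a + b * p" "y * b = a * b + p * b" by (simp_all add: distrib_left distrib_right)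
      moreover have "b * a \<in> X" "b * p \<in> P" "a * b \<in> X" "p * b \<in> P"
        using * b by (auto intro: bimod_left[OF bX] bimod_left[OF bP] bimod_right[OF bX] bimod_right[OF bP])
      ultimately show "b * y \<in> Y" "y * b \<in> Y" unfolding Y_def by blast+
    qed (use PY bimod_zero[OF bP] in auto)
    moreover have "Y \<subseteq> S"
      using X(1) idP by (auto simp: Y_def algebra_ideal_def intro: bimod_add[OF bimod_S])
    ultimately have Y: "algebra_ideal Y" using PY idP by (auto simp: algebra_ideal_def)
    have YP: "\<not> Y \<subseteq> P" using XY X(2) by blast
    have "V v \<in> Y" if v: "good P v" for v
    proof -
      obtain c k d and I :: "('e list \<times> 'v) set" where *: "awalk v c v" "c \<noteq> []" "closed_family v I d"
        "closed_poly v I k d \<in> P" "\<And>p. awalk v p v \<Longrightarrow> p \<noteq> [] \<Longrightarrow> prefix c p"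
        using good_cycle[OF idP v] by metis
      interpret exitless_cycle E sc V ed gh Z P v c I k d
        by (unfold_locales, rule P, use v in \<open>simp add: good_def\<close>) (rule *; assumption)+
      show ?thesis by (rule vertex_in_larger[OF Y PY YP])
    qed
    then have "W \<subseteq> Y" using PY by (auto simp: W_def)
    then have "g \<in> Y" using genideal_least[OF Y] g by blast
    then show ?thesis by (auto simp: Y_def)
  qed
  show ?thesis
  proof (intro exI conjI ballI allI impI)
    show "algebra_ideal ?G" "P \<subseteq> ?G" by (rule G PG)+
    show "\<exists>g \<in> ?G. g * x \<doteq> x" if "x \<in> ?G" for x
      by (rule genideal_unit[OF W that])
    show "\<exists>x \<in> X. \<exists>p \<in> P. g = x + p" if "algebra_ideal X \<and> \<not> X \<subseteq> P" "g \<in> ?G" for X g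
      using that by (intro cover) blast+
  qed
qed

end

section \<open>Leavitt path algebras\<close>

lemma poly_mapping_sum_singles: "a = (\<Sum>w\<in>Poly_Mapping.keys a. Poly_Mapping.single w (Poly_Mapping.lookup a w))"
proof (rule poly_mapping_eqI)
  fix k
  show "Poly_Mapping.lookup a k =
    Poly_Mapping.lookup (\<Sum>w\<in>Poly_Mapping.keys a. Poly_Mapping.single w (Poly_Mapping.lookup a w)) k"
    by (auto simp: lookup_sum lookup_single when_def in_keys_iff)
qed

text \<open>Scalars sit on the empty word, which is neutral for concatenation on both sides.\<close>

lemma scalar_commute:
  fixes x :: "('x, 'k::field) free_alg"
  shows "Poly_Mapping.single 0 k * x = x * Poly_Mapping.single 0 k"
  by (subst (1 2) poly_mapping_sum_singles[of x])
    (simp add: sum_distrib_left sum_distrib_right mult_single mult.commute)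

locale graph_algebra = wf_digraph E for E :: "('v, 'e) pre_digraph" +
  fixes K :: "'k::field itself"
begin

abbreviation "Gens \<equiv> lpa_gens E"
abbreviation "Free \<equiv> (free_algebra Gens :: ('k, (('v, 'e) lpa_gen, 'k) free_alg) module)"
abbreviation "N \<equiv> gen_ideal Free (lpa_rels E)"
abbreviation "L \<equiv> leavitt_path_algebra K E"

definition sc :: "'k \<Rightarrow> (('v, 'e) lpa_gen, 'k) free_alg" where
  "sc k = Poly_Mapping.single 0 k"

text \<open>Extending the generators by zero makes most relations hold without side conditions.\<close>

definition V :: "'v \<Rightarrow> (('v, 'e) lpa_gen, 'k) free_alg" where
  "V v = (if v \<in> verts E then vx v else 0)"

definition D :: "'e \<Rightarrow> (('v, 'e) lpa_gen, 'k) free_alg" where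
  "D e = (if e \<in> arcs E then ed e else 0)"

definition D' :: "'e \<Rightarrow> (('v, 'e) lpa_gen, 'k) free_alg" where
  "D' e = (if e \<in> arcs E then gh e else 0)"

abbreviation "Alg \<equiv> subalgebra sc (range V \<union> range D \<union> range D')"

section \<open>Words over the generators and the ideal of relations\<close>

definition unital :: "(('v, 'e) lpa_gen, 'k) free_alg set" where
  "unital = {a. \<forall>w \<in> Poly_Mapping.keys a. set (letters w) \<subseteq> Gens}"

definition F :: "(('v, 'e) lpa_gen, 'k) free_alg set" where
  "F = {a. \<forall>w \<in> Poly_Mapping.keys a. letters w \<noteq> [] \<and> set (letters w) \<subseteq> Gens}"

lemma Free_simps [simp]:
  "carrier Free = F" "a \<otimes>\<^bsub>Free\<^esub> b = a * b" "a \<oplus>\<^bsub>Free\<^esub> b = a + b"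
  "\<zero>\<^bsub>Free\<^esub> = 0" "c \<odot>\<^bsub>Free\<^esub> a = scale c a"
  by (simp_all add: free_algebra_def F_def)

lemma F_unital: "F \<subseteq> unital"
  by (auto simp: F_def unital_def)

lemma F_zero: "0 \<in> F"
  by (auto simp: F_def)

lemma F_add: "a \<in> F \<Longrightarrow> b \<in> F \<Longrightarrow> a + b \<in> F"
  using keys_add[of a b] by (auto simp: F_def)

lemma F_left: "a \<in> unital \<Longrightarrow> b \<in> F \<Longrightarrow> a * b \<in> F"
  using keys_mult[of a b] by (fastforce simp: F_def unital_def plus_word_def)

lemma F_right: "a \<in> unital \<Longrightarrow> b \<in> F \<Longrightarrow> b * a \<in> F"
  using keys_mult[of b a] by (fastforce simp: F_def unital_def plus_word_def)

lemma F_gen: "x \<in> Gens \<Longrightarrow> gen x \<in> F"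
  by (simp add: F_def gen_def)

lemma unital_sc: "sc k \<in> unital"
  by (auto simp: unital_def sc_def zero_word_def)

lemma unital_add: "a \<in> unital \<Longrightarrow> b \<in> unital \<Longrightarrow> a + b \<in> unital"
  using keys_add[of a b] by (auto simp: unital_def)

lemma unital_mult: "a \<in> unital \<Longrightarrow> b \<in> unital \<Longrightarrow> a * b \<in> unital"
  using keys_mult[of a b] by (fastforce simp: unital_def plus_word_def)

lemma V_F: "V v \<in> F" and D_F: "D e \<in> F" and D'_F: "D' e \<in> F"
  by (auto simp: V_def D_def D'_def lpa_gens_def F_zero intro!: F_gen)

lemma Alg_unital: "Alg \<subseteq> unital"
proof
  fix a assume "a \<in> Alg"
  then show "a \<in> unital"
    by induction (use V_F D_F D'_F F_unital in \<open>auto intro: unital_sc unital_add unital_mult\<close>)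
qed

lemma F_minus: "a \<in> F \<Longrightarrow> - a \<in> F"
  by (simp add: F_def)

lemma F_diff: "a \<in> F \<Longrightarrow> b \<in> F \<Longrightarrow> a - b \<in> F"
  using F_add[of a "- b"] F_minus[of b] by simp

lemma F_sum: "(\<And>i. i \<in> A \<Longrightarrow> f i \<in> F) \<Longrightarrow> sum f A \<in> F"
  by (induction A rule: infinite_finite_induct) (auto simp: F_zero F_add)

lemma F_mult: "a \<in> F \<Longrightarrow> b \<in> F \<Longrightarrow> a * b \<in> F"
  using F_left F_unital by blast

lemma rels_F: "lpa_rels E \<subseteq> F"
proof -
  have g: "vx v \<in> F" if "v \<in> verts E" for v using that by (intro F_gen) (simp add: lpa_gens_def)
  have e: "ed e \<in> F" "gh e \<in> F" if "e \<in> arcs E" for e using that by (auto intro!: F_gen simp: lpa_gens_def)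
  show ?thesis
    unfolding lpa_rels_def
    by (auto intro!: F_diff F_mult F_sum g e simp: regular_vertex_def)
qed

lemma N_F: "N \<subseteq> F"
proof
  fix a assume "a \<in> N"
  then show "a \<in> F"
  proof induction
    case (smult a c)
    then show ?case using F_left[OF unital_sc] by (simp add: scale_def sc_def)
  qed (use rels_F F_zero F_add F_mult in auto)
qed

lemma N_add: "a \<in> N \<Longrightarrow> b \<in> N \<Longrightarrow> a + b \<in> N"
  and N_zero: "0 \<in> N"
  and N_F_left: "a \<in> N \<Longrightarrow> x \<in> F \<Longrightarrow> x * a \<in> N"
  and N_F_right: "a \<in> N \<Longrightarrow> x \<in> F \<Longrightarrow> a * x \<in> N"
  and N_scale: "a \<in> N \<Longrightarrow> sc k * a \<in> N"
  using gen_ideal.add[of a Free "lpa_rels E" b] gen_ideal.zero[of Free "lpa_rels E"]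
    gen_ideal.l_mult[of a Free "lpa_rels E" x] gen_ideal.r_mult[of a Free "lpa_rels E" x]
    gen_ideal.smult[of a Free "lpa_rels E" k]
  by (auto simp: scale_def sc_def)

text \<open>\<open>gen_ideal\<close> absorbs factors from the non-unital algebra and scalars, and
  these generate \<open>Alg\<close>.\<close>

lemma N_Alg: "b \<in> Alg \<Longrightarrow> a \<in> N \<Longrightarrow> b * a \<in> N \<and> a * b \<in> N"
proof (induction b arbitrary: a rule: subalgebra.induct)
  case (scalar k)
  then show ?case using N_scale[of a k] by (simp add: sc_def scalar_commute)
next
  case (gen b)
  then show ?case using V_F D_F D'_F by (auto intro: N_F_left N_F_right)
next
  case (add b c)
  then show ?case by (auto simp: distrib_left distrib_right intro: N_add)
next
  case (mult b c)
  then have "b * (c * a) \<in> N" "(a * b) * c \<in> N" by blast+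
  then show ?case by (simp add: mult.assoc)
qed

lemma rel_N: "a \<in> lpa_rels E \<Longrightarrow> a \<in> N"
  by (rule gen_ideal.gen)

lemma single_Word_singleton: "Poly_Mapping.single (Word [x]) c = sc c * gen x"
  by (simp add: sc_def gen_def mult_single)

lemma single_Word_Cons: "Poly_Mapping.single (Word (x # xs)) c = gen x * Poly_Mapping.single (Word xs) c"
  by (simp add: gen_def mult_single plus_word_def)

lemma gen_cases:
  assumes "x \<in> Gens"
  shows "(\<exists>v. gen x = V v) \<or> (\<exists>e. gen x = D e) \<or> (\<exists>e. gen x = D' e)"
proof -
  consider v where "v \<in> verts E" "x = Vertex v" | e where "e \<in> arcs E" "x = Edge e"
    | e where "e \<in> arcs E" "x = Ghost e"
    using assms by (auto simp: lpa_gens_def)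
  then show ?thesis
  proof cases
    case 1 then show ?thesis by (intro disjI1 exI[of _ v]) (simp add: V_def)
  next
    case 2 then show ?thesis by (intro disjI2 disjI1 exI[of _ e]) (simp add: D_def)
  next
    case 3 then show ?thesis by (intro disjI2 exI[of _ e]) (simp add: D'_def)
  qed
qed

lemma single_Word:
  "xs \<noteq> [] \<Longrightarrow> set xs \<subseteq> Gens \<Longrightarrow> Poly_Mapping.single (Word xs) c \<in> Alg"
proof (induction xs arbitrary: c)
  case (Cons x xs)
  have x: "gen x \<in> Alg"
  proof -
    have "gen x \<in> range V \<union> range D \<union> range D'"
      using gen_cases[of x] Cons.prems(2) by auto
    then show ?thesis by (rule subalgebra.gen)
  qed
  show ?case
  proof (cases "xs = []")
    case True
    then show ?thesis
      using subalgebra.mult[OF subalgebra.scalar x, of c] by (simp add: single_Word_singleton)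
  next
    case False
    then show ?thesis
      using subalgebra.mult[OF x Cons.IH[OF False, of c]] Cons.prems by (simp add: single_Word_Cons)
  qed
qed simp

lemma F_Alg: "F \<subseteq> Alg"
proof
  fix a assume a: "a \<in> F"
  have z: "0 \<in> Alg" using subalgebra.scalar[of sc 0] by (simp add: sc_def)
  have "(\<Sum>w\<in>A. Poly_Mapping.single w (Poly_Mapping.lookup a w)) \<in> Alg" if "finite A" "A \<subseteq> Poly_Mapping.keys a" for A
    using that
  proof (induction A rule: finite_induct)
    case (insert w A)
    have "Poly_Mapping.single (Word (letters w)) (Poly_Mapping.lookup a w) \<in> Alg"
      using a insert.prems by (intro single_Word) (auto simp: F_def)
    then show ?case using insert by (auto intro: subalgebra.add)
  qed (simp add: z)
  from this[OF finite_keys order_refl] show "a \<in> Alg"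
    by (rule ssubst[of a _ "\<lambda>y. y \<in> Alg", OF poly_mapping_sum_singles])
qed

text \<open>The ideal \<open>N\<close> takes the part of \<open>Z\<close>. It contains the relation
  at each regular vertex, so there the diagonal idempotent over all outgoing edges is congruent to
  zero.\<close>

sublocale C: cohn_family E sc V D D' N
proof unfold_locales
  show "sc (k + l) = sc k + sc l" for k l by (simp add: sc_def single_add)
  show "sc (k * l) = sc k * sc l" for k l by (simp add: sc_def mult_single)
  show "sc 1 = 1" by (simp add: sc_def)
  show "sc k * x = x * sc k" for k x by (simp add: sc_def scalar_commute)
  show "N \<subseteq> Alg" using N_F F_Alg by blast
  show "V v * V v - V v \<in> N" for v
    by (auto simp: V_def N_zero intro!: rel_N) (auto simp: lpa_rels_def)
  show "V v * V w \<in> N" if "v \<noteq> w" for v w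
    using that by (auto simp: V_def N_zero intro!: rel_N) (auto simp: lpa_rels_def)
  show "V (tail E e) * D e - D e \<in> N" for e
    by (auto simp: V_def D_def N_zero intro!: rel_N) (auto simp: lpa_rels_def)
  show "D e * V (head E e) - D e \<in> N" for e
    by (auto simp: V_def D_def N_zero intro!: rel_N) (auto simp: lpa_rels_def)
  show "V (head E e) * D' e - D' e \<in> N" for e
    by (auto simp: V_def D'_def N_zero intro!: rel_N) (auto simp: lpa_rels_def)
  show "D' e * V (tail E e) - D' e \<in> N" for e
    by (auto simp: V_def D'_def N_zero intro!: rel_N) (auto simp: lpa_rels_def)
  show "D' e * D e - V (head E e) \<in> N" if "e \<in> arcs E" for e
    using that by (auto simp: V_def D_def D'_def N_zero intro!: rel_N) (auto simp: lpa_rels_def)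
  show "D' e * D f \<in> N" if "e \<noteq> f" for e f
    using that by (auto simp: D_def D'_def N_zero intro!: rel_N) (auto simp: lpa_rels_def)
qed (use N_Alg N_add N_zero in \<open>auto simp: V_def D_def D'_def\<close>)

text \<open>A nonempty word is a generator times a scalar or a further word; \<open>S\<close>
  contains the generators and absorbs \<open>Alg\<close>. Conversely, real paths are products of at
  least one vertex or edge, so the empty word does not occur.\<close>

lemma S_eq_F: "C.S = F"
proof (intro equalityI subsetI)
  fix x assume "x \<in> F"
  then have "x \<in> Alg" using F_Alg by blast
  show "x \<in> C.S"
  proof -
    have single: "Poly_Mapping.single (Word xs) c \<in> C.S" if nonempty: "xs \<noteq> []" and Gens: "set xs \<subseteq> Gens" for xs c
    proof -
      obtain y ys where xs: "xs = y # ys" using nonempty by (cases xs) auto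
      have y: "gen y \<in> C.S"
        using gen_cases[of y] Gens C.V_S C.ed_S C.gh_S unfolding xs by auto
      show ?thesis
      proof (cases "ys = []")
        case True
        then show ?thesis using C.S.scal[OF y, of c] xs by (simp only: single_Word_singleton)
      next
        case False
        then have "Poly_Mapping.single (Word ys) c \<in> Alg"
          using single_Word[of ys c] Gens xs by auto
        from C.bimod_right[OF C.bimod_S y this] show ?thesis
          unfolding xs single_Word_Cons .
      qed
    qed
    have "(\<Sum>w\<in>A. Poly_Mapping.single w (Poly_Mapping.lookup x w)) \<in> C.S" if "A \<subseteq> Poly_Mapping.keys x" for A
    proof (rule C.bimod_sum[OF C.bimod_S])
      fix w assume "w \<in> A"
      then show "Poly_Mapping.single w (Poly_Mapping.lookup x w) \<in> C.S"
        using single[of "letters w" "Poly_Mapping.lookup x w"] \<open>x \<in> F\<close> that by (auto simp: F_def)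
    qed
    from this[OF order_refl] show ?thesis
      by (rule ssubst[of x _ "\<lambda>y. y \<in> C.S", OF poly_mapping_sum_singles])
  qed
next
  fix x assume "x \<in> C.S"
  then show "x \<in> F"
  proof induction
    case (mono u p w v q)
    have "C.pa p u \<in> F" for p u
    proof (induction p arbitrary: u)
      case (Cons e p)
      then show ?case using F_mult[OF D_F Cons.IH] by simp
    qed (simp add: V_F)
    then show ?case by (rule F_right[OF subsetD[OF Alg_unital C.gp_B]])
  next
    case (rel z)
    then show ?case using N_F by blast
  next
    case (scal x k)
    show ?case by (rule F_left[OF unital_sc scal.IH])
  next
    case (add x y)
    show ?case by (rule F_add[OF add.IH])
  qed
qed

section \<open>Cosets and the ring structure of the quotient\<close>

definition cls :: "(('v, 'e) lpa_gen, 'k) free_alg \<Rightarrow> (('v, 'e) lpa_gen, 'k) free_alg set" where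
  "cls a = {n + a | n. n \<in> N}"

lemma cls_eq_iff: "cls a = cls b \<longleftrightarrow> a - b \<in> N"
proof
  assume "cls a = cls b"
  moreover have "a \<in> cls a" using N_zero by (force simp: cls_def)
  ultimately obtain n where "a = n + b" "n \<in> N" by (auto simp: cls_def)
  then show "a - b \<in> N" by simp
next
  assume ab: "a - b \<in> N"
  have "cls a \<subseteq> cls b" if "a - b \<in> N" for a b
  proof
    fix x assume "x \<in> cls a"
    then obtain n where n: "n \<in> N" "x = n + a" by (auto simp: cls_def)
    then have "x = (n + (a - b)) + b" by simp
    then show "x \<in> cls b" using N_add[OF n(1) that] unfolding cls_def by blast
  qed
  from this[OF ab] this[OF C.bimod_sym[OF C.bimod_Z ab]] show "cls a = cls b" by blast
qed

lemma coset_cls: "N +>\<^bsub>Free\<^esub> a = cls a"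
  by (auto simp: a_r_coset_def r_coset_def cls_def)

lemma carrier_L: "carrier L = cls ` F"
  by (auto simp: leavitt_path_algebra_def quot_algebra_def FactRing_def A_RCOSETS_def' coset_cls)

lemma zero_L: "\<zero>\<^bsub>L\<^esub> = cls 0"
  by (auto simp: leavitt_path_algebra_def quot_algebra_def FactRing_def cls_def)

lemma add_L: "cls a \<oplus>\<^bsub>L\<^esub> cls b = cls (a + b)"
proof -
  have "cls a \<oplus>\<^bsub>L\<^esub> cls b = {x + y | x y. x \<in> cls a \<and> y \<in> cls b}"
    by (auto simp: leavitt_path_algebra_def quot_algebra_def FactRing_def set_add_def set_mult_def)
  also have "\<dots> = cls (a + b)"
  proof (intro equalityI subsetI)
    fix z assume "z \<in> {x + y | x y. x \<in> cls a \<and> y \<in> cls b}"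
    then obtain n k where nk: "n \<in> N" "k \<in> N" "z = (n + a) + (k + b)" by (auto simp: cls_def)
    then have "z = (n + k) + (a + b)" by (simp add: algebra_simps)
    then show "z \<in> cls (a + b)" using N_add[OF nk(1,2)] by (auto simp: cls_def)
  next
    fix z assume "z \<in> cls (a + b)"
    then obtain n where n: "n \<in> N" "z = n + (a + b)" by (auto simp: cls_def)
    then have "z = (n + a) + (0 + b)" by simp
    then show "z \<in> {x + y | x y. x \<in> cls a \<and> y \<in> cls b}"
      using n(1) N_zero by (force simp: cls_def)
  qed
  finally show ?thesis .
qed

text \<open>The product of cosets is a union over all pairs of representatives; every pair
  contributes the same coset.\<close>

lemma mult_L:
  assumes "a \<in> F" "b \<in> F"
  shows "cls a \<otimes>\<^bsub>L\<^esub> cls b = cls (a * b)"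
proof -
  have eq: "cls (x * y) = cls (a * b)" if x: "x \<in> cls a" and y: "y \<in> cls b" for x y
  proof -
    have d: "x - a \<in> N" "y - b \<in> N" using x y by (auto simp: cls_def)
    obtain n where "n \<in> N" "y = n + b" using y by (auto simp: cls_def)
    then have "y \<in> F" using assms(2) N_F F_add by blast
    then have "y \<in> Alg" "a \<in> Alg" using assms(1) F_Alg by blast+
    from C.bimod_mult[OF C.bimod_Z d this] show ?thesis by (simp only: cls_eq_iff)
  qed
  have "cls a \<noteq> {}" "cls b \<noteq> {}" using N_zero by (auto simp: cls_def)
  moreover have "cls a \<otimes>\<^bsub>L\<^esub> cls b = (\<Union>x\<in>cls a. \<Union>y\<in>cls b. cls (x * y))"
    by (simp add: leavitt_path_algebra_def quot_algebra_def FactRing_def rcoset_mult_def coset_cls)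
  moreover have "(\<Union>x\<in>cls a. \<Union>y\<in>cls b. cls (x * y)) = (\<Union>x\<in>cls a. \<Union>y\<in>cls b. cls (a * b))"
    by (intro SUP_cong refl eq)
  ultimately show ?thesis by simp
qed

lemma nonunital_ring_L: "nonunital_ring L"
proof -
  have "abelian_group L"
  proof (rule abelian_groupI)
    show "\<exists>y \<in> carrier L. y \<oplus>\<^bsub>L\<^esub> x = \<zero>\<^bsub>L\<^esub>" if "x \<in> carrier L" for x
    proof -
      obtain a where a: "a \<in> F" "x = cls a" using \<open>x \<in> carrier L\<close> by (auto simp: carrier_L)
      then have "cls (- a) \<oplus>\<^bsub>L\<^esub> x = \<zero>\<^bsub>L\<^esub>" by (simp add: add_L zero_L)
      then show ?thesis using a F_minus by (auto simp: carrier_L)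
    qed
  qed (auto simp: carrier_L add_L zero_L F_add F_zero add_ac)
  then show "nonunital_ring L"
    by (rule nonunital_ring.intro)
      (unfold_locales, auto simp: carrier_L add_L mult_L F_mult F_add mult.assoc distrib_left distrib_right)
qed

sublocale L: nonunital_ring L
  by (rule nonunital_ring_L)

section \<open>Ideals and primes of the quotient in terms of representatives\<close>

definition lift :: "(('v, 'e) lpa_gen, 'k) free_alg set set \<Rightarrow> (('v, 'e) lpa_gen, 'k) free_alg set" where
  "lift X = {a \<in> F. cls a \<in> X}"

lemma cls_carrier: "a \<in> F \<Longrightarrow> cls a \<in> carrier L"
  unfolding carrier_L by (rule imageI)

lemma carrier_clsE:
  assumes "x \<in> carrier L"
  obtains a where "a \<in> F" "x = cls a"
  using assms unfolding carrier_L by blast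

lemma lift_iff: "a \<in> lift X \<longleftrightarrow> a \<in> F \<and> cls a \<in> X"
  by (simp add: lift_def)

text \<open>An ideal of the ring \<open>L\<close> is not assumed to be a subspace; local units make
  it one. With a left unit u of x, b x agrees with (b u) x modulo \<open>N\<close>, and
  \<open>b * u\<close> lies in \<open>F\<close> even if b is a scalar. Right units serve for x
  b.\<close>

lemma ideal_lift:
  assumes X: "two_sided_ideal L X"
  shows "C.algebra_ideal (lift X)"
proof -
  have "N \<subseteq> lift X"
  proof
    fix n assume n: "n \<in> N"
    then have "cls n = cls 0" by (simp add: cls_eq_iff)
    with n show "n \<in> lift X"
      using L.tsi_zero[OF X] N_F unfolding lift_iff zero_L by (metis subsetD)
  qed
  moreover have "C.bimod (lift X)"
    unfolding C.bimod_def
  proof (intro conjI ballI)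
    show "0 \<in> lift X" using L.tsi_zero[OF X] F_zero unfolding lift_iff zero_L by blast
  next
    fix x y assume "x \<in> lift X" "y \<in> lift X"
    then have "x + y \<in> F" "cls x \<oplus>\<^bsub>L\<^esub> cls y \<in> X"
      using F_add L.tsi_add[OF X] unfolding lift_iff by blast+
    then show "x + y \<in> lift X" unfolding lift_iff add_L by blast
  next
    fix b x assume b: "b \<in> Alg" and x: "x \<in> lift X"
    then have xF: "x \<in> F" and xX: "cls x \<in> X" and bu: "b \<in> unital"
      using Alg_unital unfolding lift_iff by blast+
    obtain u where u: "u \<in> F" "u * x - x \<in> N"
      using C.S_left_unit[of x] xF unfolding S_eq_F C.cgr_def by blast
    obtain u' where u': "u' \<in> F" "x * u' - x \<in> N"
      using C.S_right_unit[of x] xF unfolding S_eq_F C.cgr_def by blast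
    have "cls ((b * u) * x) = cls (b * x)"
      using C.bimod_left[OF C.bimod_Z u(2) b]
      by (simp only: cls_eq_iff right_diff_distrib mult.assoc)
    moreover have "cls (b * u) \<otimes>\<^bsub>L\<^esub> cls x \<in> X"
      by (rule L.tsi_lmult[OF X xX cls_carrier[OF F_left[OF bu u(1)]]])
    ultimately have "cls (b * x) \<in> X" by (simp only: mult_L[OF F_left[OF bu u(1)] xF])
    then show "b * x \<in> lift X" unfolding lift_iff using F_left[OF bu xF] by blast
    have "cls (x * (u' * b)) = cls (x * b)"
      using C.bimod_right[OF C.bimod_Z u'(2) b]
      by (simp only: cls_eq_iff left_diff_distrib mult.assoc)
    moreover have "cls x \<otimes>\<^bsub>L\<^esub> cls (u' * b) \<in> X"
      by (rule L.tsi_rmult[OF X xX cls_carrier[OF F_right[OF bu u'(1)]]])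
    ultimately have "cls (x * b) \<in> X" by (simp only: mult_L[OF xF F_right[OF bu u'(1)]])
    then show "x * b \<in> lift X" unfolding lift_iff using F_right[OF bu xF] by blast
  qed
  ultimately show ?thesis unfolding C.algebra_ideal_def S_eq_F using lift_iff by blast
qed

lemma prime_lift:
  assumes P: "prime_ideal L P"
  shows "C.algebra_prime (lift P)"
  unfolding C.algebra_prime_def S_eq_F
proof (intro conjI ballI impI)
  show "C.algebra_ideal (lift P)" by (rule ideal_lift[OF L.prime_idealD(1)[OF P]])
  have units: "\<exists>u \<in> carrier L. u \<otimes>\<^bsub>L\<^esub> y = y" if y: "y \<in> carrier L" for y
  proof -
    obtain a where a: "a \<in> F" "y = cls a" using y by (rule carrier_clsE)
    obtain u where u: "u \<in> F" "u * a - a \<in> N"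
      using C.S_left_unit[of a] a(1) unfolding S_eq_F C.cgr_def by blast
    have "cls u \<otimes>\<^bsub>L\<^esub> y = y"
      unfolding a(2) mult_L[OF u(1) a(1)] cls_eq_iff by (rule u(2))
    then show ?thesis using cls_carrier[OF u(1)] by blast
  qed
  fix a b assume a: "a \<in> F" and b: "b \<in> F" and prod: "\<forall>f \<in> F. a * f * b \<in> lift P"
  have "cls a \<otimes>\<^bsub>L\<^esub> x \<otimes>\<^bsub>L\<^esub> cls b \<in> P" if x: "x \<in> carrier L" for x
  proof -
    obtain f where f: "f \<in> F" "x = cls f" using x by (rule carrier_clsE)
    show ?thesis
      unfolding f(2) mult_L[OF a f(1)] mult_L[OF F_mult[OF a f(1)] b] using prod f(1) lift_iff by blast
  qed
  from L.prime_elementwise[OF P units cls_carrier[OF a] cls_carrier[OF b] this]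
  show "a \<in> lift P \<or> b \<in> lift P" unfolding lift_iff using a b by blast
qed

sublocale L: covered_primes_ring L
proof
  fix P assume P: "prime_ideal L P"
  note idP = L.prime_idealD(1)[OF P]
  from C.prime_cover[OF prime_lift[OF P]] obtain G where G: "C.algebra_ideal G" "lift P \<subseteq> G"
    "\<forall>x \<in> G. \<exists>g \<in> G. C.cgr (g * x) x"
    "\<forall>X. C.algebra_ideal X \<and> \<not> X \<subseteq> lift P \<longrightarrow> (\<forall>g \<in> G. \<exists>x \<in> X. \<exists>p \<in> lift P. g = x + p)"
    by (elim exE conjE)
  have GF: "G \<subseteq> F" using G(1) unfolding C.algebra_ideal_def S_eq_F by blast
  have "P \<subseteq> cls ` G"
  proof
    fix x assume x: "x \<in> P"
    then have "x \<in> carrier L" using L.tsi_subset[OF idP] by blast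
    then obtain a where "a \<in> F" "x = cls a" by (rule carrier_clsE)
    with x G(2) show "x \<in> cls ` G" using lift_iff by blast
  qed
  moreover have "\<forall>x \<in> cls ` G. \<exists>g \<in> cls ` G. g \<otimes>\<^bsub>L\<^esub> x = x"
  proof
    fix x assume "x \<in> cls ` G"
    then obtain a where a: "a \<in> G" "x = cls a" by blast
    then obtain g where g: "g \<in> G" "g * a - a \<in> N" using G(3) unfolding C.cgr_def by blast
    have "g \<in> F" "a \<in> F" using a g GF by blast+
    then have "cls g \<otimes>\<^bsub>L\<^esub> x = x" unfolding a(2) using g(2) by (simp only: mult_L cls_eq_iff)
    with g show "\<exists>g \<in> cls ` G. g \<otimes>\<^bsub>L\<^esub> x = x" by blast
  qed
  moreover have "cls ` G \<subseteq> X <+>\<^bsub>L\<^esub> P" if X: "two_sided_ideal L X" "\<not> X \<subseteq> P" for X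
  proof
    fix y assume "y \<in> cls ` G"
    then obtain g where g: "g \<in> G" "y = cls g" by blast
    obtain z where "z \<in> X" "z \<notin> P" using X(2) by blast
    moreover from this have "z \<in> carrier L" using L.tsi_subset[OF X(1)] by blast
    then obtain b where "b \<in> F" "z = cls b" by (rule carrier_clsE)
    ultimately have "\<not> lift X \<subseteq> lift P" using lift_iff by blast
    then obtain x p where *: "x \<in> lift X" "p \<in> lift P" "g = x + p"
      using G(4) ideal_lift[OF X(1)] g(1) by blast
    then have "y = cls x \<oplus>\<^bsub>L\<^esub> cls p" using g(2) by (simp only: add_L)
    moreover have "cls x \<in> X" "cls p \<in> P" using * unfolding lift_iff by blast+
    ultimately show "y \<in> X <+>\<^bsub>L\<^esub> P" unfolding set_add_def' by blast
  qed
  ultimately show "\<exists>G. P \<subseteq> G \<and> (\<forall>x \<in> G. \<exists>g \<in> G. g \<otimes>\<^bsub>L\<^esub> x = x) \<and>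
      (\<forall>X. two_sided_ideal L X \<and> \<not> X \<subseteq> P \<longrightarrow> G \<subseteq> X <+>\<^bsub>L\<^esub> P)"
    by (intro exI[of _ "cls ` G"] conjI allI impI) (assumption | elim conjE, assumption)+
qed

end

theorem theorem3p13:
  fixes E :: "('v, 'e) pre_digraph"
    and P :: "nat \<Rightarrow> (('v, 'e) lpa_gen, 'k::field) free_alg set set"
    and Q :: "'j \<Rightarrow> (('v, 'e) lpa_gen, 'k) free_alg set set"
    and I :: "(('v, 'e) lpa_gen, 'k) free_alg set set"
    and r :: "nat \<Rightarrow> nat" and s :: "'j \<Rightarrow> nat"
    and m :: nat and J :: "'j set"
  defines "L \<equiv> leavitt_path_algebra TYPE('k) E"
  assumes "wf_digraph E"
    and "two_sided_ideal L I"
    and "\<And>i. i \<in> {1..m} \<Longrightarrow> prime_ideal L (P i)"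
    and "\<And>i. i \<in> {1..m} \<Longrightarrow> r i \<ge> 1"
    and "inj_on P {1..m}"
    and "\<And>j. j \<in> J \<Longrightarrow> prime_ideal L (Q j)"
    and "\<And>j. j \<in> J \<Longrightarrow> s j \<ge> 1"
    and "inj_on Q J"
    and "I = ideal_Inter L {1..m} (\<lambda>i. ideal_power L (P i) (r i))"
    and "irredundant L {1..m} (\<lambda>i. ideal_power L (P i) (r i))"
    and "I = ideal_Inter L J (\<lambda>j. ideal_power L (Q j) (s j))"
    and "irredundant L J (\<lambda>j. ideal_power L (Q j) (s j))"
  shows "finite J \<and> card J = m \<and>
    (\<lambda>i. ideal_power L (P i) (r i)) ` {1..m} = (\<lambda>j. ideal_power L (Q j) (s j)) ` J"
proof -
  interpret wf_digraph E by (rule assms(2))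
  interpret graph_algebra E "TYPE('k)" ..
  have "finite J \<and> card J = card {1..m} \<and>
    (\<lambda>i. ideal_power L (P i) (r i)) ` {1..m} = (\<lambda>j. ideal_power L (Q j) (s j)) ` J"
    unfolding L_def
    by (rule L.irredundant_prime_powers_unique)
      (use assms in \<open>simp_all add: L_def\<close>)
  then show ?thesis by simp
qed

end
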